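(* Let $q$ be a power of a prime. Then there exist involutions $\rho_0,\rho_1,\rho_2\in \mathrm{L}_2(q^3)$ such that $\rho_0$ and $\rho_2$ commute, $\langle \rho_0,\rho_1,\rho_2\rangle=\mathrm{L}_2(q^3)$, and the (reflexible) map generated by $\rho_0,\rho_1,\rho_2$ is a map of Class III.
   Context: $\mathrm{L}_2(q^3)=\mathrm{SL}(2,q^3)/Z(\mathrm{SL}(2,q^3))$ is the projective special linear group over the field with $q^3$ elements. A map is a 2-cell embedding of a graph into a closed surface without boundary. Its flags are the triples (vertex, edge, face) of pairwise incident elements. It is reflexible if its automorphism group $G$ has a unique orbit on flags. For a chosen flag $\{v,e,f\}$ of a reflexible map, $G$ is generated by three involutions $\rho_0,\rho_1,\rho_2$, where $\rho_0$ and $\rho_2$ commute and $\rho_0\rho_2$ has order 2: $\rho_0$ fixes $e,f$ and moves $v$ to the other end of $e$; $\rho_1$ fixes $v,f$ and moves $e$; $\rho_2$ fixes $v,e$ and moves $f$. Conversely, a group $G$ generated by such a triple of involutions $(\rho_0,\rho_1,\rho_2)$ (with $\rho_0\rho_2$ of order 2) determines a reflexible map, called the map generated by $\rho_0,\rho_1,\rho_2$, with automorphism group $G$. Two such maps, given by triples $(\rho_0,\rho_1,\rho_2)$ and $(\rho_0',\rho_1',\rho_2')$ generating $G$ and $G'$, are isomorphic if and only if there is a group isomorphism $G\to G'$ with $\rho_i\mapsto\rho_i'$ for $i=0,1,2$. Wilson's operations on reflexible maps are generated by the duality $D$, sending the triple $(\rho_0,\rho_1,\rho_2)$ to $(\rho_2,\rho_1,\rho_0)$,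 and the Petrie duality $P$, sending $(\rho_0,\rho_1,\rho_2)$ to $(\rho_0\rho_2,\rho_1,\rho_2)$. They generate a group isomorphic to $S_3$, and the six images of a map under it are given by the triples $(\rho_0,\rho_1,\rho_2)$, $(\rho_2,\rho_1,\rho_0)$, $(\rho_0\rho_2,\rho_1,\rho_2)$, $(\rho_0\rho_2,\rho_1,\rho_0)$, $(\rho_2,\rho_1,\rho_0\rho_2)$, $(\rho_0,\rho_1,\rho_0\rho_2)$. A reflexible map is of Class III if these six maps split into exactly two isomorphism classes, each containing three of them. Equivalently, the map is isomorphic to its images under the order-3 operations $DP$ and $PD$ (it has trialities), but not to its images under $D$, $P$ or $DPD=PDP$. In terms of generators: some automorphism of $G$ fixes $\rho_1$ and cyclically permutes $\rho_0,\rho_2,\rho_0\rho_2$, but no automorphism of $G$ fixes $\rho_1$ and interchanges two of $\rho_0,\rho_2,\rho_0\rho_2$ while fixing the third. *)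

theory Defs
  imports
    "HOL-Analysis.Determinants"
    "HOL-Algebra.Generated_Groups"
    "HOL-Number_Theory.Prime_Powers"
begin

definition SL :: "('a::field ^ 'n::finite ^ 'n) monoid" where
  "SL = \<lparr>carrier = {A. det A = 1}, mult = (**), one = mat 1\<rparr>"

definition group_centre :: "('a, 'b) monoid_scheme \<Rightarrow> 'a set" where
  "group_centre G = {z \<in> carrier G. \<forall>x \<in> carrier G. z \<otimes>\<^bsub>G\<^esub> x = x \<otimes>\<^bsub>G\<^esub> z}"

text \<open>The elements of \<open>L2\<close> are cosets of the centre. The field of definition is the type \<open>'a\<close>.\<close>

definition L2 :: "('a::field ^ 2 ^ 2) set monoid" where
  "L2 = SL Mod group_centre SL"

definition is_involution :: "('a, 'b) monoid_scheme \<Rightarrow> 'a \<Rightarrow> bool" where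
  "is_involution G x \<longleftrightarrow> x \<in> carrier G \<and> x \<noteq> \<one>\<^bsub>G\<^esub> \<and> x \<otimes>\<^bsub>G\<^esub> x = \<one>\<^bsub>G\<^esub>"


text \<open>
  A map on a closed surface is encoded by its flags and the three adjacency involutions on them:
  \<open>flip0\<close>, \<open>flip1\<close>, \<open>flip2\<close> send a flag to the neighbouring flag that differs from it only in the
  vertex, the edge, the face respectively. Vertices, edges and faces are the orbits of
  \<open>\<langle>flip1, flip2\<rangle>\<close>, \<open>\<langle>flip0, flip2\<rangle>\<close> and \<open>\<langle>flip0, flip1\<rangle>\<close>. The absence of fixed points says that
  the surface has no boundary, and that the edges have two ends and two sides; finiteness says
  that the surface is compact. The values of the flips outside \<open>flags\<close> are irrelevant.
\<close>

record 'f flag_map =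
  flags :: "'f set"
  flip0 :: "'f \<Rightarrow> 'f"
  flip1 :: "'f \<Rightarrow> 'f"
  flip2 :: "'f \<Rightarrow> 'f"

definition flag_step :: "'f flag_map \<Rightarrow> ('f \<times> 'f) set" where
  "flag_step M = {(x, y). x \<in> flags M \<and> y \<in> {flip0 M x, flip1 M x, flip2 M x}}"

definition is_map :: "'f flag_map \<Rightarrow> bool" where
  "is_map M \<longleftrightarrow>
     finite (flags M) \<and> flags M \<noteq> {} \<and>
     (\<forall>r \<in> {flip0 M, flip1 M, flip2 M}. \<forall>x \<in> flags M. r x \<in> flags M \<and> r x \<noteq> x \<and> r (r x) = x) \<and>
     (\<forall>x \<in> flags M. flip0 M (flip2 M x) = flip2 M (flip0 M x) \<and> flip0 M (flip2 M x) \<noteq> x) \<and>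
     (\<forall>x \<in> flags M. \<forall>y \<in> flags M. (x, y) \<in> (flag_step M)\<^sup>*)"

definition map_isos :: "'f flag_map \<Rightarrow> 'g flag_map \<Rightarrow> ('f \<Rightarrow> 'g) set" where
  "map_isos M N =
     {\<phi>. bij_betw \<phi> (flags M) (flags N) \<and>
         (\<forall>x \<in> flags M. \<phi> (flip0 M x) = flip0 N (\<phi> x) \<and>
                         \<phi> (flip1 M x) = flip1 N (\<phi> x) \<and>
                         \<phi> (flip2 M x) = flip2 N (\<phi> x))}"

definition map_isomorphic :: "'f flag_map \<Rightarrow> 'g flag_map \<Rightarrow> bool" where
  "map_isomorphic M N \<longleftrightarrow> map_isos M N \<noteq> {}"

definition reflexible :: "'f flag_map \<Rightarrow> bool" where
  "reflexible M \<longleftrightarrow> is_map M \<and> (\<forall>x \<in> flags M. \<forall>y \<in> flags M. \<exists>\<phi> \<in> map_isos M M. \<phi> x = y)"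

definition dual :: "'f flag_map \<Rightarrow> 'f flag_map" where
  "dual M = M\<lparr>flip0 := flip2 M, flip2 := flip0 M\<rparr>"

definition petrie :: "'f flag_map \<Rightarrow> 'f flag_map" where
  "petrie M = M\<lparr>flip0 := flip0 M \<circ> flip2 M\<rparr>"

definition wilson_images :: "'f flag_map \<Rightarrow> 'f flag_map list" where
  "wilson_images M =
     [M, dual M, petrie M, petrie (dual M), dual (petrie M), petrie (dual (petrie M))]"

text \<open>The six images are counted by their positions in the list.\<close>

definition wilson_iso :: "'f flag_map \<Rightarrow> (nat \<times> nat) set" where
  "wilson_iso M = {(i, j). i < 6 \<and> j < 6 \<and>
                     map_isomorphic (wilson_images M ! i) (wilson_images M ! j)}"

definition class_III :: "'f flag_map \<Rightarrow> bool" where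
  "class_III M \<longleftrightarrow>
     reflexible M \<and>
     card ({..<6} // wilson_iso M) = 2 \<and> (\<forall>C \<in> {..<6} // wilson_iso M. card C = 3)"


text \<open>
  With a base flag \<open>\<Phi>\<close> chosen, the flags \<open>g \<Phi>\<close> of a reflexible map correspond to the automorphisms
  \<open>g\<close>. As \<open>\<rho>\<^sub>i \<Phi>\<close> is the \<open>i\<close>-th neighbour of \<open>\<Phi>\<close>, the \<open>i\<close>-th neighbour of \<open>g \<Phi>\<close> is \<open>g \<rho>\<^sub>i \<Phi>\<close>.
\<close>

definition generated_map ::
    "('a, 'b) monoid_scheme \<Rightarrow> 'a \<Rightarrow> 'a \<Rightarrow> 'a \<Rightarrow> 'a flag_map" where
  "generated_map G \<rho>\<^sub>0 \<rho>\<^sub>1 \<rho>\<^sub>2 =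
     \<lparr>flags = carrier G,
      flip0 = (\<lambda>x. x \<otimes>\<^bsub>G\<^esub> \<rho>\<^sub>0), flip1 = (\<lambda>x. x \<otimes>\<^bsub>G\<^esub> \<rho>\<^sub>1), flip2 = (\<lambda>x. x \<otimes>\<^bsub>G\<^esub> \<rho>\<^sub>2)\<rparr>"


text \<open>
  The lemmas below are not needed for the definitions. They confirm that \<open>L2\<close> is a group and that
  flag maps of generating triples behave as expected: they are reflexible, their isomorphisms
  are those of the groups respecting the generators, and duality and Petrie duality act on the
  triples by the usual formulas.
\<close>

lemma group_SL: "group (SL :: ('a::field ^ 'n::finite ^ 'n) monoid)"
proof (rule groupI)
  fix A :: "'a ^ 'n ^ 'n"
  assume "A \<in> carrier SL"
  then have d: "det A = 1" by (simp add: SL_def)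
  then have "invertible A" by (simp add: invertible_det_nz)
  then obtain B where B: "B ** A = mat 1" by (auto simp: invertible_def)
  then have "det B * det A = 1" by (metis det_mul det_I)
  with d B show "\<exists>B \<in> carrier SL. B \<otimes>\<^bsub>SL\<^esub> A = \<one>\<^bsub>SL\<^esub>" by (auto simp: SL_def)
qed (auto simp: SL_def det_mul matrix_mul_assoc)

lemma (in group) centre_normal: "group_centre G \<lhd> G"
proof -
  have "subgroup (group_centre G) G"
  proof (rule subgroupI)
    fix z assume "z \<in> group_centre G"
    then have z: "z \<in> carrier G" "\<And>x. x \<in> carrier G \<Longrightarrow> z \<otimes> x = x \<otimes> z"
      unfolding group_centre_def by blast+
    have "inv z \<otimes> x = x \<otimes> inv z" if x: "x \<in> carrier G" for x
    proof -
      have "inv (inv x \<otimes> z) = inv (z \<otimes> inv x)" using z(2)[of "inv x"] x by simp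
      then show ?thesis using z(1) x by (simp add: inv_mult_group)
    qed
    with z(1) show "inv z \<in> group_centre G" by (simp add: group_centre_def)
  next
    fix z w assume zw: "z \<in> group_centre G" "w \<in> group_centre G"
    then have c: "z \<in> carrier G" "w \<in> carrier G" by (auto simp: group_centre_def)
    have "z \<otimes> w \<otimes> x = x \<otimes> (z \<otimes> w)" if x: "x \<in> carrier G" for x
    proof -
      have comm: "z \<otimes> x = x \<otimes> z" "w \<otimes> x = x \<otimes> w"
        using zw x unfolding group_centre_def by blast+
      have "z \<otimes> w \<otimes> x = z \<otimes> (x \<otimes> w)" using c x by (simp only: m_assoc comm(2))
      also have "\<dots> = (z \<otimes> x) \<otimes> w" using c x by (simp add: m_assoc)
      also have "z \<otimes> x = x \<otimes> z" by (fact comm(1))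
      finally show ?thesis using c x by (simp add: m_assoc)
    qed
    with c show "z \<otimes> w \<in> group_centre G" by (simp add: group_centre_def)
  qed (auto simp: group_centre_def)
  moreover have "x \<otimes> z \<otimes> inv x \<in> group_centre G"
    if "x \<in> carrier G" "z \<in> group_centre G" for x z
  proof -
    have z: "z \<in> carrier G" "z \<otimes> x = x \<otimes> z" using that unfolding group_centre_def by blast+
    have "x \<otimes> z \<otimes> inv x = z \<otimes> x \<otimes> inv x" by (simp only: z(2))
    also have "\<dots> = z" using that(1) z(1) by (simp add: m_assoc)
    finally have "x \<otimes> z \<otimes> inv x = z" .
    with that show ?thesis by simp
  qed
  ultimately show ?thesis by (simp add: normal_inv_iff)
qed

lemma group_L2: "group (L2 :: ('a::field ^ 2 ^ 2) set monoid)"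
  unfolding L2_def by (rule normal.factorgroup_is_group[OF group.centre_normal[OF group_SL]])

lemma (in group) bij_mult_left:
  assumes "u \<in> carrier G"
  shows "bij_betw (\<lambda>z. u \<otimes> z) (carrier G) (carrier G)"
  by (rule bij_betw_byWitness[where f' = "\<lambda>z. inv u \<otimes> z"])
    (use assms in \<open>auto simp: m_assoc[symmetric]\<close>)

locale map_triple = group G for G (structure) +
  fixes \<rho>\<^sub>0 \<rho>\<^sub>1 \<rho>\<^sub>2
  assumes involutions: "is_involution G \<rho>\<^sub>0" "is_involution G \<rho>\<^sub>1" "is_involution G \<rho>\<^sub>2"
    and commute: "\<rho>\<^sub>0 \<otimes> \<rho>\<^sub>2 = \<rho>\<^sub>2 \<otimes> \<rho>\<^sub>0"
    and generating: "generate G {\<rho>\<^sub>0, \<rho>\<^sub>1, \<rho>\<^sub>2} = carrier G"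
begin

lemma closed [simp]: "\<rho>\<^sub>0 \<in> carrier G" "\<rho>\<^sub>1 \<in> carrier G" "\<rho>\<^sub>2 \<in> carrier G"
  using involutions by (auto simp: is_involution_def)

lemma square: "\<rho>\<^sub>0 \<otimes> \<rho>\<^sub>0 = \<one>" "\<rho>\<^sub>1 \<otimes> \<rho>\<^sub>1 = \<one>" "\<rho>\<^sub>2 \<otimes> \<rho>\<^sub>2 = \<one>"
  using involutions by (auto simp: is_involution_def)

lemma inv_gen: "s \<in> {\<rho>\<^sub>0, \<rho>\<^sub>1, \<rho>\<^sub>2} \<Longrightarrow> inv s = s"
  using square by (auto intro!: inv_equality)

lemma word_induct [consumes 1, case_names one step]:
  assumes "y \<in> carrier G" "P \<one>"
    and step: "\<And>x s. x \<in> carrier G \<Longrightarrow> P x \<Longrightarrow> s \<in> {\<rho>\<^sub>0, \<rho>\<^sub>1, \<rho>\<^sub>2} \<Longrightarrow> P (x \<otimes> s)"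
  shows "P y"
proof -
  have "\<forall>x \<in> carrier G. P x \<longrightarrow> P (x \<otimes> y)"
    using assms(1) unfolding generating[symmetric]
  proof (induction rule: generate.induct)
    case one
    then show ?case by (simp add: generating)
  next
    case (incl h)
    then show ?case using step generating by simp
  next
    case (inv h)
    then show ?case using step generating inv_gen by simp
  next
    case (eng h1 h2)
    then have "h1 \<in> carrier G" "h2 \<in> carrier G" using generating by auto
    with eng.IH show ?case by (auto simp: generating m_assoc[symmetric])
  qed
  with assms(1,2) show ?thesis by force
qed

lemma connected_generated_map:
  assumes "x \<in> carrier G" "y \<in> carrier G"
  shows "(x, y) \<in> (flag_step (generated_map G \<rho>\<^sub>0 \<rho>\<^sub>1 \<rho>\<^sub>2))\<^sup>*"
proof -
  have "(x, x \<otimes> z) \<in> (flag_step (generated_map G \<rho>\<^sub>0 \<rho>\<^sub>1 \<rho>\<^sub>2))\<^sup>*" if "z \<in> carrier G" for z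
    using that
  proof (induction rule: word_induct)
    case one
    then show ?case using assms by simp
  next
    case (step z s)
    have "(x \<otimes> z, x \<otimes> (z \<otimes> s)) \<in> flag_step (generated_map G \<rho>\<^sub>0 \<rho>\<^sub>1 \<rho>\<^sub>2)"
      using step assms by (auto simp: flag_step_def generated_map_def m_assoc)
    with step show ?case by (meson rtrancl.rtrancl_into_rtrancl)
  qed
  from this[of "inv x \<otimes> y"] show ?thesis
    using assms by (simp add: m_assoc[symmetric])
qed

lemma reflexible_generated_map:
  assumes "finite (carrier G)" "\<rho>\<^sub>0 \<noteq> \<rho>\<^sub>2"
  shows "reflexible (generated_map G \<rho>\<^sub>0 \<rho>\<^sub>1 \<rho>\<^sub>2)"
proof -
  have ne: "\<rho>\<^sub>0 \<noteq> \<one>" "\<rho>\<^sub>1 \<noteq> \<one>" "\<rho>\<^sub>2 \<noteq> \<one>" using involutions by (auto simp: is_involution_def)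
  have ne': "\<rho>\<^sub>2 \<otimes> \<rho>\<^sub>0 \<noteq> \<one>"
    using assms(2) inv_equality[of \<rho>\<^sub>2 \<rho>\<^sub>0] inv_gen[of \<rho>\<^sub>0] by auto
  have mv: "x \<otimes> s \<noteq> x" if "x \<in> carrier G" "s \<in> carrier G" "s \<noteq> \<one>" for x s
    using that by simp
  have "is_map (generated_map G \<rho>\<^sub>0 \<rho>\<^sub>1 \<rho>\<^sub>2)"
    unfolding is_map_def using connected_generated_map assms(1) mv ne ne'
    by (auto simp: generated_map_def m_assoc square commute)
  moreover have "\<exists>\<phi> \<in> map_isos (generated_map G \<rho>\<^sub>0 \<rho>\<^sub>1 \<rho>\<^sub>2) (generated_map G \<rho>\<^sub>0 \<rho>\<^sub>1 \<rho>\<^sub>2). \<phi> x = y"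
    if xy: "x \<in> carrier G" "y \<in> carrier G" for x y
  proof (rule bexI[where x = "\<lambda>z. (y \<otimes> inv x) \<otimes> z"])
    let ?\<phi> = "\<lambda>z. (y \<otimes> inv x) \<otimes> z"
    show "?\<phi> x = y" using xy by (simp add: m_assoc)
    have "bij_betw ?\<phi> (carrier G) (carrier G)"
      by (rule bij_mult_left) (use xy in simp)
    then show "?\<phi> \<in> map_isos (generated_map G \<rho>\<^sub>0 \<rho>\<^sub>1 \<rho>\<^sub>2) (generated_map G \<rho>\<^sub>0 \<rho>\<^sub>1 \<rho>\<^sub>2)"
      using xy by (auto simp: map_isos_def generated_map_def m_assoc)
  qed
  ultimately show ?thesis by (auto simp: reflexible_def generated_map_def)
qed

lemma isomorphic_generated_map_iff:
  fixes H (structure)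
  assumes "map_triple H \<sigma>\<^sub>0 \<sigma>\<^sub>1 \<sigma>\<^sub>2"
  shows "map_isomorphic (generated_map G \<rho>\<^sub>0 \<rho>\<^sub>1 \<rho>\<^sub>2) (generated_map H \<sigma>\<^sub>0 \<sigma>\<^sub>1 \<sigma>\<^sub>2) \<longleftrightarrow>
    (\<exists>h \<in> iso G H. h \<rho>\<^sub>0 = \<sigma>\<^sub>0 \<and> h \<rho>\<^sub>1 = \<sigma>\<^sub>1 \<and> h \<rho>\<^sub>2 = \<sigma>\<^sub>2)" (is "?L \<longleftrightarrow> ?R")
proof
  interpret H: map_triple H \<sigma>\<^sub>0 \<sigma>\<^sub>1 \<sigma>\<^sub>2 by fact
  {
    assume ?L
    then obtain \<phi> where bij: "bij_betw \<phi> (carrier G) (carrier H)"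
      and c: "\<And>x. x \<in> carrier G \<Longrightarrow> \<phi> (x \<otimes>\<^bsub>G\<^esub> \<rho>\<^sub>0) = \<phi> x \<otimes>\<^bsub>H\<^esub> \<sigma>\<^sub>0"
        "\<And>x. x \<in> carrier G \<Longrightarrow> \<phi> (x \<otimes>\<^bsub>G\<^esub> \<rho>\<^sub>1) = \<phi> x \<otimes>\<^bsub>H\<^esub> \<sigma>\<^sub>1"
        "\<And>x. x \<in> carrier G \<Longrightarrow> \<phi> (x \<otimes>\<^bsub>G\<^esub> \<rho>\<^sub>2) = \<phi> x \<otimes>\<^bsub>H\<^esub> \<sigma>\<^sub>2"
      by (auto simp: map_isomorphic_def map_isos_def generated_map_def)
    have cl [simp]: "\<phi> x \<in> carrier H" if "x \<in> carrier G" for x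
      using bij that by (auto simp: bij_betw_def)
    define u where "u = inv\<^bsub>H\<^esub> (\<phi> \<one>\<^bsub>G\<^esub>)"
    have u [simp]: "u \<in> carrier H" by (simp add: u_def)
    define h where "h x = u \<otimes>\<^bsub>H\<^esub> \<phi> x" for x
    have hcl [simp]: "h x \<in> carrier H" if "x \<in> carrier G" for x
      using that by (simp add: h_def)
    have h1: "h \<one>\<^bsub>G\<^esub> = \<one>\<^bsub>H\<^esub>" by (simp add: h_def u_def)
    have hc: "h (x \<otimes>\<^bsub>G\<^esub> \<rho>\<^sub>0) = h x \<otimes>\<^bsub>H\<^esub> \<sigma>\<^sub>0" "h (x \<otimes>\<^bsub>G\<^esub> \<rho>\<^sub>1) = h x \<otimes>\<^bsub>H\<^esub> \<sigma>\<^sub>1"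
      "h (x \<otimes>\<^bsub>G\<^esub> \<rho>\<^sub>2) = h x \<otimes>\<^bsub>H\<^esub> \<sigma>\<^sub>2" if "x \<in> carrier G" for x
      using that c by (auto simp: h_def H.m_assoc)
    have hg: "h \<rho>\<^sub>0 = \<sigma>\<^sub>0" "h \<rho>\<^sub>1 = \<sigma>\<^sub>1" "h \<rho>\<^sub>2 = \<sigma>\<^sub>2"
      using hc[of "\<one>\<^bsub>G\<^esub>"] h1 by auto
    have mult: "h (x \<otimes>\<^bsub>G\<^esub> y) = h x \<otimes>\<^bsub>H\<^esub> h y" if "y \<in> carrier G" "x \<in> carrier G" for x y
      using that(1)
    proof (induction rule: word_induct)
      case one
      then show ?case using that h1 by simp
    next
      case (step y s)
      then have "h (x \<otimes>\<^bsub>G\<^esub> (y \<otimes>\<^bsub>G\<^esub> s)) = h (x \<otimes>\<^bsub>G\<^esub> y) \<otimes>\<^bsub>H\<^esub> h s"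
        using that hc[of "x \<otimes>\<^bsub>G\<^esub> y"] hg by (auto simp: m_assoc)
      also have "\<dots> = h x \<otimes>\<^bsub>H\<^esub> (h y \<otimes>\<^bsub>H\<^esub> h s)"
        using step that by (auto simp: H.m_assoc)
      also have "h y \<otimes>\<^bsub>H\<^esub> h s = h (y \<otimes>\<^bsub>G\<^esub> s)"
        using step hc[of y] hg by auto
      finally show ?case .
    qed
    have "bij_betw (\<lambda>z. u \<otimes>\<^bsub>H\<^esub> z) (carrier H) (carrier H)"
      by (rule H.bij_mult_left) simp
    from bij_betw_trans[OF bij this] have "bij_betw h (carrier G) (carrier H)"
      by (simp add: h_def comp_def cong: bij_betw_cong)
    with mult have "h \<in> iso G H" by (auto simp: iso_def hom_def)
    with hg show ?R by blast
  next
    assume ?R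
    then obtain h where "h \<in> iso G H" "h \<rho>\<^sub>0 = \<sigma>\<^sub>0" "h \<rho>\<^sub>1 = \<sigma>\<^sub>1" "h \<rho>\<^sub>2 = \<sigma>\<^sub>2" by blast
    then have "h \<in> map_isos (generated_map G \<rho>\<^sub>0 \<rho>\<^sub>1 \<rho>\<^sub>2) (generated_map H \<sigma>\<^sub>0 \<sigma>\<^sub>1 \<sigma>\<^sub>2)"
      by (auto simp: map_isos_def generated_map_def iso_def hom_mult)
    then show ?L by (auto simp: map_isomorphic_def)
  }
qed

lemma dual_generated_map: "dual (generated_map G \<rho>\<^sub>0 \<rho>\<^sub>1 \<rho>\<^sub>2) = generated_map G \<rho>\<^sub>2 \<rho>\<^sub>1 \<rho>\<^sub>0"
  by (simp add: dual_def generated_map_def)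

text \<open>The two sides may differ outside the set of flags, hence no equation.\<close>

lemma petrie_generated_map:
  "(\<lambda>x. x) \<in> map_isos (petrie (generated_map G \<rho>\<^sub>0 \<rho>\<^sub>1 \<rho>\<^sub>2)) (generated_map G (\<rho>\<^sub>0 \<otimes> \<rho>\<^sub>2) \<rho>\<^sub>1 \<rho>\<^sub>2)"
  by (auto simp: map_isos_def petrie_def generated_map_def m_assoc commute bij_betw_def)

end

end

theory Submission
  imports Defs "HOL-Algebra.Algebraic_Closure_Type" "HOL-Algebra.Sylow" "HOL-Number_Theory.Residues"
begin

text \<open>Let \<open>K\<close> be the field with \<open>q\<^sup>3\<close> elements and \<open>\<sigma>\<close> its automorphism \<open>x \<mapsto> x\<^sup>q\<close> of order three. A reflexible
map with a triality amounts to a four-group \<open>{1, \<rho>\<^sub>0, \<rho>\<^sub>2, \<rho>\<^sub>0 \<rho>\<^sub>2}\<close> and an involution \<open>\<rho>\<^sub>1\<close>, together with an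
automorphism \<open>\<tau>\<close> that fixes \<open>\<rho>\<^sub>1\<close> and rotates the four-group. Here \<open>\<tau>\<close> is \<open>\<sigma>\<close> followed by a conjugation.

With such a \<open>\<tau>\<close>, dualities are impossible. An automorphism of \<open>L\<^sub>2(K)\<close> changes the squares of traces by a
field automorphism \<open>\<phi>\<close> (\<open>trace_field_hom\<close>), which commutes with \<open>\<sigma>\<close>, a power map. Let \<open>a\<close> be the squared
trace of \<open>\<rho>\<^sub>0 \<rho>\<^sub>1\<close>, so that \<open>\<rho>\<^sub>2 \<rho>\<^sub>1\<close> has the squared trace \<open>\<sigma>(a)\<close>. An automorphism fixing \<open>\<rho>\<^sub>1\<close> and swapping
\<open>\<rho>\<^sub>0\<close> and \<open>\<rho>\<^sub>2\<close> gives \<open>\<phi>(a) = \<sigma>(a)\<close> and \<open>\<phi>(\<sigma>(a)) = a\<close>, hence \<open>\<sigma>\<^sup>2(a) = a\<close>, and so \<open>\<sigma>(a) = a\<close>. This fails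
if \<open>a\<close> generates \<open>K\<close>.

For odd \<open>q\<close> the four-group is generated by the quaternion units \<open>i\<close>, \<open>j\<close>, \<open>k\<close> in a split quaternion algebra
over the field with \<open>q\<close> elements. The conjugation is the one by \<open>1 + i + j + k\<close>, which rotates them, and \<open>\<rho>\<^sub>1\<close>
is \<open>x i + \<sigma>(x) j + \<sigma>\<^sup>2(x) k\<close> with \<open>x\<^sup>2 + \<sigma>(x)\<^sup>2 + \<sigma>\<^sup>2(x)\<^sup>2 = 1\<close>; the squared traces are \<open>4 x\<^sup>2\<close> and its conjugates.
For even \<open>q\<close> the four-group consists of the translations by \<open>0\<close>, \<open>a\<close>, \<open>\<sigma>(a)\<close>, \<open>\<sigma>\<^sup>2(a)\<close>, where \<open>a\<close> has
the trace \<open>a + \<sigma>(a) + \<sigma>\<^sup>2(a) = 0\<close>, and \<open>\<rho>\<^sub>1\<close> exchanges \<open>0\<close> and \<open>\<infinity>\<close>. A count of the elements in smaller fields provides an \<open>x\<close> or an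
\<open>a\<close> such that the squared trace generates \<open>K\<close> (\<open>exists_full_degree_odd\<close>, \<open>exists_full_degree_char_two\<close>).

What remains is that the three involutions generate \<open>L\<^sub>2(K)\<close>. The list of all its subgroups is due to Dickson.
A weak form is enough (\<open>trace_in_small_field\<close>): let \<open>\<Gamma>\<close> be a finite group of matrices of determinant 1 over
an algebraically closed field of characteristic \<open>p\<close>, without orbits of size one or two on the projective line and,
if \<open>p = 2\<close>, with two parabolic elements that have a fixed point in common.
Then for every trace \<open>t\<close> in \<open>\<Gamma>\<close>, either \<open>t\<^sup>2\<close> lies in the field with \<open>p\<^sup>2\<close> elements, or it lies in a field with
\<open>r\<close> elements and \<open>\<Gamma>\<close> has at least \<open>r (r\<^sup>2 - 1)\<close> elements. As in the classification of the finite rotation groups,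
the proof counts the pairs of a group element and a fixed point of it on the projective line
(\<open>sum_orbit_weights\<close>). If \<open>t\<^sup>2\<close> generates \<open>K\<close>, then the first case is impossible, since \<open>K\<close> has degree at least three over
its prime field. In the second case \<open>r \<ge> q\<^sup>3\<close>, which leaves no room for a proper subgroup of \<open>SL\<^sub>2(K)\<close> (\<open>eq_SL2\<close>).\<close>

no_notation fps_nth (infixl \<open>$\<close> 75)
hide_const (open) Divisibility.prime Coset.order

section \<open>Matrices of size two and the projective line\<close>

definition mat2 :: "'a \<Rightarrow> 'a \<Rightarrow> 'a \<Rightarrow> 'a \<Rightarrow> 'a ^ 2 ^ 2" where
  "mat2 a b c d = (\<chi> i j. if i = 1 then if j = 1 then a else b else if j = 1 then c else d)"

definition vec2 :: "'a \<Rightarrow> 'a \<Rightarrow> 'a ^ 2" where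
  "vec2 x y = (\<chi> i. if i = 1 then x else y)"

lemma mat2_nth [simp]:
  "mat2 a b c d $ 1 $ 1 = a" "mat2 a b c d $ 1 $ 2 = b" "mat2 a b c d $ 2 $ 1 = c" "mat2 a b c d $ 2 $ 2 = d"
  by (simp_all add: mat2_def)

lemma vec2_nth [simp]: "vec2 x y $ 1 = x" "vec2 x y $ 2 = y"
  by (simp_all add: vec2_def)

lemma mat2_eta: "A = mat2 (A $ 1 $ 1) (A $ 1 $ 2) (A $ 2 $ 1) (A $ 2 $ 2)"
  by (simp add: vec_eq_iff forall_2)

lemma vec2_eta: "v = vec2 (v $ 1) (v $ 2)"
  by (simp add: vec_eq_iff forall_2)

lemma mat2_cases: obtains a b c d where "A = mat2 a b c d"
  using mat2_eta by blast

lemma vec2_cases: obtains x y where "v = vec2 x y"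
  using vec2_eta by blast

lemma mat2_eq_iff [simp]: "mat2 a b c d = mat2 a' b' c' d' \<longleftrightarrow> a = a' \<and> b = b' \<and> c = c' \<and> d = d'"
  by (auto simp: vec_eq_iff forall_2)

lemma vec2_eq_iff [simp]: "vec2 x y = vec2 x' y' \<longleftrightarrow> x = x' \<and> y = y'"
  by (auto simp: vec_eq_iff forall_2)

lemma mat2_mult [simp]:
  "mat2 a b c d ** mat2 a' b' c' d' =
     mat2 (a * a' + b * c') (a * b' + b * d') (c * a' + d * c') (c * b' + d * d' :: 'a::semiring_1)"
  by (simp add: vec_eq_iff forall_2 matrix_matrix_mult_def sum_2)

lemma mat2_vmult [simp]: "mat2 a b c d *v vec2 x y = vec2 (a * x + b * y) (c * x + d * y :: 'a::semiring_1)"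
  by (simp add: vec_eq_iff forall_2 matrix_vector_mult_def sum_2)

lemma mat2_one: "mat 1 = mat2 1 0 0 (1 :: 'a::zero_neq_one)"
  by (simp add: vec_eq_iff forall_2 mat_def)

lemma mat2_uminus [simp]: "- mat2 a b c d = mat2 (- a) (- b) (- c) (- d :: 'a::ab_group_add)"
  by (simp add: vec_eq_iff forall_2)

lemma vec2_scale [simp]: "k *s vec2 x y = vec2 (k * x) (k * y)"
  by (simp add: vec_eq_iff forall_2)

lemma vec2_zero: "0 = vec2 0 (0 :: 'a::zero)"
  by (simp add: vec_eq_iff forall_2)

lemma mat2_det [simp]: "det (mat2 a b c d) = a * d - b * (c :: 'a::comm_ring_1)"
  by (simp add: det_2)

lemma mat2_trace [simp]: "trace (mat2 a b c d) = a + (d :: 'a::semiring_1)"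
  by (simp add: trace_def sum_2)

lemma minus_one_mult: "- (mat 1 :: 'a::ring_1^2^2) ** A = - A" "A ** - (mat 1 :: 'a::ring_1^2^2) = - A"
  by (cases A rule: mat2_cases; simp add: mat2_one)+

text \<open>On matrices of determinant 1 this is the inverse, but it has polynomial entries, so that identities with it are
left to ring normalization.\<close>

definition adj :: "'a::ab_group_add ^ 2 ^ 2 \<Rightarrow> 'a ^ 2 ^ 2" where
  "adj A = mat2 (A $ 2 $ 2) (- (A $ 1 $ 2)) (- (A $ 2 $ 1)) (A $ 1 $ 1)"

lemma adj_mat2 [simp]: "adj (mat2 a b c d) = mat2 d (- b) (- c) (a :: 'a::ab_group_add)"
  by (simp add: adj_def)

lemma adj_mult: "det A = 1 \<Longrightarrow> A ** adj A = mat 1" "det A = 1 \<Longrightarrow> adj A ** A = mat 1" for A :: "'a::field^2^2"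
  by (cases A rule: mat2_cases; simp add: mat2_one algebra_simps)+

lemma det_adj [simp]: "det (adj A) = det A" for A :: "'a::field^2^2"
  by (cases A rule: mat2_cases) (simp add: algebra_simps)

lemma trace_uminus [simp]: "trace (- A) = - trace A" for A :: "'a::field^2^2"
  by (cases A rule: mat2_cases) (simp add: algebra_simps)

lemma det_uminus [simp]: "det (- A) = det A" for A :: "'a::field^2^2"
  by (cases A rule: mat2_cases) (simp add: algebra_simps)

lemma trace_conj: "det B = 1 \<Longrightarrow> trace (B ** A ** adj B) = trace A" for A :: "'a::field^2^2"
  by (metis adj_mult(2) matrix_mul_assoc matrix_mul_lid trace_mul_sym)

lemma adj_cancel:
  "det A = 1 \<Longrightarrow> adj A ** (A ** B) = B" "det A = 1 \<Longrightarrow> A ** (adj A ** B) = B"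
  "det A = 1 \<Longrightarrow> (B ** A) ** adj A = B" "det A = 1 \<Longrightarrow> (B ** adj A) ** A = B" for A :: "'a::field^2^2"
  by (simp_all add: matrix_mul_assoc[symmetric] adj_mult)
     (simp_all add: matrix_mul_assoc adj_mult)

text \<open>A point of the projective line is a one-dimensional space of vectors. Matrices act on it by images, which makes
the laws of an action trivial and avoids a separate treatment of infinity.\<close>

definition line :: "'a::field ^ 2 \<Rightarrow> ('a ^ 2) set" where
  "line v = range (\<lambda>k. k *s v)"

definition points :: "('a::field ^ 2) set set" where
  "points = line ` (- {0})"

definition act :: "'a::field ^ 2 ^ 2 \<Rightarrow> ('a ^ 2) set \<Rightarrow> ('a ^ 2) set" where
  "act A P = (\<lambda>v. A *v v) ` P"

lemma act_line [simp]: "act A (line v) = line (A *v v)"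
  by (auto simp: act_def line_def image_image vector_scalar_commute)

lemma act_mult: "act (A ** B) P = act A (act B P)"
  by (simp add: act_def image_image matrix_vector_mul_assoc)

lemma act_one [simp]: "act (mat 1) P = P"
  by (simp add: act_def)

lemma line_eq_iff:
  assumes "v \<noteq> 0"
  shows "line v = line w \<longleftrightarrow> (\<exists>k. k \<noteq> 0 \<and> w = k *s v)"
proof
  assume eq: "line v = line w"
  have "w \<in> line w" by (metis line_def rangeI vector_smult_lid)
  then obtain k where k: "w = k *s v" using eq by (auto simp: line_def)
  have "v \<in> line v" by (metis line_def rangeI vector_smult_lid)
  with eq have "k \<noteq> 0" using k assms by (auto simp: line_def)
  with k show "\<exists>k. k \<noteq> 0 \<and> w = k *s v" by blast
next
  assume "\<exists>k. k \<noteq> 0 \<and> w = k *s v"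
  then obtain k where k: "k \<noteq> 0" "w = k *s v" by blast
  have "line w \<subseteq> line v" by (auto simp: line_def k)
  moreover have "line v \<subseteq> line w"
  proof
    fix x assume "x \<in> line v"
    then obtain l where "x = l *s v" by (auto simp: line_def)
    then have "x = (l / k) *s w" using k by simp
    then show "x \<in> line w" by (auto simp: line_def)
  qed
  ultimately show "line v = line w" by blast
qed

lemma vmult_eq_0_iff: "det A = 1 \<Longrightarrow> A *v v = 0 \<longleftrightarrow> v = 0" for A :: "'a::field^2^2"
  by (metis adj_mult(2) matrix_vector_mul_assoc matrix_vector_mul_lid matrix_vector_mult_0_right)

lemma act_points: "det A = 1 \<Longrightarrow> P \<in> points \<Longrightarrow> act A P \<in> points"
  by (auto simp: points_def vmult_eq_0_iff)

lemma act_uminus: "P \<in> points \<Longrightarrow> act (- A) P = act A P"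
proof -
  assume "P \<in> points"
  then obtain v where P: "P = line v" by (auto simp: points_def)
  have "- A *v v = (-1) *s (A *v v)" by (cases A rule: mat2_cases, cases v rule: vec2_cases) (simp add: algebra_simps)
  moreover have "line ((-1) *s w) = line w" for w :: "'a^2"
    by (cases "w = 0") (auto simp: line_eq_iff[of w] intro!: line_eq_iff[THEN iffD2, symmetric] exI[of _ "-1"])
  ultimately show ?thesis by (simp add: P)
qed

lemma act_adj_cancel [simp]: "det A = 1 \<Longrightarrow> act (adj A) (act A P) = P" "det A = 1 \<Longrightarrow> act A (act (adj A) P) = P"
  by (simp_all add: act_mult[symmetric] adj_mult)

lemma points_transitive:
  assumes "P \<in> points"
  obtains B where "det B = 1" "act B (line (vec2 1 0)) = P"
proof -
  obtain x y where P: "P = line (vec2 x y)" "vec2 x y \<noteq> 0" using assms by (metis (no_types, lifting) Compl_iff imageE insertCI points_def vec2_eta)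
  show ?thesis
  proof (cases "x = 0")
    case True
    then show ?thesis using P that[of "mat2 0 (- 1 / y) y 0"] by (simp add: vec2_zero)
  next
    case False
    then show ?thesis using P that[of "mat2 x 0 y (1 / x)"] by (simp)
  qed
qed

section \<open>Fixed points on the projective line\<close>

definition fixed_points :: "'a::field ^ 2 ^ 2 \<Rightarrow> ('a ^ 2) set set" where
  "fixed_points A = {P \<in> points. act A P = P}"

definition central :: "'a::field ^ 2 ^ 2 \<Rightarrow> bool" where
  "central A \<longleftrightarrow> A = mat 1 \<or> A = - mat 1"

text \<open>On matrices of determinant 1 the condition on the trace says that the two eigenvalues agree.\<close>

definition parabolic :: "'a::field ^ 2 ^ 2 \<Rightarrow> bool" where
  "parabolic A \<longleftrightarrow> \<not> central A \<and> (trace A)\<^sup>2 = 4"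

lemma points_cases:
  assumes "P \<in> points" obtains "P = line (vec2 1 0)" | x where "P = line (vec2 x 1)"
proof -
  obtain x y where P: "P = line (vec2 x y)" "vec2 x y \<noteq> 0"
    using assms by (metis (no_types, lifting) Compl_iff imageE insertCI points_def vec2_eta)
  show ?thesis
  proof (cases "y = 0")
    case True
    with P have "P = line (vec2 1 0)"
      by (auto simp: line_eq_iff vec2_zero intro!: exI[of _ "1/x"])
    with that show ?thesis by blast
  next
    case False
    with P have "P = line (vec2 (x / y) 1)"
      by (auto simp: line_eq_iff vec2_zero intro!: exI[of _ "1/y"])
    with that show ?thesis by blast
  qed
qed

lemma line_vec2_in_points [simp]: "line (vec2 1 0) \<in> points" "line (vec2 x 1) \<in> points"
  by (auto simp: points_def vec2_zero)

lemma line_vec2_eq [simp]: "line (vec2 1 0) \<noteq> line (vec2 x 1)" "line (vec2 x 1) \<noteq> line (vec2 1 0)"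
  "line (vec2 x 1) = line (vec2 y 1) \<longleftrightarrow> x = (y :: 'a::field)"
  by (auto simp: line_eq_iff vec2_zero)

lemma fixed_points_triangular:
  assumes "l \<noteq> 0"
  shows "l\<^sup>2 \<noteq> 1 \<Longrightarrow> fixed_points (mat2 l b 0 (1 / l)) = {line (vec2 1 0), line (vec2 (b / (1 / l - l)) 1)}"
    "l\<^sup>2 = 1 \<Longrightarrow> b \<noteq> 0 \<Longrightarrow> fixed_points (mat2 l b 0 (1 / l)) = {line (vec2 1 0)}"
proof -
  have 1: "line (vec2 l 0) = line (vec2 1 0)"
    using assms by (simp add: line_eq_iff vec2_zero) (auto intro!: exI[of _ "1/l"])
  have 2: "line (vec2 (l * x + b) (1 / l)) = line (vec2 x 1) \<longleftrightarrow> x * (1 - l\<^sup>2) = b * l" for x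
    using assms by (auto simp: line_eq_iff vec2_zero field_simps power2_eq_square intro!: exI[of _ l])
  show "fixed_points (mat2 l b 0 (1 / l)) = {line (vec2 1 0), line (vec2 (b / (1 / l - l)) 1)}" if "l\<^sup>2 \<noteq> 1"
  proof -
    have "x * (1 - l\<^sup>2) = b * l \<longleftrightarrow> x = b / (1 / l - l)" for x
      using assms that by (auto simp: field_simps power2_eq_square)
    with 2 have 3: "line (vec2 (l * x + b) (1 / l)) = line (vec2 x 1) \<longleftrightarrow> x = b / (1 / l - l)" for x
      by simp
    have "P \<in> fixed_points (mat2 l b 0 (1 / l)) \<longleftrightarrow> P = line (vec2 1 0) \<or> P = line (vec2 (b / (1 / l - l)) 1)"
      if "P \<in> points" for P
      using that by (cases rule: points_cases) (simp_all add: fixed_points_def 1 3)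
    then have "P \<in> fixed_points (mat2 l b 0 (1 / l)) \<longleftrightarrow> P \<in> {line (vec2 1 0), line (vec2 (b / (1 / l - l)) 1)}" for P
      by (cases "P \<in> points") (simp, use line_vec2_in_points fixed_points_def in blast)
    then show ?thesis by blast
  qed
  show "fixed_points (mat2 l b 0 (1 / l)) = {line (vec2 1 0)}" if "l\<^sup>2 = 1" "b \<noteq> 0"
    using that assms 1 2 by (auto simp: fixed_points_def elim!: points_cases)
qed

lemma act_inj: "det B = 1 \<Longrightarrow> inj (act B)"
  by (metis act_adj_cancel(1) injI)

lemma fixed_points_conj:
  assumes "det B = 1"
  shows "fixed_points (B ** A ** adj B) = act B ` fixed_points A"
proof -
  have "act (B ** A ** adj B) P = P \<longleftrightarrow> act A (act (adj B) P) = act (adj B) P" for P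
    by (metis assms act_mult act_adj_cancel)
  note * = this
  show ?thesis
  proof (intro equalityI subsetI)
    fix P assume "P \<in> fixed_points (B ** A ** adj B)"
    then have P: "P \<in> points" "act A (act (adj B) P) = act (adj B) P"
      by (simp_all add: fixed_points_def *)
    then have "act (adj B) P \<in> fixed_points A"
      using act_points[of "adj B" P] assms by (simp add: fixed_points_def)
    then have "act B (act (adj B) P) \<in> act B ` fixed_points A" by (rule imageI)
    then show "P \<in> act B ` fixed_points A" by (simp add: assms)
  next
    fix P assume "P \<in> act B ` fixed_points A"
    then obtain Q where "P = act B Q" "Q \<in> points" "act A Q = Q"
      by (auto simp: fixed_points_def)
    then show "P \<in> fixed_points (B ** A ** adj B)"
      using act_points[OF assms] by (simp add: fixed_points_def * assms)
  qed
qed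

lemma minus_mult: "- A ** B = - (A ** B)" for A B :: "'a::field^2^2"
  by (cases A rule: mat2_cases, cases B rule: mat2_cases) simp

lemma central_conj: "det B = 1 \<Longrightarrow> central (B ** A ** adj B) \<longleftrightarrow> central A"
proof -
  assume B: "det B = 1"
  have "A = adj B ** (B ** A ** adj B) ** B"
    by (simp add: B adj_cancel matrix_mul_assoc[symmetric] adj_mult)
  moreover have "adj B ** mat 1 ** B = mat 1" "B ** mat 1 ** adj B = mat 1" by (simp_all add: B adj_mult)
  moreover have "adj B ** - mat 1 ** B = - mat 1" "B ** - mat 1 ** adj B = - mat 1"
    by (simp_all add: minus_one_mult minus_mult adj_mult B)
  ultimately show ?thesis unfolding central_def by metis
qed

lemma fixes_infinity_iff:
  "det A = 1 \<Longrightarrow> act A (line (vec2 1 0)) = line (vec2 1 0) \<longleftrightarrow> A $ 2 $ 1 = (0::'a::field)"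
proof (cases A rule: mat2_cases)
  fix a b c d assume "det A = 1" and A: "A = mat2 a b c d"
  have "line (vec2 1 0) = line (vec2 a c) \<longleftrightarrow> c = 0"
    using \<open>det A = 1\<close> by (auto simp: line_eq_iff vec2_zero A)
  then show ?thesis by (auto simp: A)
qed

lemma triangular_cases:
  assumes "det A = 1" "A $ 2 $ 1 = (0::'a::field)"
  obtains l b where "l \<noteq> 0" "A = mat2 l b 0 (1 / l)"
proof -
  obtain a b c d where A: "A = mat2 a b c d" by (rule mat2_cases)
  with assms have "c = 0" "a * d = 1" by auto
  then have "a \<noteq> 0" by auto
  with \<open>a * d = 1\<close> have "d = 1 / a" by (simp add: field_simps)
  with A \<open>c = 0\<close> \<open>a \<noteq> 0\<close> show ?thesis using that[of a b] by simp
qed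

lemma eigenvalue_imp_fixed_point:
  fixes A :: "'a::field ^ 2 ^ 2"
  assumes "det A = 1" "1 - trace A * l + l\<^sup>2 = 0"
  obtains P where "P \<in> fixed_points A"
proof -
  obtain a b c d where A: "A = mat2 a b c d" by (rule mat2_cases)
  show ?thesis
  proof (cases "c = 0")
    case True
    then show ?thesis using that[of "line (vec2 1 0)"] fixes_infinity_iff[OF assms(1)]
      by (simp add: fixed_points_def A del: act_line)
  next
    case False
    have "a * d - b * c = 1" using assms by (simp add: A)
    moreover have "a * (l - d) + b * c - l * (l - d) = (1 - (a * d - b * c)) - (1 - (a + d) * l + l\<^sup>2)"
      by (simp add: algebra_simps power2_eq_square)
    ultimately have "a * (l - d) + b * c = l * (l - d)" using assms(2)
      unfolding A mat2_trace by (metis diff_self right_minus_eq)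
    then have "A *v vec2 (l - d) c = l *s vec2 (l - d) c"
      by (simp add: A algebra_simps)
    moreover have "l \<noteq> 0" using assms(2) by auto
    ultimately have "act A (line (vec2 (l - d) c)) = line (vec2 (l - d) c)"
      using False by (metis act_line line_eq_iff vec2_eq_iff vec2_zero)
    with False that[of "line (vec2 (l - d) c)"] show ?thesis by (simp add: fixed_points_def points_def vec2_zero)
  qed
qed

lemma fixed_point_exists:
  fixes A :: "'a::alg_closed_field ^ 2 ^ 2"
  assumes "det A = 1"
  obtains P where "P \<in> fixed_points A"
proof -
  have "\<exists>x. (\<Sum>k\<le>2. (if k = 0 then 1 else if k = 1 then - trace A else 1) * x ^ k) = 0"
    by (rule alg_closed) auto
  then obtain l where "1 - trace A * l + l\<^sup>2 = 0"
    by (auto simp: numeral_2_eq_2 algebra_simps)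
  then show ?thesis using eigenvalue_imp_fixed_point[OF assms] that by blast
qed

lemma triangularize:
  assumes "det A = 1" "P \<in> fixed_points A"
  obtains B l b where "det B = 1" "act B (line (vec2 1 0)) = P" "l \<noteq> 0" "A = B ** mat2 l b 0 (1 / l) ** adj B"
proof -
  obtain B where B: "det B = 1" "act B (line (vec2 1 0)) = P"
    using assms(2) points_transitive[of P] by (auto simp: fixed_points_def)
  have "act (adj B ** A ** B) (line (vec2 1 0)) = line (vec2 1 0)"
    using assms(2) B act_adj_cancel(1)[OF B(1), of "line (vec2 1 0)"]
    by (simp add: act_mult fixed_points_def del: act_line act_adj_cancel)
  moreover have "det (adj B ** A ** B) = 1" using assms B by (simp add: det_mul)
  ultimately obtain l b where "l \<noteq> 0" "adj B ** A ** B = mat2 l b 0 (1 / l)"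
    using fixes_infinity_iff triangular_cases by metis
  moreover from this B have "A = B ** mat2 l b 0 (1 / l) ** adj B"
    using adj_cancel(2,3)[OF B(1)] by (metis matrix_mul_assoc)
  ultimately show ?thesis using B that by blast
qed

lemma trace_triangular:
  assumes "l \<noteq> (0::'a::field)" shows "(l + 1 / l)\<^sup>2 = 4 \<longleftrightarrow> l\<^sup>2 = 1"
proof -
  have "(l + 1 / l)\<^sup>2 - 4 = ((l\<^sup>2 - 1) / l)\<^sup>2" using assms by (simp add: field_simps power2_eq_square)
  moreover have "((l\<^sup>2 - 1) / l)\<^sup>2 = 0 \<longleftrightarrow> l\<^sup>2 = 1" using assms by simp
  ultimately show ?thesis by (metis right_minus_eq)
qed

text \<open>A triangular form of the matrix shows the fixed points: they are the two eigenlines, which coincide for a double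
eigenvalue.\<close>

lemma card_fixed_points:
  fixes A :: "'a::alg_closed_field ^ 2 ^ 2"
  assumes "det A = 1" "\<not> central A"
  shows "card (fixed_points A) = (if parabolic A then 1 else 2)"
proof -
  obtain P where P: "P \<in> fixed_points A" using assms fixed_point_exists by blast
  obtain B l b where B: "det B = 1" "l \<noteq> 0" "A = B ** mat2 l b 0 (1 / l) ** adj B"
    using triangularize[OF assms(1) P] by metis
  have "card (fixed_points A) = card (fixed_points (mat2 l b 0 (1 / l)))"
    unfolding B(3) fixed_points_conj[OF B(1)] using act_inj[OF B(1)] by (simp add: card_image inj_on_subset)
  moreover have "trace A = l + 1 / l" unfolding B(3) using B(1) by (simp add: trace_conj)
  moreover have "\<not> central (mat2 l b 0 (1 / l))" using assms(2) B central_conj by metis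
  moreover have "b \<noteq> 0" if "l\<^sup>2 = 1"
  proof
    assume "b = 0"
    have "l = 1 \<or> l = -1" using that by (simp add: power2_eq_1_iff)
    with \<open>b = 0\<close> calculation(3) show False by (auto simp: central_def mat2_one)
  qed
  ultimately show ?thesis
    using assms(2) fixed_points_triangular[OF B(2)] by (auto simp: parabolic_def trace_triangular[OF B(2)])
qed

section \<open>Counting fixed points of a finite group\<close>

locale finite_SL2_subgroup =
  fixes G :: "('a::alg_closed_field ^ 2 ^ 2) set"
  assumes finite_G: "finite G"
    and det [simp]: "A \<in> G \<Longrightarrow> det A = 1"
    and one [simp, intro]: "mat 1 \<in> G"
    and mult [simp, intro]: "A \<in> G \<Longrightarrow> B \<in> G \<Longrightarrow> A ** B \<in> G"
    and adj [simp, intro]: "A \<in> G \<Longrightarrow> adj A \<in> G"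
    and uminus [simp, intro]: "A \<in> G \<Longrightarrow> - A \<in> G"
begin

definition stab :: "('a ^ 2) set \<Rightarrow> ('a ^ 2 ^ 2) set" where "stab P = {A \<in> G. act A P = P}"
definition orb :: "('a ^ 2) set \<Rightarrow> ('a ^ 2) set set" where "orb P = (\<lambda>A. act A P) ` G"
definition pars :: "('a ^ 2) set \<Rightarrow> ('a ^ 2 ^ 2) set" where "pars P = {A \<in> stab P. parabolic A}"
definition special :: "('a ^ 2) set set" where
  "special = {P \<in> points. \<exists>A \<in> G. \<not> central A \<and> act A P = P}"
definition z :: nat where "z = card {mat 1, - mat 1 :: 'a ^ 2 ^ 2}"
definition weight :: "('a ^ 2) set \<Rightarrow> real" where
  "weight P = (real (card (stab P)) - real z + real (card (pars P))) / real (card (stab P))"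

lemma finite_stab [simp]: "finite (stab P)" using finite_G by (simp add: stab_def)
lemma finite_orb [simp]: "finite (orb P)" using finite_G by (simp add: orb_def)
lemma finite_pars [simp]: "finite (pars P)" by (simp add: pars_def)
lemma one_in_stab [simp]: "mat 1 \<in> stab P" by (simp add: stab_def)
lemma card_stab_pos: "card (stab P) > 0" using one_in_stab finite_stab card_gt_0_iff by blast
lemma card_G_pos: "card G > 0" using one finite_G by (auto simp: card_gt_0_iff)
lemma z_pos: "z > 0" by (simp add: z_def card_gt_0_iff)
lemma self_in_orb: "P \<in> orb P" unfolding orb_def by (metis act_one image_iff one)

lemma orb_eq: "Q \<in> orb P \<Longrightarrow> orb Q = orb P"
proof -
  assume "Q \<in> orb P"
  then obtain A where A: "A \<in> G" "Q = act A P" by (auto simp: orb_def)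
  have "act B Q \<in> orb P" if "B \<in> G" for B
    using A that by (auto simp: orb_def act_mult[symmetric])
  moreover have "act B P \<in> orb Q" if "B \<in> G" for B
  proof -
    have "act B P = act (B ** adj A) Q" using A by (simp add: act_mult)
    then show ?thesis using A that by (auto simp: orb_def)
  qed
  ultimately show ?thesis by (auto simp: orb_def)
qed

lemma orb_points: "P \<in> points \<Longrightarrow> orb P \<subseteq> points"
  by (auto simp: orb_def act_points)

text \<open>The fibres of \<open>A \<mapsto> act A P\<close> are the cosets of the stabilizer.\<close>

lemma orbit_stabilizer: "card G = card (orb P) * card (stab P)"
proof -
  have fib: "card {A \<in> G. act A P = Q} = card (stab P)" if "Q \<in> orb P" for Q
  proof -
    from that obtain B where B: "B \<in> G" "Q = act B P" by (auto simp: orb_def)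
    have "bij_betw (\<lambda>A. B ** A) (stab P) {A \<in> G. act A P = Q}"
      by (rule bij_betw_byWitness[where f' = "\<lambda>A. adj B ** A"])
        (use B in \<open>auto simp: stab_def act_mult adj_cancel\<close>)
    then show ?thesis by (simp add: bij_betw_same_card)
  qed
  have "card G = (\<Sum>A\<in>G. 1)" by simp
  also have "\<dots> = (\<Sum>Q\<in>orb P. card {A \<in> G. act A P = Q})"
    unfolding orb_def by (subst sum.image_gen[OF finite_G, of _ "\<lambda>A. act A P"]) simp
  also have "\<dots> = card (orb P) * card (stab P)" by (simp add: fib)
  finally show ?thesis .
qed

lemma parabolic_conj: "det B = 1 \<Longrightarrow> parabolic (B ** A ** adj B) \<longleftrightarrow> parabolic A"
  by (simp add: parabolic_def central_conj trace_conj)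

lemma stab_conj:
  assumes "B \<in> G"
  shows "bij_betw (\<lambda>A. B ** A ** adj B) (stab P) (stab (act B P))"
    "bij_betw (\<lambda>A. B ** A ** adj B) (pars P) (pars (act B P))"
proof -
  have 1: "adj B ** (B ** A ** adj B) ** adj (adj B) = A" "B ** (adj B ** A ** adj (adj B)) ** adj B = A" for A
  proof -
    have "adj (adj B) = B" by (cases B rule: mat2_cases) simp
    then show "adj B ** (B ** A ** adj B) ** adj (adj B) = A" "B ** (adj B ** A ** adj (adj B)) ** adj B = A"
      using assms by (simp_all add: matrix_mul_assoc[symmetric] adj_cancel adj_mult)
  qed
  have 2: "adj (adj B) = B" by (cases B rule: mat2_cases) simp
  have 3: "B ** A ** adj B \<in> stab (act B P)" if "A \<in> stab P" for A
    using that assms by (simp add: stab_def act_mult)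
  have 4: "adj B ** A ** adj (adj B) \<in> stab P" if "A \<in> stab (act B P)" for A
    using that assms by (simp add: stab_def act_mult 2)
  show "bij_betw (\<lambda>A. B ** A ** adj B) (stab P) (stab (act B P))"
    by (rule bij_betw_byWitness[where f' = "\<lambda>A. adj B ** A ** adj (adj B)"]) (use 1 3 4 in auto)
  show "bij_betw (\<lambda>A. B ** A ** adj B) (pars P) (pars (act B P))"
    by (rule bij_betw_byWitness[where f' = "\<lambda>A. adj B ** A ** adj (adj B)"])
      (use 1 3 4 assms in \<open>auto simp: pars_def parabolic_conj\<close>)
qed

lemma orbit_invariant:
  assumes "Q \<in> orb P"
  shows "card (stab Q) = card (stab P)" "card (pars Q) = card (pars P)" "weight Q = weight P"
proof -
  from assms obtain B where "B \<in> G" "Q = act B P" by (auto simp: orb_def)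
  with stab_conj[of B P] show "card (stab Q) = card (stab P)" "card (pars Q) = card (pars P)"
    by (simp_all add: bij_betw_same_card)
  then show "weight Q = weight P" by (simp add: weight_def)
qed

lemma orb_special: "P \<in> special \<Longrightarrow> orb P \<subseteq> special"
proof
  fix Q assume P: "P \<in> special" and "Q \<in> orb P"
  then obtain B where B: "B \<in> G" "Q = act B P" by (auto simp: orb_def)
  from P obtain A where A: "A \<in> G" "\<not> central A" "act A P = P" by (auto simp: special_def)
  have "act (B ** A ** adj B) Q = Q" using A B by (simp add: act_mult)
  with A B P show "Q \<in> special"
    by (auto simp: special_def act_points central_conj intro!: bexI[of _ "B ** A ** adj B"])
qed

lemma special_eq: "special = (\<Union>A\<in>{A \<in> G. \<not> central A}. fixed_points A)"
  by (auto simp: special_def fixed_points_def)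

lemma finite_fixed_points: "A \<in> G \<Longrightarrow> \<not> central A \<Longrightarrow> finite (fixed_points A)"
  using card_fixed_points[of A] by (intro card_ge_0_finite) simp

lemma finite_special: "finite special"
  unfolding special_eq using finite_G finite_fixed_points by auto

lemma central_in_stab: "P \<in> points \<Longrightarrow> {A \<in> stab P. central A} = {mat 1, - mat 1}"
  by (auto simp: stab_def central_def act_uminus)

lemma central_in_G: "{A \<in> G. central A} = {mat 1, - mat 1}"
  by (auto simp: central_def)

text \<open>Every element outside the centre is counted twice: once at each of its two fixed points, or, if it is parabolic, twice
at the only one. The term for the parabolic elements of a stabilizer thus makes up for the missing fixed points.\<close>

lemma count_fixed:
  "(\<Sum>P\<in>special. real (card (stab P)) - real z + real (card (pars P))) = 2 * (real (card G) - real z)"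
proof -
  let ?N = "{A \<in> G. \<not> central A}"
  have fN: "finite ?N" using finite_G by simp
  have 1: "real (card (stab P)) - real z + real (card (pars P)) =
      (\<Sum>A\<in>?N. if P \<in> fixed_points A then 1 + of_bool (parabolic A) else 0)" if "P \<in> special" for P
  proof -
    have P: "P \<in> points" using that by (simp add: special_def)
    have "stab P = {A \<in> stab P. central A} \<union> {A \<in> ?N. P \<in> fixed_points A}"
      "{A \<in> stab P. central A} \<inter> {A \<in> ?N. P \<in> fixed_points A} = {}"
      using P by (auto simp: stab_def fixed_points_def)
    then have "card (stab P) = card {A \<in> stab P. central A} + card {A \<in> ?N. P \<in> fixed_points A}"
      using finite_G by (metis (no_types, lifting) card_Un_disjoint finite_Un finite_stab)
    then have c: "real (card (stab P)) = real z + real (card {A \<in> ?N. P \<in> fixed_points A})"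
      by (simp add: central_in_stab[OF P] z_def)
    have d: "pars P = {A \<in> ?N. P \<in> fixed_points A \<and> parabolic A}"
      using P by (auto simp: pars_def stab_def fixed_points_def parabolic_def)
    have "(\<Sum>A\<in>?N. if P \<in> fixed_points A then 1 + of_bool (parabolic A) else 0) =
      (\<Sum>A\<in>?N. (if P \<in> fixed_points A then 1 else 0) + (if P \<in> fixed_points A \<and> parabolic A then 1 else 0 :: real))"
      by (intro sum.cong) auto
    also have "\<dots> = real (card {A \<in> ?N. P \<in> fixed_points A}) + real (card {A \<in> ?N. P \<in> fixed_points A \<and> parabolic A})"
      using fN by (simp add: sum.distrib sum.If_cases Int_def conj_ac)
    finally show ?thesis using c d by simp
  qed
  have 2: "(\<Sum>P\<in>special. if P \<in> fixed_points A then 1 + of_bool (parabolic A) else 0 :: real) = 2"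
    if "A \<in> ?N" for A
  proof -
    have "fixed_points A \<subseteq> special" using that by (auto simp: special_eq)
    then have "(\<Sum>P\<in>special. if P \<in> fixed_points A then 1 + of_bool (parabolic A) else 0 :: real) =
      real (card (fixed_points A)) * (1 + of_bool (parabolic A))"
      using finite_special by (simp add: sum.If_cases Int_absorb1)
    then show ?thesis using that card_fixed_points[of A] by auto
  qed
  have "(\<Sum>P\<in>special. real (card (stab P)) - real z + real (card (pars P))) =
    (\<Sum>A\<in>?N. \<Sum>P\<in>special. if P \<in> fixed_points A then 1 + of_bool (parabolic A) else 0)"
    by (subst sum.swap) (simp add: 1)
  also have "\<dots> = 2 * real (card ?N)" by (simp add: 2)
  also have "real (card ?N) = real (card G) - real z"
  proof -
    have "G = ?N \<union> {A \<in> G. central A}" by auto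
    then have "card G = card ?N + card {A \<in> G. central A}"
      using finite_G by (metis (no_types, lifting) card_Un_disjoint finite_Un disjoint_iff mem_Collect_eq)
    then show ?thesis by (simp add: central_in_G z_def)
  qed
  finally show ?thesis .
qed

definition orbits :: "('a ^ 2) set set set" where "orbits = orb ` special"

definition orbit_weight :: "('a ^ 2) set set \<Rightarrow> real" where
  "orbit_weight C = (\<Sum>P\<in>C. real (card (stab P)) - real z + real (card (pars P))) / real (card G)"

lemma orbit_weight_orb: "orbit_weight (orb P) = weight P"
proof -
  have "orbit_weight (orb P) = (\<Sum>Q\<in>orb P. real (card (stab P)) - real z + real (card (pars P))) / real (card G)"
    unfolding orbit_weight_def using orbit_invariant by (intro arg_cong2[where f = "(/)"] sum.cong) auto
  also have "\<dots> = weight P"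
    using card_G_pos orbit_stabilizer[of P] by (simp add: weight_def card_gt_0_iff)
  finally show ?thesis .
qed

lemma finite_orbits: "finite orbits" using finite_special by (simp add: orbits_def)

text \<open>An orbit of points that no parabolic element fixes has a weight of the form \<open>1 - 1 / e\<close> with \<open>e \<ge> 2\<close>, and every other
orbit has a weight of at least 1. As the total is less than 2, few orbits are possible.\<close>

theorem sum_orbit_weights: "(\<Sum>C\<in>orbits. orbit_weight C) = 2 - 2 * real z / real (card G)"
proof -
  have un: "\<Union>orbits = special" using orb_special self_in_orb by (force simp: orbits_def)
  have "\<forall>C\<in>orbits. finite C" by (auto simp: orbits_def)
  moreover have "\<forall>C\<in>orbits. \<forall>D\<in>orbits. C \<noteq> D \<longrightarrow> C \<inter> D = {}"
  proof (intro ballI impI)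
    fix C D assume "C \<in> orbits" "D \<in> orbits" "C \<noteq> D"
    then obtain P Q where "C = orb P" "D = orb Q" by (auto simp: orbits_def)
    with \<open>C \<noteq> D\<close> show "C \<inter> D = {}" using orb_eq by (metis disjoint_iff)
  qed
  ultimately have "(\<Sum>P\<in>\<Union>orbits. real (card (stab P)) - real z + real (card (pars P))) =
    (\<Sum>C\<in>orbits. \<Sum>P\<in>C. real (card (stab P)) - real z + real (card (pars P)))"
    by (simp add: sum.Union_disjoint)
  then have "(\<Sum>C\<in>orbits. orbit_weight C) = 2 * (real (card G) - real z) / real (card G)"
    by (simp add: orbit_weight_def un count_fixed sum_divide_distrib[symmetric])
  then show ?thesis using card_G_pos by (simp add: field_simps)
qed

end

section \<open>Divisibility and Frobenius maps\<close>

text \<open>This replaces the statement that the order of a freely acting group divides the number of points. The groups that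
occur here are too different (signs, translations, multipliers) for a common carrier.\<close>

lemma dvd_card_of_equal_classes:
  assumes "finite S" "\<And>x. x \<in> S \<Longrightarrow> x \<in> C x \<and> C x \<subseteq> S \<and> card (C x) = n"
    and "\<And>x y. x \<in> S \<Longrightarrow> y \<in> C x \<Longrightarrow> C y = C x"
  shows "n dvd card S"
proof -
  have S: "S = \<Union>(C ` S)" using assms(2) by blast
  have "\<forall>D \<in> C ` S. \<forall>E \<in> C ` S. D \<noteq> E \<longrightarrow> D \<inter> E = {}"
    using assms(3) by (metis (no_types, opaque_lifting) disjoint_iff imageE)
  moreover have "\<forall>D \<in> C ` S. finite D" using assms(1,2) by (auto intro: finite_subset[OF _ assms(1)])
  ultimately have "card (\<Union>(C ` S)) = sum card (C ` S)"
    by (intro card_Union_disjoint) (auto simp: pairwise_def disjnt_def)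
  also have "\<dots> = (\<Sum>D\<in>C ` S. n)" using assms(2) by (intro sum.cong) auto
  finally show ?thesis using S by simp
qed

lemma nat_prime_power_of_unique_prime:
  fixes n p :: nat
  assumes "n > 0" "\<And>r. prime r \<Longrightarrow> r dvd n \<Longrightarrow> r = p"
  obtains m where "n = p ^ m"
proof (cases "n = 1")
  case True
  then show ?thesis using that[of 0] by simp
next
  case False
  then obtain r where "prime r" "r dvd n" using prime_factor_nat by blast
  then have "prime p" using assms(2) by metis
  then obtain k where k: "n = p ^ multiplicity p n * k" "\<not> p dvd k"
    using multiplicity_decompose'[of n p] assms(1) by (metis not_prime_unit not_gr_zero)
  have "k = 1"
  proof (rule ccontr)
    assume "k \<noteq> 1"
    then obtain r where "prime r" "r dvd k" using prime_factor_nat by blast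
    then have "r = p" using assms(2)[of r] k(1) by (metis dvd_mult)
    with k(2) \<open>r dvd k\<close> show False by simp
  qed
  with k(1) that show ?thesis by simp
qed

text \<open>By Cauchy's theorem, no prime other than the characteristic divides the order.\<close>

lemma card_additive_subgroup:
  fixes A :: "'a::field set"
  assumes "prime (CHAR('a))" "finite A" "0 \<in> A" "\<And>x y. x \<in> A \<Longrightarrow> y \<in> A \<Longrightarrow> x + y \<in> A" "\<And>x. x \<in> A \<Longrightarrow> - x \<in> A"
  obtains m where "card A = CHAR('a) ^ m"
proof -
  define AG where "AG = \<lparr>carrier = A, mult = (+), one = (0::'a)\<rparr>"
  have grp: "group AG"
    by (rule groupI) (use assms in \<open>auto simp: AG_def intro: bexI[of _ "- _"]\<close>)
  interpret AG: group AG by (rule grp)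
  have pos: "card A > 0" using assms(2,3) card_gt_0_iff by blast
  have "r = CHAR('a)" if r: "prime r" "r dvd card A" for r
  proof -
    from r(2) obtain k where "card A = r * k" by (rule dvdE)
    then have "Coset.order AG = r ^ 1 * k" by (simp add: Coset.order_def AG_def)
    moreover have "finite (carrier AG)" using assms(2) by (simp add: AG_def)
    ultimately have "\<exists>H. subgroup H AG \<and> card H = r ^ 1" by (intro sylow_thm[OF r(1) grp])
    then obtain H where H: "subgroup H AG" "card H = r" by auto
    have "0 \<in> H" using subgroup.one_closed[OF H(1)] by (simp add: AG_def)
    moreover have "H \<noteq> {0}" using H(2) prime_gt_1_nat[OF r(1)] by auto
    ultimately obtain x where x: "x \<in> H" "x \<noteq> 0" by blast
    interpret HG: group "AG\<lparr>carrier := H\<rparr>" by (rule AG.subgroup_imp_group[OF H(1)])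
    have "x [^]\<^bsub>AG\<lparr>carrier := H\<rparr>\<^esub> Coset.order (AG\<lparr>carrier := H\<rparr>) = \<one>\<^bsub>AG\<lparr>carrier := H\<rparr>\<^esub>"
      using HG.pow_order_eq_1 x(1) by simp
    moreover have "x [^]\<^bsub>AG\<lparr>carrier := H\<rparr>\<^esub> n = of_nat n * x" for n :: nat
      by (induction n) (auto simp: AG_def algebra_simps)
    ultimately have "of_nat r * x = 0" using H(2) by (simp add: Coset.order_def AG_def)
    then have "(of_nat r :: 'a) = 0" using x(2) by simp
    then have "CHAR('a) dvd r" by (simp only: of_nat_eq_0_iff_char_dvd)
    with r(1) assms(1) show ?thesis using primes_dvd_imp_eq by metis
  qed
  then show ?thesis using nat_prime_power_of_unique_prime[OF pos] that by metis
qed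

text \<open>The equation is the orbit count in the presence of parabolic elements: \<open>q\<close> translations, \<open>c\<close> multipliers, a wild orbit
of size \<open>1 + k q\<close> and a tame orbit with stabilizers of order \<open>e\<close>. The first alternative belongs to the groups
\<open>PSL\<^sub>2\<close> and \<open>PGL\<^sub>2\<close> over the field with \<open>q\<close> elements, the second one to the alternating group of degree five in
characteristic three. The proof rests on the fact that \<open>1 + k (q - 2)\<close> is prime to \<open>k\<close> and therefore divides \<open>2 c\<close>.\<close>

lemma wild_orbit_arithmetic:
  fixes q c k e :: nat
  assumes "q \<ge> 3" "c dvd q - 1" "k \<ge> 1" "e * (1 + k * (q - 2)) = c * (1 + k * q)"
  shows "(k = 1 \<and> e dvd q + 1 \<and> (q - 1) dvd 2 * c) \<or> (q = 3 \<and> c = 2 \<and> e = 5)"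
proof -
  obtain r where r: "q = r + 2" "r \<ge> 1" using assms(1) that[of "q - 2"] by simp
  define D where "D = 1 + k * r"
  have eq: "e * D = c * (D + 2 * k)" using assms(4) by (simp add: r D_def algebra_simps)
  have c: "c > 0" "c \<le> q - 1" using assms(1,2) by (auto intro: dvd_imp_le Nat.gr0I)
  have "D dvd e * D" by simp
  then have "D dvd c * D + 2 * c * k" unfolding eq by (simp add: algebra_simps)
  then have "D dvd 2 * c * k" by (simp add: dvd_add_right_iff)
  moreover have "coprime D k"
    using gcd_add_mult[of k r 1] by (simp add: D_def coprime_iff_gcd_eq_1 gcd.commute add.commute mult.commute)
  ultimately have D: "D dvd 2 * c" using coprime_dvd_mult_left_iff by blast
  have Dle: "D \<le> 2 * c" by (rule dvd_imp_le) (use D c in auto)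
  consider "k = 1" | "k = 2" | "k \<ge> 3" using assms(3) by linarith
  then show ?thesis
  proof cases
    case 1
    then have Dq: "D = q - 1" by (simp add: D_def r)
    from assms(2) obtain m where m: "q - 1 = c * m" by (rule dvdE)
    have "D + 2 * k = q + 1" using Dq 1 r by linarith
    with eq have "e * D = c * (q + 1)" by metis
    moreover have "D = c * m" using Dq m by metis
    ultimately have "c * (e * m) = c * (q + 1)" by (metis mult.left_commute)
    then have "e * m = q + 1" using c(1) by (metis mult_cancel1 not_gr_zero)
    then have "e dvd q + 1" using dvd_triv_left[of e m] by metis
    then show ?thesis using 1 D Dq by simp
  next
    case 2
    then have "odd D" by (simp add: D_def)
    then have "D dvd c" using D coprime_dvd_mult_right_iff[of D 2 c] by simp
    then have "D \<le> c" using c by (simp add: dvd_imp_le)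
    then show ?thesis using 2 c r by (simp add: D_def)
  next
    case 3
    then have "3 * r \<le> k * r" by simp
    then have r1: "r = 1" using Dle c(2) r unfolding D_def by linarith
    then have q: "q = 3" and Dk: "D = 1 + k" by (simp_all add: r D_def)
    have c2: "c = 2" using Dle 3 c(2) q Dk by linarith
    moreover have k3: "k = 3" using Dle 3 c2 Dk by linarith
    moreover have "e = 5" using eq unfolding Dk k3 c2 by simp
    ultimately show ?thesis using q by simp
  qed
qed

context
  fixes p :: nat
  assumes p: "p = CHAR('a::field)" "prime p"
begin

lemma frob_add: "(x + y :: 'a) ^ (p ^ n) = x ^ (p ^ n) + y ^ (p ^ n)"
  using p by (simp add: freshmans_dream')

lemma frob_minus: "(- x :: 'a) ^ (p ^ n) = - (x ^ (p ^ n))"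
proof -
  have "p ^ n > 0" using p(2) by (simp add: prime_gt_0_nat)
  then have "0 = (x + - x) ^ (p ^ n)" by simp
  also have "\<dots> = x ^ (p ^ n) + (- x) ^ (p ^ n)" by (rule frob_add)
  finally show ?thesis by (metis add_eq_0_iff)
qed

lemma frob_diff: "(x - y :: 'a) ^ (p ^ n) = x ^ (p ^ n) - y ^ (p ^ n)"
  using frob_add[of x "- y" n] by (simp add: frob_minus)

text \<open>Sums of a root of unity of order at most five and its inverse are integers or roots of \<open>y\<^sup>2 + y - 1\<close>.\<close>

lemma small_order_trace:
  assumes "u \<noteq> (0::'a)" "u ^ e = 1" "e \<ge> 1" "e \<le> 5"
  shows "(u + 1 / u) ^ (p ^ 2) = u + 1 / u"
proof -
  define y where "y = u + 1 / u"
  define F where "F = {x :: 'a. x ^ (p ^ 2) = x}"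
  have F1: "1 \<in> F" "0 \<in> F" using p(2) by (auto simp: F_def prime_gt_0_nat)
  have Fa: "x + x' \<in> F" if "x \<in> F" "x' \<in> F" for x x' using that by (simp add: F_def frob_add)
  have Fm: "- x \<in> F" if "x \<in> F" for x using that by (simp add: F_def frob_minus)
  have "1 + 1 \<in> F" "- (1 + 1) \<in> F" "-1 \<in> F" using Fa Fm F1 by blast+
  then have F2: "2 \<in> F" "-2 \<in> F" "-1 \<in> F" by simp_all
  have 1: "y \<in> F" if "u = 1 \<or> u = -1" using that F2 by (auto simp: y_def)
  have "y \<in> F"
  proof -
    consider "e = 1" | "e = 2" | "e = 3" | "e = 4" | "e = 5" using assms by linarith
    then show ?thesis
    proof cases
      case 1
      then show ?thesis using assms \<open>u = 1 \<or> u = -1 \<Longrightarrow> y \<in> F\<close> by simp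
    next
      case 2
      then show ?thesis using assms 1 by (auto simp: power2_eq_1_iff)
    next
      case 3
      then have "(u - 1) * (u\<^sup>2 + u + 1) = 0" using assms(2) by (simp add: algebra_simps power2_eq_square power3_eq_cube)
      then have "u = 1 \<or> u\<^sup>2 + u + 1 = 0" by simp
      moreover have "y = -1" if "u\<^sup>2 + u + 1 = 0"
      proof -
        have "u * (y + 1) = 0" using that assms(1) by (simp add: y_def field_simps power2_eq_square)
        then show ?thesis using assms(1) by (simp add: eq_neg_iff_add_eq_0)
      qed
      ultimately show ?thesis using 1 F2 by auto
    next
      case 4
      then have "(u\<^sup>2)\<^sup>2 = 1" using assms(2) by (simp flip: power_mult)
      then have "u\<^sup>2 = 1 \<or> u\<^sup>2 = -1" using power2_eq_1_iff[of "u\<^sup>2"] by blast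
      moreover have "y = 0" if "u\<^sup>2 = -1" using that assms(1) by (simp add: y_def field_simps power2_eq_square)
      ultimately show ?thesis using 1 F1 by (auto simp: power2_eq_1_iff)
    next
      case 5
      then have "(u - 1) * (u^4 + u^3 + u\<^sup>2 + u + 1) = 0" using assms(2) by (simp add: algebra_simps eval_nat_numeral)
      then have "u = 1 \<or> u^4 + u^3 + u\<^sup>2 + u + 1 = 0" by simp
      moreover have "y \<in> F" if "u^4 + u^3 + u\<^sup>2 + u + 1 = 0"
      proof -
        have "u * y = u\<^sup>2 + 1" using assms(1) by (simp add: y_def field_simps power2_eq_square)
        moreover have "u\<^sup>2 * (y\<^sup>2 + y - 1) = (u * y)\<^sup>2 + u * (u * y) - u\<^sup>2"
          by (simp add: algebra_simps power2_eq_square)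
        ultimately have "u\<^sup>2 * (y\<^sup>2 + y - 1) = u^4 + u^3 + u\<^sup>2 + u + 1"
          by (simp add: algebra_simps eval_nat_numeral)
        then have "u\<^sup>2 * (y\<^sup>2 + y - 1) = 0" using that by simp
        then have y: "y\<^sup>2 + y - 1 = 0" using assms(1) by simp
        have "(y\<^sup>2 + y - 1) ^ (p ^ 1) = 0" using p(2) y by (simp add: prime_gt_0_nat)
        then have "(y ^ p)\<^sup>2 + y ^ p - 1 = 0" unfolding frob_add frob_diff by (simp flip: power_mult add: mult.commute)
        moreover have "(y ^ p - y) * (y ^ p - (- 1 - y)) = ((y ^ p)\<^sup>2 + y ^ p - 1) - (y\<^sup>2 + y - 1)"
          by (simp add: algebra_simps power2_eq_square)
        ultimately have "(y ^ p - y) * (y ^ p - (- 1 - y)) = 0" using y by simp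
        then have "y ^ p = y \<or> y ^ p = - 1 - y" by simp
        then have "(y ^ p) ^ p = y"
        proof
          assume a: "y ^ p = - 1 - y"
          then have "(y ^ p) ^ p = (- 1 - y) ^ (p ^ 1)" by simp
          also have "\<dots> = - 1 - y ^ p" unfolding frob_diff frob_minus by simp
          finally show ?thesis using a by simp
        qed simp
        then show ?thesis by (simp add: F_def power2_eq_square power_mult)
      qed
      ultimately show ?thesis using 1 by auto
    qed
  qed
  then show ?thesis by (simp add: F_def y_def)
qed

end

section \<open>Groups without parabolic elements\<close>

context finite_SL2_subgroup
begin

lemma stab_mult: "A \<in> stab P \<Longrightarrow> B \<in> stab P \<Longrightarrow> A ** B \<in> stab P"
  by (simp add: stab_def act_mult)

lemma stab_adj: "A \<in> stab P \<Longrightarrow> adj A \<in> stab P"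
  by (simp add: stab_def) (metis act_adj_cancel(1) det)

lemma z_cases:
  shows "(1::'a) = -1 \<Longrightarrow> z = 1" "(1::'a) \<noteq> -1 \<Longrightarrow> z = 2"
  by (auto simp: z_def mat2_one card_insert_if)

text \<open>If \<open>1 \<noteq> -1\<close>, then the pairs \<open>{A, - A}\<close> partition the set.\<close>

lemma z_dvd:
  fixes S :: "('a ^ 2 ^ 2) set"
  assumes "finite S" "\<And>A. A \<in> S \<Longrightarrow> - A \<in> S" "\<And>A. A \<in> S \<Longrightarrow> det A = 1"
  shows "z dvd card S"
proof (cases "(1::'a) = -1")
  case True
  then show ?thesis by (simp add: z_cases)
next
  case False
  have "2 dvd card S"
  proof (rule dvd_card_of_equal_classes[OF assms(1), of "\<lambda>A. {A, - A}"])
    fix A assume A: "A \<in> S"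
    have "A \<noteq> - A"
    proof
      assume eq: "A = - A"
      obtain a b c d where m: "A = mat2 a b c d" by (rule mat2_cases)
      have "x = 0" if "x = - x" for x :: 'a
      proof -
        have "(1 - -1) * x = 0" using that by (simp add: algebra_simps)
        then show ?thesis using False by simp
      qed
      note zero = this
      from eq have "a = - a" "b = - b" "c = - c" "d = - d" by (simp_all only: m mat2_uminus mat2_eq_iff)
      then have "a = 0" "b = 0" "c = 0" "d = 0" using zero by blast+
      then have "A = mat2 0 0 0 0" by (simp add: m)
      with assms(3)[OF A] show False by simp
    qed
    then show "A \<in> {A, - A} \<and> {A, - A} \<subseteq> S \<and> card {A, - A} = 2"
      using A assms(2) by simp
  qed auto
  then show ?thesis using False by (simp add: z_cases)
qed

text \<open>The order of the stabilizer in the group modulo its centre.\<close>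

definition stab_order :: "('a ^ 2) set \<Rightarrow> nat" where "stab_order P = card (stab P) div z"

lemma card_stab: "P \<in> points \<Longrightarrow> card (stab P) = z * stab_order P"
proof -
  assume P: "P \<in> points"
  have "z dvd card (stab P)"
    by (rule z_dvd[OF finite_stab]) (use P in \<open>auto simp: stab_def act_uminus\<close>)
  then show ?thesis by (simp add: stab_order_def)
qed

lemma stab_order_pos: "P \<in> points \<Longrightarrow> stab_order P \<ge> 1"
  using card_stab[of P] card_stab_pos[of P] by (cases "stab_order P") auto

lemma stab_order_special: "P \<in> special \<Longrightarrow> stab_order P \<ge> 2"
proof -
  assume P: "P \<in> special"
  then have pt: "P \<in> points" by (simp add: special_def)
  from P obtain A where "A \<in> stab P" "\<not> central A" by (auto simp: special_def stab_def)
  then have "{mat 1, - mat 1} \<subset> stab P" using central_in_stab[OF pt] by auto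
  then have "z < card (stab P)" unfolding z_def using finite_stab psubset_card_mono by blast
  then have "stab_order P \<noteq> 1" "stab_order P \<noteq> 0" using card_stab[OF pt] by auto
  then show ?thesis by linarith
qed

text \<open>Multiplication by \<open>A\<close> permutes the stabilizer and multiplies all eigenvalues at the fixed point by \<open>l\<close>. So the product
of these eigenvalues is not affected by the factor \<open>l ^ card (stab (line v))\<close>.\<close>

lemma eigenvalue_power:
  assumes v: "v \<noteq> 0" and A: "A \<in> G" "A *v v = l *s v"
  shows "l ^ card (stab (line v)) = 1"
proof -
  have ex: "\<exists>k. k \<noteq> 0 \<and> B *v v = k *s v" if "B \<in> stab (line v)" for B
    using that line_eq_iff[OF v, of "B *v v"] by (auto simp: stab_def)
  define ev where "ev B = (SOME k. k \<noteq> 0 \<and> B *v v = k *s v)" for B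
  have ev: "ev B \<noteq> 0" "B *v v = ev B *s v" if "B \<in> stab (line v)" for B
    using someI_ex[OF ex[OF that]] unfolding ev_def by blast+
  have uniq: "k = k'" if "k *s v = k' *s v" for k k'
    using that v by (cases v rule: vec2_cases) (auto simp: vec2_zero)
  have l0: "l \<noteq> 0"
  proof
    assume "l = 0"
    then have "A *v v = 0" using A by simp
    then show False using vmult_eq_0_iff[of A v] A v by simp
  qed
  then have As: "A \<in> stab (line v)" using A line_eq_iff[OF v, of "A *v v"] by (auto simp: stab_def)
  have mult: "ev (A ** B) = l * ev B" if B: "B \<in> stab (line v)" for B
  proof (rule uniq)
    have "ev (A ** B) *s v = A *v (B *v v)"
      using ev(2)[OF stab_mult[OF As B]] by (simp add: matrix_vector_mul_assoc)
    also have "\<dots> = (l * ev B) *s v" using ev(2)[OF B] A(2) by (simp add: vector_scalar_commute mult.commute)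
    finally show "ev (A ** B) *s v = (l * ev B) *s v" .
  qed
  have bij: "bij_betw (\<lambda>B. A ** B) (stab (line v)) (stab (line v))"
    by (rule bij_betw_byWitness[where f' = "\<lambda>B. adj A ** B"])
      (use As A in \<open>auto simp: adj_cancel intro: stab_mult stab_adj\<close>)
  have "(\<Prod>B\<in>stab (line v). ev B) = (\<Prod>B\<in>stab (line v). ev (A ** B))"
    using prod.reindex_bij_betw[OF bij, of ev] by simp
  also have "\<dots> = l ^ card (stab (line v)) * (\<Prod>B\<in>stab (line v). ev B)"
    by (simp add: mult prod.distrib)
  finally show ?thesis using ev(1) by simp
qed

text \<open>The number \<open>u\<close> is the quotient \<open>l\<^sup>2\<close> of the two eigenvalues \<open>l\<close> and \<open>1 / l\<close>. The sign of \<open>l\<close> is lost in the square,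
which is why the order modulo the centre suffices as exponent.\<close>

lemma trace_at_fixed_point:
  assumes "A \<in> stab P" "P \<in> points"
  obtains u where "u \<noteq> 0" "u ^ stab_order P = 1" "(trace A)\<^sup>2 - 2 = u + 1 / u"
proof -
  have AG: "A \<in> G" and "P \<in> fixed_points A" using assms by (auto simp: stab_def fixed_points_def)
  then obtain B l b where B: "det B = 1" "act B (line (vec2 1 0)) = P" "l \<noteq> 0" "A = B ** mat2 l b 0 (1 / l) ** adj B"
    using triangularize[of A P] det by metis
  define v where "v = B *v vec2 1 0"
  have P: "P = line v" using B by (simp add: v_def)
  have v0: "v \<noteq> 0" using vmult_eq_0_iff[OF B(1), of "vec2 1 0"] by (simp add: v_def vec2_zero)
  have "A *v v = (A ** B) *v vec2 1 0" by (simp add: v_def matrix_vector_mul_assoc)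
  also have "A ** B = B ** mat2 l b 0 (1 / l)" using B by (simp add: adj_cancel)
  also have "(B ** mat2 l b 0 (1 / l)) *v vec2 1 0 = l *s v"
  proof -
    have "mat2 l b 0 (1 / l) *v vec2 1 0 = l *s vec2 1 0" by simp
    then show ?thesis by (metis matrix_vector_mul_assoc vector_scalar_commute v_def)
  qed
  finally have "l ^ card (stab P) = 1" using eigenvalue_power[OF v0 AG] P by simp
  then have "(l ^ z) ^ stab_order P = 1" by (simp add: card_stab[OF assms(2)] power_mult)
  moreover have "z = 1 \<or> z = 2" using z_cases by blast
  moreover have "(l\<^sup>2) ^ stab_order P = (l ^ stab_order P)\<^sup>2" by (metis power_mult mult.commute)
  ultimately have "(l\<^sup>2) ^ stab_order P = 1" by auto
  moreover have "trace A = l + 1 / l" using B by (simp add: trace_conj)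
  then have "(trace A)\<^sup>2 - 2 = l\<^sup>2 + 1 / l\<^sup>2" using B(3) by (simp add: power2_eq_square field_simps)
  ultimately show ?thesis using B(3) that[of "l\<^sup>2"] by simp
qed

lemma weight_tame:
  assumes "P \<in> points" "pars P = {}"
  shows "weight P = 1 - 1 / stab_order P"
  using assms stab_order_pos[of P] z_pos by (simp add: weight_def card_stab field_simps)

lemma weight_wild:
  assumes "P \<in> points" "pars P \<noteq> {}"
  shows "weight P \<ge> 1"
proof -
  obtain A where A: "A \<in> pars P" using assms by blast
  have "z dvd card (pars P)"
    by (rule z_dvd[OF finite_pars])
      (use assms in \<open>auto simp: pars_def stab_def act_uminus parabolic_def central_def minus_equation_iff[of _ "mat 1"]\<close>)
  moreover have "card (pars P) > 0" using assms(2) finite_pars by (simp add: card_gt_0_iff)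
  ultimately have "z \<le> card (pars P)" by (simp add: dvd_imp_le)
  then show ?thesis using card_stab_pos[of P] by (simp add: weight_def field_simps)
qed

lemma special_points: "P \<in> special \<Longrightarrow> P \<in> points" by (simp add: special_def)

lemma card_G: "P \<in> points \<Longrightarrow> card G = z * (card (orb P) * stab_order P)"
  using orbit_stabilizer[of P] card_stab[of P] by simp

lemma orbitsE: assumes "C \<in> orbits" obtains P where "P \<in> special" "C = orb P"
  using assms by (auto simp: orbits_def)

text \<open>This is the classification of the finite rotation groups: there are at most three orbits, and if there are three, the
reciprocals of the orders of their stabilizers add up to more than 1. If one of the three orders exceeds five, then the
other two are 2, which is the dihedral case with its orbit of size two.\<close>

theorem tame_stabilizer_bound:
  assumes tame: "\<And>A. A \<in> G \<Longrightarrow> \<not> parabolic A"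
    and no_fix: "\<And>P. P \<in> points \<Longrightarrow> card (orb P) \<noteq> 1"
    and no_pair: "\<And>P. P \<in> points \<Longrightarrow> card (orb P) \<noteq> 2"
    and P: "P \<in> special"
  shows "stab_order P \<le> 5"
proof (rule ccontr)
  assume "\<not> stab_order P \<le> 5"
  then have e6: "stab_order P \<ge> 6" by simp
  have pt: "P \<in> points" using P by (rule special_points)
  have nopars: "pars Q = {}" for Q using tame by (auto simp: pars_def stab_def)
  have w: "orbit_weight (orb Q) = 1 - 1 / stab_order Q" if "Q \<in> special" for Q
    using that by (simp add: orbit_weight_orb weight_tame nopars special_points)
  define N where "N = card (orb P)"
  have Npos: "N \<ge> 1" unfolding N_def using self_in_orb[of P] finite_orb[of P] card_gt_0_iff[of "orb P"] by fastforce
  define h where "h = real N * real (stab_order P)"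
  have h: "real (card G) = real z * h" using card_G[OF pt] by (simp add: h_def N_def)
  have hpos: "h > 0" using Npos e6 by (simp add: h_def)
  (* the orbits other than the one with the large stabilizer *)
  define R where "R = orbits - {orb P}"
  have fR: "finite R" using finite_orbits by (simp add: R_def)
  have "(\<Sum>C\<in>orbits. orbit_weight C) = orbit_weight (orb P) + (\<Sum>C\<in>R. orbit_weight C)"
    unfolding R_def using P finite_orbits by (intro sum.remove) (auto simp: orbits_def)
  then have eq: "1 - 1 / stab_order P + (\<Sum>C\<in>R. orbit_weight C) = 2 - 2 / h"
    using sum_orbit_weights w[OF P] z_pos h by simp
  have w2: "orbit_weight C \<ge> 1 / 2" if "C \<in> R" for C
  proof -
    from that have "C \<in> orbits" by (simp add: R_def)
    then obtain Q where Q: "Q \<in> special" "C = orb Q" by (rule orbitsE)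
    have "1 / real (stab_order Q) \<le> 1 / 2" using stab_order_special[OF Q(1)] by (simp add: field_simps)
    then show ?thesis using w[OF Q(1)] Q(2) by simp
  qed
  have "(\<Sum>C\<in>R. 1 / 2) \<le> (\<Sum>C\<in>R. orbit_weight C)" by (rule sum_mono) (rule w2)
  then have half: "real (card R) / 2 \<le> (\<Sum>C\<in>R. orbit_weight C)" by simp
  have ep: "1 / real (stab_order P) \<le> 1 / 6" using e6 by (simp add: field_simps)
  have "2 / h > 0" using hpos by simp
  with eq half ep have "real (card R) < 3" by linarith
  then consider "card R = 0" | "card R = 1" | "card R = 2" by fastforce
  then show False
  proof cases
    case 1
    then have "R = {}" using fR by simp
    with eq have "2 / h = 1 + 1 / stab_order P" by simp
    moreover have "h \<ge> 6" using e6 Npos mult_mono[of 1 "real N" 6 "real (stab_order P)"] by (simp add: h_def)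
    then have "2 / h \<le> 1" by (simp add: field_simps)
    ultimately have "1 / real (stab_order P) \<le> 0" by linarith
    then show False using e6 by simp
  next
    case 2
    then obtain C where C: "R = {C}" by (auto simp: card_1_singleton_iff)
    then have "C \<in> orbits" by (auto simp: R_def)
    then obtain Q where Q: "Q \<in> special" "C = orb Q" by (rule orbitsE)
    define M where "M = card (orb Q)"
    have h2: "h = real M * real (stab_order Q)" using h card_G[OF special_points[OF Q(1)]] z_pos by (simp add: M_def)
    have "1 / stab_order P + 1 / stab_order Q = 2 / h" using eq C Q w[OF Q(1)] by simp
    moreover have "1 / stab_order P = N / h" using e6 Npos by (simp add: h_def)
    moreover have "1 / stab_order Q = M / h" using stab_order_special[OF Q(1)] hpos unfolding h2 by (auto simp: zero_less_mult_iff)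
    ultimately have "(real N + real M) / h = 2 / h" by (simp add: add_divide_distrib)
    then have "N + M = 2" using hpos by simp
    moreover have "M \<ge> 1" unfolding M_def using self_in_orb[of Q] finite_orb[of Q] card_gt_0_iff[of "orb Q"] by fastforce
    ultimately have "N = 1" using Npos by linarith
    then show False using no_fix[OF pt] by (simp add: N_def)
  next
    case 3
    then obtain C D where CD: "R = {C, D}" "C \<noteq> D" by (auto simp: card_2_iff)
    then have "C \<in> orbits" "D \<in> orbits" by (auto simp: R_def)
    then obtain Q Q' where Q: "Q \<in> special" "C = orb Q" "Q' \<in> special" "D = orb Q'"
      by (metis orbitsE)
    have s: "1 / stab_order P + 1 / stab_order Q + 1 / stab_order Q' = 1 + 2 / h"
      using eq CD Q w[OF Q(1)] w[OF Q(3)] by simp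
    have third: "1 / real (stab_order S) \<le> 1 / 3" if "stab_order S \<noteq> 2" "S \<in> special" for S
      using that stab_order_special[OF that(2)] by (simp add: field_simps)
    have le2: "1 / real (stab_order S) \<le> 1 / 2" if "S \<in> special" for S
      using stab_order_special[OF that] by (simp add: field_simps)
    have "stab_order Q = 2" using third[OF _ Q(1)] le2[OF Q(3)] s ep \<open>2 / h > 0\<close> by fastforce
    moreover have "stab_order Q' = 2" using third[OF _ Q(3)] le2[OF Q(1)] s ep \<open>2 / h > 0\<close> by fastforce
    ultimately have "1 / stab_order P = 2 / h" using s by simp
    moreover have "1 / stab_order P = N / h" using e6 Npos by (simp add: h_def)
    ultimately have "N = 2" using hpos by simp
    then show False using no_pair[OF pt] by (simp add: N_def)
  qed
qed

end

section \<open>The stabilizer of infinity\<close>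

context finite_SL2_subgroup
begin

definition infinity :: "('a ^ 2) set" where "infinity = line (vec2 1 0)"
text \<open>Up to sign, the elements of \<open>G\<close> that fix infinity are the maps \<open>x \<mapsto> u x + b\<close>. The next two sets collect the \<open>b\<close>
that occur with \<open>u = 1\<close> and the \<open>u\<close> that occur with some \<open>b\<close>.\<close>

definition shifts :: "'a set" where "shifts = {b. mat2 1 b 0 1 \<in> G}"
definition multipliers :: "'a set" where
  "multipliers = {u. \<exists>l b. l \<noteq> 0 \<and> u = l\<^sup>2 \<and> mat2 l b 0 (1 / l) \<in> G}"

lemma infinity_point [simp]: "infinity \<in> points" by (simp add: infinity_def)

lemma stab_infinity_iff: "A \<in> stab infinity \<longleftrightarrow> A \<in> G \<and> (\<exists>l b. l \<noteq> 0 \<and> A = mat2 l b 0 (1 / l))"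
proof
  assume "A \<in> stab infinity"
  then have *: "A \<in> G" "act A (line (vec2 1 0)) = line (vec2 1 0)"
    by (simp_all add: stab_def infinity_def del: act_line)
  then have A: "A \<in> G" "A $ 2 $ 1 = 0" using fixes_infinity_iff[OF det] by blast+
  show "A \<in> G \<and> (\<exists>l b. l \<noteq> 0 \<and> A = mat2 l b 0 (1 / l))"
    using triangular_cases[OF det[OF A(1)] A(2)] A(1) by metis
next
  assume "A \<in> G \<and> (\<exists>l b. l \<noteq> 0 \<and> A = mat2 l b 0 (1 / l))"
  then obtain l b where "A \<in> G" "l \<noteq> 0" "A = mat2 l b 0 (1 / l)" by blast
  then show "A \<in> stab infinity" using fixes_infinity_iff[of A] by (simp add: stab_def infinity_def del: act_line)
qed

lemma shifts_add: "a \<in> shifts \<Longrightarrow> b \<in> shifts \<Longrightarrow> a + b \<in> shifts"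
  using mult[of "mat2 1 a 0 1" "mat2 1 b 0 1"] by (simp add: shifts_def add.commute)

lemma shifts_uminus: "a \<in> shifts \<Longrightarrow> - a \<in> shifts"
  using adj[of "mat2 1 a 0 1"] by (simp add: shifts_def)

lemma shifts_zero: "0 \<in> shifts"
  using one by (simp add: shifts_def mat2_one)

lemma finite_shifts: "finite shifts"
proof -
  have "inj (\<lambda>b. mat2 1 b 0 (1::'a))" by (auto simp: inj_def)
  then have "finite ((\<lambda>b. mat2 1 b 0 (1::'a)) -` G)" using finite_G finite_vimageI by blast
  then show ?thesis by (simp add: shifts_def vimage_def)
qed

lemma multipliers_one: "1 \<in> multipliers"
proof -
  have "(1::'a) \<noteq> 0 \<and> (1::'a) = 1\<^sup>2 \<and> mat2 1 0 0 (1 / 1 :: 'a) \<in> G" using one by (simp add: mat2_one)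
  then show ?thesis unfolding multipliers_def by blast
qed

lemma multipliers_nonzero: "u \<in> multipliers \<Longrightarrow> u \<noteq> 0"
  by (auto simp: multipliers_def)

lemma multipliers_mult:
  assumes "u \<in> multipliers" "w \<in> multipliers" shows "u * w \<in> multipliers"
proof -
  obtain l b m d where *: "l \<noteq> 0" "u = l\<^sup>2" "mat2 l b 0 (1 / l) \<in> G" "m \<noteq> 0" "w = m\<^sup>2" "mat2 m d 0 (1 / m) \<in> G"
    using assms unfolding multipliers_def by blast
  from mult[OF *(3,6)] have "mat2 (l * m) (l * d + b / m) 0 (1 / (l * m)) \<in> G" by simp
  with * have "l * m \<noteq> 0 \<and> u * w = (l * m)\<^sup>2 \<and> mat2 (l * m) (l * d + b / m) 0 (1 / (l * m)) \<in> G"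
    by (simp add: power_mult_distrib)
  then show ?thesis unfolding multipliers_def by blast
qed

lemma multipliers_inverse:
  assumes "u \<in> multipliers" shows "inverse u \<in> multipliers"
proof -
  obtain l b where *: "l \<noteq> 0" "u = l\<^sup>2" "mat2 l b 0 (1 / l) \<in> G"
    using assms unfolding multipliers_def by blast
  from adj[OF *(3)] have "mat2 (1 / l) (- b) 0 (1 / (1 / l)) \<in> G" by simp
  moreover have "inverse u = (1 / l)\<^sup>2" "1 / l \<noteq> 0" using * by (simp_all add: power_divide inverse_eq_divide)
  ultimately show ?thesis unfolding multipliers_def by blast
qed

lemma multipliers_shifts:
  assumes "u \<in> multipliers" "a \<in> shifts" shows "u * a \<in> shifts"
proof -
  obtain l b where *: "l \<noteq> 0" "u = l\<^sup>2" "mat2 l b 0 (1 / l) \<in> G"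
    using assms unfolding multipliers_def by blast
  have "mat2 l b 0 (1 / l) ** mat2 1 a 0 1 ** adj (mat2 l b 0 (1 / l)) \<in> G"
    using * assms(2) by (simp add: shifts_def del: mat2_mult adj_mat2)
  moreover have "mat2 l b 0 (1 / l) ** mat2 1 a 0 1 ** adj (mat2 l b 0 (1 / l)) = mat2 1 (u * a) 0 1"
    using * by (simp add: field_simps power2_eq_square)
  ultimately show ?thesis by (simp add: shifts_def)
qed

definition signed_shifts :: "('a ^ 2 ^ 2) set" where
  "signed_shifts = {A \<in> stab infinity. (A $ 1 $ 1)\<^sup>2 = 1}"

lemma card_signed_shifts: "card signed_shifts = z * card shifts"
proof -
  have "bij_betw (\<lambda>(s, b). s ** mat2 1 b 0 1) ({mat 1, - mat 1} \<times> shifts) signed_shifts"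
    unfolding bij_betw_def
  proof (intro conjI equalityI subsetI)
    show "inj_on (\<lambda>(s, b). s ** mat2 1 b 0 1) ({mat 1, - mat 1} \<times> shifts)"
      by (auto simp: inj_on_def minus_one_mult mat2_one)
  next
    fix A assume "A \<in> (\<lambda>(s, b). s ** mat2 1 b 0 1) ` ({mat 1, - mat 1} \<times> shifts)"
    then obtain b where b: "mat2 1 b 0 1 \<in> G" and A: "A = mat2 1 b 0 1 \<or> A = - mat2 1 b 0 1"
      by (auto simp: shifts_def minus_one_mult simp del: mat2_uminus)
    from A show "A \<in> signed_shifts"
    proof
      assume "A = mat2 1 b 0 1"
      then show ?thesis using b by (auto simp: signed_shifts_def stab_infinity_iff intro!: exI[of _ 1])
    next
      assume A: "A = - mat2 1 b 0 1"
      with b have "A \<in> G" by (simp del: mat2_uminus)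
      with A show ?thesis by (auto simp: signed_shifts_def stab_infinity_iff intro!: exI[of _ "-1"])
    qed
  next
    fix A assume "A \<in> signed_shifts"
    then obtain l b where A: "A \<in> G" "l \<noteq> 0" "A = mat2 l b 0 (1 / l)" "l\<^sup>2 = 1"
      by (auto simp: signed_shifts_def stab_infinity_iff)
    then have "l = 1 \<or> l = -1" by (simp add: power2_eq_1_iff)
    then show "A \<in> (\<lambda>(s, b). s ** mat2 1 b 0 1) ` ({mat 1, - mat 1} \<times> shifts)"
    proof
      assume "l = 1"
      then show ?thesis using A by (force simp: shifts_def)
    next
      assume l: "l = -1"
      then have "mat2 1 (- b) 0 1 \<in> G" using A uminus[OF A(1)] by simp
      then have "(- mat 1, - b) \<in> {mat 1, - mat 1} \<times> shifts" by (simp add: shifts_def)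
      moreover have "A = (\<lambda>(s, b). s ** mat2 1 b 0 1) (- mat 1, - b)"
        using A l by (simp add: minus_one_mult)
      ultimately show ?thesis by (rule rev_image_eqI)
    qed
  qed
  then have "card signed_shifts = card ({mat 1, - mat 1 :: 'a ^ 2 ^ 2} \<times> shifts)"
    by (simp add: bij_betw_same_card)
  then show ?thesis by (simp add: card_cartesian_product z_def)
qed

lemma card_pars_infinity: "card (pars infinity) + z = z * card shifts"
proof -
  have sub: "{mat 1, - mat 1} \<subseteq> signed_shifts"
    using one_in_stab[of infinity] central_in_stab[OF infinity_point]
    by (auto simp: signed_shifts_def mat2_one)
  have "pars infinity = signed_shifts - {mat 1, - mat 1}"
    by (auto simp: pars_def signed_shifts_def stab_infinity_iff parabolic_def central_def trace_triangular)
  moreover have "finite signed_shifts" by (simp add: signed_shifts_def)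
  ultimately have "card (pars infinity) + card {mat 1, - mat 1 :: 'a ^ 2 ^ 2} = card signed_shifts"
    using sub by (simp add: card_Diff_subset card_mono le_add_diff_inverse2)
  then show ?thesis by (simp add: z_def card_signed_shifts)
qed

lemma card_stab_infinity: "card (stab infinity) = z * (card shifts * card multipliers)"
  and finite_multipliers: "finite multipliers"
proof -
  let ?f = "\<lambda>A :: 'a ^ 2 ^ 2. (A $ 1 $ 1)\<^sup>2"
  have im: "?f ` stab infinity = multipliers"
    by (force simp: stab_infinity_iff multipliers_def)
  then show "finite multipliers" by (metis finite_imageI finite_stab)
  have fib: "card {A \<in> stab infinity. ?f A = u} = z * card shifts" if u: "u \<in> multipliers" for u
  proof -
    obtain l b where B: "l \<noteq> 0" "u = l\<^sup>2" "mat2 l b 0 (1 / l) \<in> G"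
      using u unfolding multipliers_def by blast
    define B where "B = mat2 l b 0 (1 / l)"
    have BG: "B \<in> G" "B \<in> stab infinity" using B by (auto simp: B_def stab_infinity_iff)
    have f: "?f (S ** T) = ?f S * ?f T" if "S \<in> stab infinity" "T \<in> stab infinity" for S T
      using that by (auto simp: stab_infinity_iff power_mult_distrib)
    have fB: "?f B = u" "?f (adj B) = 1 / u" using B by (simp_all add: B_def power_divide)
    have "bij_betw (\<lambda>A. B ** A) signed_shifts {A \<in> stab infinity. ?f A = u}"
      by (rule bij_betw_byWitness[where f' = "\<lambda>A. adj B ** A"])
        (use BG B fB in \<open>auto simp: signed_shifts_def adj_cancel f stab_mult stab_adj\<close>)
    then show ?thesis using card_signed_shifts by (simp add: bij_betw_same_card)
  qed
  have "card (stab infinity) = (\<Sum>u\<in>multipliers. card {A \<in> stab infinity. ?f A = u})"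
    using sum.image_gen[of "stab infinity" "\<lambda>_. 1 :: nat" ?f] by (simp add: im)
  then show "card (stab infinity) = z * (card shifts * card multipliers)"
    by (simp add: fib)
qed

lemma stab_order_infinity: "stab_order infinity = card shifts * card multipliers"
  using card_stab_infinity z_pos by (simp add: stab_order_def)

text \<open>The multipliers act freely on the nonzero shifts.\<close>

lemma card_multipliers_dvd: "card multipliers dvd card shifts - 1"
proof -
  have "card multipliers dvd card (shifts - {0})"
  proof (rule dvd_card_of_equal_classes[where C = "\<lambda>x. (\<lambda>u. u * x) ` multipliers"])
    fix x assume x: "x \<in> shifts - {0}"
    then have "inj_on (\<lambda>u. u * x) multipliers" by (auto simp: inj_on_def)
    moreover have "x \<in> (\<lambda>u. u * x) ` multipliers" using multipliers_one by force
    ultimately show "x \<in> (\<lambda>u. u * x) ` multipliers \<and> (\<lambda>u. u * x) ` multipliers \<subseteq> shifts - {0} \<and>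
        card ((\<lambda>u. u * x) ` multipliers) = card multipliers"
      using x multipliers_shifts multipliers_nonzero by (auto simp: card_image)
  next
    fix x y assume "y \<in> (\<lambda>u. u * x) ` multipliers"
    then obtain w where w: "w \<in> multipliers" "y = w * x" by blast
    have "u * y \<in> (\<lambda>u. u * x) ` multipliers" if "u \<in> multipliers" for u
      using multipliers_mult[OF that w(1)] w(2) by (auto simp: mult.assoc[symmetric])
    moreover have "u * x \<in> (\<lambda>u. u * y) ` multipliers" if "u \<in> multipliers" for u
    proof -
      have "u * x = (u * inverse w) * y" using w multipliers_nonzero by simp
      then show ?thesis using multipliers_mult[OF that multipliers_inverse[OF w(1)]] by blast
    qed
    ultimately show "(\<lambda>u. u * y) ` multipliers = (\<lambda>u. u * x) ` multipliers" by blast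
  qed (use finite_shifts in simp)
  then show ?thesis using shifts_zero finite_shifts by simp
qed

lemma multipliers_power:
  assumes "u \<in> multipliers" shows "u ^ card multipliers = 1"
proof -
  have bij: "bij_betw (\<lambda>w. u * w) multipliers multipliers"
    by (rule bij_betw_byWitness[where f' = "\<lambda>w. inverse u * w"])
      (use assms multipliers_nonzero in \<open>auto intro: multipliers_mult multipliers_inverse\<close>)
  have "(\<Prod>w\<in>multipliers. w) = (\<Prod>w\<in>multipliers. u * w)"
    using prod.reindex_bij_betw[OF bij, of "\<lambda>w. w"] by simp
  also have "\<dots> = u ^ card multipliers * (\<Prod>w\<in>multipliers. w)"
    by (simp add: prod.distrib)
  finally show ?thesis using multipliers_nonzero finite_multipliers by auto
qed

text \<open>The shifts act freely on the points other than infinity.\<close>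

lemma card_orbit_infinity: "card shifts dvd card (orb infinity) - 1"
proof -
  let ?t = "\<lambda>b :: 'a. mat2 1 b 0 (1 :: 'a)"
  let ?C = "\<lambda>P. (\<lambda>b. act (?t b) P) ` shifts"
  have fix_inf: "act (?t b) infinity = infinity" for b
    by (simp add: infinity_def)
  have comp: "act (?t a) (act (?t b) P) = act (?t (a + b)) P" for a b P
    by (simp add: act_mult[symmetric] add.commute)
  have zero: "act (?t 0) P = P" for P by (simp add: mat2_one[symmetric])
  have free: "b = 0" if "act (?t b) P = P" "P \<in> points" "P \<noteq> infinity" for b P
    using that fixed_points_triangular(2)[of 1 b] by (auto simp: fixed_points_def infinity_def)
  have "card shifts dvd card (orb infinity - {infinity})"
  proof (rule dvd_card_of_equal_classes[where C = ?C])
    fix P assume "P \<in> orb infinity - {infinity}"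
    then have P: "P \<in> orb infinity" "P \<noteq> infinity" "P \<in> points" using orb_points[OF infinity_point] by auto
    have "inj_on (\<lambda>b. act (?t b) P) shifts"
    proof (rule inj_onI)
      fix a b assume "act (?t a) P = act (?t b) P"
      then have "act (?t (- b)) (act (?t a) P) = act (?t (- b)) (act (?t b) P)" by simp
      then have "act (?t (- b + a)) P = P" by (simp add: comp zero del: mat2_mult)
      then have "- b + a = 0" using free[OF _ P(3,2)] by blast
      then show "a = b" by simp
    qed
    moreover have "P \<in> ?C P" using shifts_zero zero[of P] by force
    moreover have "act (?t b) P \<in> orb infinity - {infinity}" if "b \<in> shifts" for b
    proof -
      have "act (?t b) P \<in> orb P" using that by (auto simp: orb_def shifts_def)
      moreover have "orb P = orb infinity" using orb_eq P(1) by blast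
      moreover have "act (?t b) P \<noteq> infinity"
      proof
        assume "act (?t b) P = infinity"
        then have "act (?t (- b)) (act (?t b) P) = infinity" by (simp only: fix_inf)
        then show False using P(2) by (simp add: comp zero)
      qed
      ultimately show ?thesis by simp
    qed
    ultimately show "P \<in> ?C P \<and> ?C P \<subseteq> orb infinity - {infinity} \<and> card (?C P) = card shifts"
      by (auto simp: card_image)
  next
    fix P Q assume "Q \<in> ?C P"
    then obtain b where b: "b \<in> shifts" "Q = act (?t b) P" by blast
    have "act (?t a) Q \<in> ?C P" if "a \<in> shifts" for a
      using shifts_add[OF that b(1)] b(2) by (auto simp: comp)
    moreover have "act (?t a) P \<in> ?C Q" if "a \<in> shifts" for a
    proof -
      have "act (?t a) P = act (?t (a + - b)) Q" by (simp add: b(2) comp)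
      then show ?thesis using shifts_add[OF that shifts_uminus[OF b(1)]] by blast
    qed
    ultimately show "?C Q = ?C P" by blast
  qed simp
  then show ?thesis using self_in_orb by simp
qed

end

section \<open>Groups with parabolic elements\<close>

context finite_SL2_subgroup
begin

lemma eigenvalue_ratio_infinity:
  assumes "A \<in> stab infinity" obtains u where "u \<in> multipliers" "(trace A)\<^sup>2 - 2 = u + 1 / u"
proof -
  obtain l b where A: "A \<in> G" "l \<noteq> 0" "A = mat2 l b 0 (1 / l)" using assms by (auto simp: stab_infinity_iff)
  have "l\<^sup>2 \<in> multipliers" using A unfolding multipliers_def by blast
  moreover have "(trace A)\<^sup>2 - 2 = l\<^sup>2 + 1 / l\<^sup>2" using A by (simp add: power2_eq_square field_simps)
  ultimately show ?thesis by (rule that)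
qed

text \<open>The orbit of infinity has a weight of at least 1, so that there is at most one other orbit, and its stabilizers are tame.
If there is none, then \<open>G\<close> fixes infinity. Otherwise the equation for the weights is the one of
\<open>wild_orbit_arithmetic\<close>, which determines the order of \<open>G\<close> up to the exceptional case. The quotient \<open>u\<close> of the
eigenvalues of an element satisfies \<open>u ^ q = u\<close> if it fixes a point in the orbit of infinity, and \<open>u ^ q = 1 / u\<close> if it
fixes one in the tame orbit, where \<open>q\<close> is the number of shifts; in both cases \<open>u + 1 / u\<close> lies in the field with \<open>q\<close>
elements.\<close>

theorem wild_subgroup:
  assumes p: "p = CHAR('a)" "prime p"
    and no_fix: "\<And>P. P \<in> points \<Longrightarrow> card (orb P) \<noteq> 1"
    and wild: "pars infinity \<noteq> {}"
    and q3: "card shifts \<ge> 3"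
    and A: "A \<in> G"
  shows "\<exists>m\<ge>1. ((trace A)\<^sup>2 - 2) ^ (p ^ m) = (trace A)\<^sup>2 - 2 \<and> (m \<le> 2 \<or> card G \<ge> p ^ m * (p ^ (2 * m) - 1))"
proof -
  define q where "q = card shifts"
  define c where "c = card multipliers"
  define N where "N = card (orb infinity)"
  have q: "q \<ge> 3" using q3 by (simp add: q_def)
  have cdvd: "c dvd q - 1" using card_multipliers_dvd by (simp add: c_def q_def)
  have c1: "c \<ge> 1" using multipliers_one finite_multipliers by (auto simp: c_def Suc_le_eq card_gt_0_iff)
  have Npos: "N \<ge> 1" using self_in_orb[of infinity] by (auto simp: N_def Suc_le_eq card_gt_0_iff)
  have N2: "N \<ge> 2" using no_fix[OF infinity_point] Npos by (simp add: N_def)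
  have cardG: "card G = z * (N * (q * c))"
    using card_G[OF infinity_point] by (simp add: N_def stab_order_infinity q_def c_def)
  have "q dvd N - 1" using card_orbit_infinity by (simp add: q_def N_def)
  then obtain k where "N - 1 = q * k" by (rule dvdE)
  then have k: "N = 1 + k * q" using Npos by (simp add: mult.commute)
  have k1: "k \<ge> 1" using k N2 by (cases k) auto
  have inf_special: "infinity \<in> special"
    using wild by (auto simp: pars_def stab_def special_def parabolic_def)
  have w_inf: "orbit_weight (orb infinity) = 1 + (real q - 2) / (real q * real c)"
  proof -
    have "real (card (stab infinity)) = real z * (real q * real c)" using card_stab_infinity by (simp add: q_def c_def)
    moreover have "real (card (pars infinity)) = real z * real q - real z"
      using card_pars_infinity by (simp add: q_def flip: of_nat_mult of_nat_add)
    ultimately have "orbit_weight (orb infinity) = (real z * (real q * real c + real q - 2)) / (real z * (real q * real c))"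
      unfolding orbit_weight_orb weight_def by (simp add: algebra_simps)
    also have "\<dots> = (real q * real c + real q - 2) / (real q * real c)" using z_pos by simp
    also have "\<dots> = 1 + (real q - 2) / (real q * real c)" using q c1 by (simp add: field_simps)
    finally show ?thesis .
  qed
  define h where "h = real N * (real q * real c)"
  have h: "real z / real (card G) = 1 / h" using z_pos by (simp add: cardG h_def)
  have hpos: "h > 0" using Npos q c1 by (simp add: h_def)
  define R where "R = orbits - {orb infinity}"
  have fR: "finite R" using finite_orbits by (simp add: R_def)
  have "(\<Sum>C\<in>orbits. orbit_weight C) = orbit_weight (orb infinity) + (\<Sum>C\<in>R. orbit_weight C)"
    unfolding R_def using inf_special finite_orbits by (intro sum.remove) (auto simp: orbits_def)
  moreover have "2 * real z / real (card G) = 2 * (1 / h)" by (simp flip: h)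
  ultimately have eq: "(\<Sum>C\<in>R. orbit_weight C) = 1 - 2 / h - (real q - 2) / (real q * real c)"
    using sum_orbit_weights w_inf by simp
  have qc: "(real q - 2) / (real q * real c) > 0" using q c1 by simp
  have lt1: "(\<Sum>C\<in>R. orbit_weight C) < 1"
  proof -
    have "2 / h > 0" using hpos by simp
    then show ?thesis using eq qc by linarith
  qed
  have half: "orbit_weight C \<ge> 1 / 2" if "C \<in> R" for C
  proof -
    from that have "C \<in> orbits" by (simp add: R_def)
    then obtain Q where Q: "Q \<in> special" "C = orb Q" by (rule orbitsE)
    show ?thesis
    proof (cases "pars Q = {}")
      case True
      have "1 / real (stab_order Q) \<le> 1 / 2" using stab_order_special[OF Q(1)] by (simp add: field_simps)
      then show ?thesis using Q special_points[OF Q(1)] True by (simp add: orbit_weight_orb weight_tame)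
    next
      case False
      then show ?thesis using weight_wild[OF special_points[OF Q(1)]] Q by (simp add: orbit_weight_orb)
    qed
  qed
  have "(\<Sum>C\<in>R. 1 / 2) \<le> (\<Sum>C\<in>R. orbit_weight C)" by (rule sum_mono) (rule half)
  then have "real (card R) / 2 \<le> (\<Sum>C\<in>R. orbit_weight C)" by simp
  with lt1 have "card R < 2" by linarith
  moreover have "card R \<noteq> 0"
  proof
    assume "card R = 0"
    then have "R = {}" using fR by simp
    then have "1 - 2 / h = (real q - 2) / (real q * real c)" using eq by simp
    moreover have "2 / h \<le> 1 / (real q * real c)"
      using N2 q c1 by (simp add: h_def field_simps)
    ultimately have "1 \<le> (real q - 2) / (real q * real c) + 1 / (real q * real c)" by linarith
    also have "\<dots> = (real q - 1) / (real q * real c)" by (simp add: add_divide_distrib[symmetric])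
    finally have "real q * real c \<le> real q - 1" using q c1 by (simp add: field_simps)
    moreover have "real q * real c \<ge> real q * 1" using c1 by (intro mult_left_mono) auto
    ultimately show False by linarith
  qed
  ultimately have "card R = 1" by linarith
  then obtain C where C: "R = {C}" by (auto simp: card_1_singleton_iff)
  then have "C \<in> orbits" by (auto simp: R_def)
  then obtain Q where Q: "Q \<in> special" "C = orb Q" by (rule orbitsE)
  have orbs: "orbits = {orb infinity, orb Q}"
    using C Q inf_special unfolding R_def orbits_def by blast
  have tameQ: "pars Q = {}"
  proof (rule ccontr)
    assume "pars Q \<noteq> {}"
    then have "orbit_weight C \<ge> 1" using weight_wild[OF special_points[OF Q(1)]] Q by (simp add: orbit_weight_orb)
    with lt1 C show False by simp
  qed
  define f where "f = stab_order Q"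
  have f1: "f \<ge> 1" using stab_order_special[OF Q(1)] by (simp add: f_def)
  have "1 / real f = 2 / h + (real q - 2) / (real q * real c)"
    using eq C Q tameQ special_points[OF Q(1)] by (simp add: orbit_weight_orb weight_tame f_def)
  also have "\<dots> = (2 + (real q - 2) * real N) / h"
  proof -
    have "(real q - 2) * real N / h = (real N * (real q - 2)) / (real N * (real q * real c))"
      by (simp only: h_def mult.commute)
    also have "\<dots> = (real q - 2) / (real q * real c)"
      using Npos by (intro mult_divide_mult_cancel_left) simp
    finally show ?thesis by (simp add: add_divide_distrib)
  qed
  finally have "h = real f * (2 + (real q - 2) * real N)" using f1 hpos by (simp add: field_simps)
  then have "real q * (real c * (1 + real k * real q)) = real q * (real f * (1 + real k * (real q - 2)))"
    by (simp add: h_def k algebra_simps)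
  then have "real c * (1 + real k * real q) = real f * (1 + real k * (real q - 2))" using q by simp
  moreover have "real (q - 2) = real q - 2" using q by (simp add: of_nat_diff)
  ultimately have "real (c * (1 + k * q)) = real (f * (1 + k * (q - 2)))"
    by (simp only: of_nat_add of_nat_mult of_nat_1)
  then have ar: "f * (1 + k * (q - 2)) = c * (1 + k * q)" using of_nat_eq_iff by metis
  (* \<open>u\<close> is the quotient of the eigenvalues of \<open>A\<close> *)
  obtain u where u: "u \<noteq> 0" "(trace A)\<^sup>2 - 2 = u + 1 / u" "u ^ c = 1 \<or> u ^ f = 1"
  proof (cases "central A \<or> parabolic A")
    case True
    then have "(trace A)\<^sup>2 = 4"
      by (auto simp: parabolic_def central_def mat2_one)
    then show ?thesis using that[of 1] by simp
  next
    case False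
    obtain P where P: "P \<in> fixed_points A" using fixed_point_exists[OF det[OF A]] by blast
    then have PA: "A \<in> stab P" "P \<in> points" "P \<in> special" using False A by (auto simp: fixed_points_def stab_def special_def)
    then have "orb P = orb infinity \<or> orb P = orb Q" using orbs unfolding orbits_def by blast
    then have "P \<in> orb infinity \<or> P \<in> orb Q" using self_in_orb[of P] by auto
    then show ?thesis
    proof
      assume "P \<in> orb infinity"
      then obtain B where B: "B \<in> G" "P = act B infinity" by (auto simp: orb_def)
      have "bij_betw (\<lambda>A. B ** A ** adj B) (stab infinity) (stab P)" using stab_conj(1)[OF B(1)] B(2) by simp
      then obtain A' where A': "A' \<in> stab infinity" "A = B ** A' ** adj B" using PA(1) by (auto simp: bij_betw_def)
      obtain u where u: "u \<in> multipliers" "(trace A')\<^sup>2 - 2 = u + 1 / u" using eigenvalue_ratio_infinity[OF A'(1)] by blast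
      have "trace A = trace A'" using A'(2) B(1) by (simp add: trace_conj)
      then show ?thesis using that[of u] u multipliers_power[OF u(1)] multipliers_nonzero[OF u(1)] by (simp add: c_def)
    next
      assume "P \<in> orb Q"
      then have "stab_order P = f" using orbit_invariant(1) by (simp add: stab_order_def f_def)
      then show ?thesis using trace_at_fixed_point[OF PA(1,2)] that by metis
    qed
  qed
  define y where "y = (trace A)\<^sup>2 - 2"
  have y: "y = u + 1 / u" using u(2) by (simp add: y_def)
  from wild_orbit_arithmetic[OF q cdvd k1 ar] have "\<exists>m\<ge>1. y ^ (p ^ m) = y \<and> (m \<le> 2 \<or> card G \<ge> p ^ m * (p ^ (2 * m) - 1))"
  proof (elim disjE conjE)
    assume k: "k = 1" and f: "f dvd q + 1" and c2: "q - 1 dvd 2 * c"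
    have "prime (CHAR('a))" using p by simp
    then obtain m where m: "q = p ^ m"
      using card_additive_subgroup[OF _ finite_shifts shifts_zero shifts_add shifts_uminus] p(1) q_def by metis
    have "m \<ge> 1" using m q by (cases m) auto
    have "u ^ q = u \<or> u ^ q = 1 / u"
      using u(3)
    proof
      assume uc: "u ^ c = 1"
      obtain j where "q - 1 = c * j" using cdvd by (rule dvdE)
      then have "u ^ (q - 1) = 1" using uc by (simp add: power_mult)
      moreover have "u ^ q = u ^ (q - 1) * u" using q by (metis power_minus_mult le_trans zero_less_numeral less_le_trans)
      ultimately show ?thesis by simp
    next
      assume uf: "u ^ f = 1"
      obtain j where "q + 1 = f * j" using f by (rule dvdE)
      then have "u ^ (q + 1) = 1" using uf by (simp only: power_mult power_one)
      then show ?thesis using u(1) by (simp add: field_simps)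
    qed
    then have "y ^ (p ^ m) = y" unfolding y frob_add[OF p] using u(1) by (auto simp: power_divide m[symmetric])
    moreover have "q - 1 \<le> z * c"
    proof (cases "p = 2")
      case True
      then have "odd (q - 1)" using m \<open>m \<ge> 1\<close> q by auto
      then have "q - 1 dvd c" using c2 coprime_dvd_mult_right_iff[of "q - 1" 2 c] by simp
      then have "q - 1 \<le> c" using c1 by (simp add: dvd_imp_le)
      also have "c \<le> z * c" using z_pos by simp
      finally show ?thesis .
    next
      case False
      have "(1::'a) \<noteq> -1"
      proof
        assume "(1::'a) = -1"
        then have "of_nat 2 = (0::'a)" by (metis add_eq_0_iff of_nat_numeral one_add_one)
        then have "p dvd 2" using p(1) by (simp only: of_nat_eq_0_iff_char_dvd)
        then show False using False p(2) by (metis primes_dvd_imp_eq two_is_prime_nat)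
      qed
      then have "z = 2" by (rule z_cases)
      then show ?thesis using c2 c1 by (simp add: dvd_imp_le)
    qed
    then have "q * (q + 1) * (q - 1) \<le> q * (q + 1) * (z * c)" by simp
    then have "q * (q + 1) * (q - 1) \<le> card G" using cardG \<open>N = 1 + k * q\<close> k by (simp add: algebra_simps)
    moreover have "p ^ m * (p ^ (2 * m) - 1) = q * (q + 1) * (q - 1)"
    proof -
      have 1: "p ^ (2 * m) = q * q" by (simp add: m mult_2 power_add)
      have 2: "q * q - 1 = (q + 1) * (q - 1)" using q by (simp add: algebra_simps diff_mult_distrib2)
      show ?thesis unfolding 1 2 m[symmetric] by (simp only: mult.assoc)
    qed
    ultimately show ?thesis using \<open>m \<ge> 1\<close> by metis
  next
    assume "c = 2" "f = 5"
    then have "y ^ (p ^ 2) = y" unfolding y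
      using u small_order_trace[OF p u(1), of c] small_order_trace[OF p u(1), of f] by auto
    then show ?thesis by (intro exI[of _ 2]) simp
  qed
  then show ?thesis by (simp add: y_def)
qed

lemma conjugate_subgroup:
  assumes B: "det B = 1"
  shows "finite_SL2_subgroup ((\<lambda>A. adj B ** A ** B) ` G)"
proof
  fix S T assume "S \<in> (\<lambda>A. adj B ** A ** B) ` G" "T \<in> (\<lambda>A. adj B ** A ** B) ` G"
  then obtain S' T' where ST: "S' \<in> G" "S = adj B ** S' ** B" "T' \<in> G" "T = adj B ** T' ** B" by blast
  have "S ** T = adj B ** (S' ** T') ** B"
    unfolding ST using B by (simp add: matrix_mul_assoc[symmetric] adj_cancel)
  then show "S ** T \<in> (\<lambda>A. adj B ** A ** B) ` G" using ST by blast
next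
  have "mat 1 = adj B ** mat 1 ** B" using B by (simp add: adj_mult)
  then show "mat 1 \<in> (\<lambda>A. adj B ** A ** B) ` G" by blast
next
  fix S assume "S \<in> (\<lambda>A. adj B ** A ** B) ` G"
  then obtain S' where S: "S' \<in> G" "S = adj B ** S' ** B" by blast
  then show "det S = 1" using B by (simp add: det_mul)
  have "adj S = adj B ** adj S' ** B" unfolding S
    by (cases B rule: mat2_cases, cases S' rule: mat2_cases) (simp add: algebra_simps)
  then show "adj S \<in> (\<lambda>A. adj B ** A ** B) ` G" using S by blast
  have "- S = adj B ** (- S') ** B" unfolding S
    by (cases B rule: mat2_cases, cases S' rule: mat2_cases) (simp add: algebra_simps)
  then show "- S \<in> (\<lambda>A. adj B ** A ** B) ` G" using S by blast
qed (use finite_G in simp)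

text \<open>The extreme cases are the exceptional groups, whose elements have order at most five, and the groups over the field with
\<open>p ^ m\<close> elements. Any point fixed by a parabolic element can be moved to infinity.\<close>

theorem trace_in_small_field:
  assumes p: "p = CHAR('a)" "prime p"
    and no_fix: "\<And>P. P \<in> points \<Longrightarrow> card (orb P) \<noteq> 1"
    and no_pair: "\<And>P. P \<in> points \<Longrightarrow> card (orb P) \<noteq> 2"
    and two: "p = 2 \<Longrightarrow> \<exists>P \<in> points. card (pars P) \<ge> 2"
    and A: "A \<in> G"
  shows "\<exists>m\<ge>1. ((trace A)\<^sup>2 - 2) ^ (p ^ m) = (trace A)\<^sup>2 - 2 \<and> (m \<le> 2 \<or> card G \<ge> p ^ m * (p ^ (2 * m) - 1))"
proof (cases "\<exists>P \<in> points. pars P \<noteq> {}")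
  case True
  then obtain P where P: "P \<in> points" "pars P \<noteq> {}" "p = 2 \<Longrightarrow> card (pars P) \<ge> 2"
    using two by (metis card.empty not_numeral_le_zero)
  obtain B where B: "det B = 1" "act B infinity = P" using points_transitive[OF P(1)] unfolding infinity_def by metis
  let ?c = "\<lambda>A. adj B ** A ** B"
  interpret C: finite_SL2_subgroup "?c ` G" by (rule conjugate_subgroup[OF B(1)])
  have adj_adj: "adj (adj B) = B" by (cases B rule: mat2_cases) simp
  have act_c: "act (?c A) Q = act (adj B) (act A (act B Q))" for A Q by (simp add: act_mult)
  have "C.orb Q = act (adj B) ` orb (act B Q)" for Q
    by (auto simp: C.orb_def orb_def act_c image_image)
  moreover have "inj_on (act (adj B)) S" for S using act_inj[of "adj B"] B(1) by (simp add: inj_on_def)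
  ultimately have orb: "card (C.orb Q) = card (orb (act B Q))" for Q by (simp add: card_image)
  have inj: "inj_on ?c S" for S
    by (rule inj_on_inverseI[of _ "\<lambda>A. B ** A ** adj B"]) (simp add: matrix_mul_assoc[symmetric] adj_cancel adj_mult B(1))
  have "C.pars infinity = ?c ` pars P"
  proof -
    have "act (?c A) infinity = infinity \<longleftrightarrow> act A P = P" for A
      by (metis act_c B act_adj_cancel)
    moreover have "parabolic (?c A) \<longleftrightarrow> parabolic A" for A
      using parabolic_conj[of "adj B" A] B(1) by (simp add: adj_adj)
    ultimately show ?thesis by (auto simp: C.pars_def C.stab_def pars_def stab_def)
  qed
  then have pars: "C.pars infinity \<noteq> {}" "card (C.pars infinity) = card (pars P)"
    using P(2) by (auto simp: card_image[OF inj])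
  then have pos: "card (C.pars infinity) \<ge> 1" using P(2) by (simp add: Suc_le_eq card_gt_0_iff)
  have "card C.shifts \<ge> 3"
  proof (cases "p = 2")
    case True
    then have "of_nat 2 = (0::'a)" using p(1) by (metis of_nat_CHAR)
    then have "(1::'a) = -1" by (simp add: eq_neg_iff_add_eq_0)
    then have "C.z = 1" by (rule C.z_cases)
    then show ?thesis using C.card_pars_infinity P(3)[OF True] pars(2) by simp
  next
    case False
    have "card C.shifts \<noteq> 1" using C.card_pars_infinity pos by auto
    moreover have "prime (CHAR('a))" using p by simp
    then obtain m where m: "card C.shifts = p ^ m"
      using card_additive_subgroup[OF _ C.finite_shifts C.shifts_zero C.shifts_add C.shifts_uminus] p(1) by metis
    ultimately have "m \<noteq> 0" by (cases m) auto
    then have "p \<le> p ^ m" using p(2) prime_gt_0_nat by (simp add: self_le_power Suc_le_eq)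
    moreover have "p \<ge> 3" using False prime_ge_2_nat[OF p(2)] by linarith
    ultimately show ?thesis using m by linarith
  qed
  moreover have "card (C.orb Q) \<noteq> 1" if "Q \<in> points" for Q
    using no_fix[of "act B Q"] act_points[OF B(1) that] by (simp add: orb)
  moreover have "?c A \<in> ?c ` G" using A by blast
  ultimately have "\<exists>m\<ge>1. ((trace (?c A))\<^sup>2 - 2) ^ (p ^ m) = (trace (?c A))\<^sup>2 - 2 \<and> (m \<le> 2 \<or> card (?c ` G) \<ge> p ^ m * (p ^ (2 * m) - 1))"
    using C.wild_subgroup[OF p _ pars(1)] by blast
  moreover have "trace (?c A) = trace A" using trace_conj[of "adj B" A] B(1) by (simp add: adj_adj)
  moreover have "card (?c ` G) = card G" by (rule card_image[OF inj])
  ultimately show ?thesis by simp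
next
  case False
  obtain P where P: "P \<in> fixed_points A" using fixed_point_exists[OF det[OF A]] by blast
  then have "P \<in> points" by (simp add: fixed_points_def)
  have tame: "\<not> parabolic S" if SG: "S \<in> G" for S
  proof
    assume S: "parabolic S"
    obtain R where R: "R \<in> fixed_points S" using fixed_point_exists[OF det[OF SG]] by blast
    then have "S \<in> pars R" "R \<in> points" using S SG by (auto simp: pars_def stab_def fixed_points_def)
    with False show False by blast
  qed
  have "((trace A)\<^sup>2 - 2) ^ (p ^ 2) = (trace A)\<^sup>2 - 2"
  proof (cases "central A")
    case True
    then have "(trace A)\<^sup>2 - 2 = 1 + 1 / (1::'a)" by (auto simp: central_def mat2_one)
    then show ?thesis using small_order_trace[OF p, of 1 1] by simp
  next
    case False
    have AP: "A \<in> stab P" "P \<in> special"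
      using P A False by (auto simp: fixed_points_def stab_def special_def)
    obtain u where u: "u \<noteq> 0" "u ^ stab_order P = 1" "(trace A)\<^sup>2 - 2 = u + 1 / u"
      using trace_at_fixed_point[OF AP(1) \<open>P \<in> points\<close>] by blast
    have "stab_order P \<le> 5" using tame_stabilizer_bound[OF tame no_fix no_pair AP(2)] .
    then show ?thesis using small_order_trace[OF p u(1,2)] stab_order_special[OF AP(2)] unfolding u(3) by simp
  qed
  then show ?thesis by (intro exI[of _ 2]) simp
qed

end

section \<open>Small orbits\<close>

text \<open>If \<open>S\<close> moves infinity and \<open>S\<^sup>2\<close> fixes it, then the lower left entry of \<open>S\<^sup>2\<close>, which is the trace times the lower left
entry of \<open>S\<close>, vanishes.\<close>

lemma trace_zero_of_swap:
  fixes S :: "'a::field ^ 2 ^ 2"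
  assumes "det S = 1" "P \<in> points" "act S P \<noteq> P" "act S (act S P) = P"
  shows "trace S = 0"
proof -
  obtain B where B: "det B = 1" "act B (line (vec2 1 0)) = P" using assms(2) points_transitive by metis
  have aa: "adj (adj B) = B" by (cases B rule: mat2_cases) simp
  define T where "T = adj B ** S ** B"
  obtain a b c d where T: "T = mat2 a b c d" by (rule mat2_cases)
  have dT: "det T = 1" unfolding T_def using B assms(1) by (simp add: det_mul)
  have act_T: "act T Q = act (adj B) (act S (act B Q))" for Q by (simp add: T_def act_mult)
  have "act T (line (vec2 1 0)) \<noteq> line (vec2 1 0)"
    using assms(3) B by (metis act_T act_adj_cancel(2))
  then have "c \<noteq> 0" using fixes_infinity_iff[OF dT] T by simp
  moreover have "act (T ** T) (line (vec2 1 0)) = line (vec2 1 0)"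
    unfolding act_mult act_T using assms(4) B by (metis act_adj_cancel)
  then have "(T ** T) $ 2 $ 1 = 0" using fixes_infinity_iff[of "T ** T"] dT by (simp add: det_mul del: act_line)
  then have "c * (a + d) = 0" by (simp add: T algebra_simps)
  ultimately have "trace T = 0" by (simp add: T)
  then show ?thesis using trace_conj[of "adj B" S] B(1) by (simp add: T_def aa)
qed

lemma eigenvector_of_fixed_point:
  assumes "v \<noteq> 0" "act A (line v) = line v" obtains k where "k \<noteq> 0" "A *v v = k *s (v :: 'a::field ^ 2)"
  using assms line_eq_iff[OF assms(1), of "A *v v"] by auto

lemma eigenvalue_equation:
  fixes A :: "'a::field ^ 2 ^ 2"
  assumes "det A = 1" "v \<noteq> 0" "A *v v = k *s v"
  shows "k\<^sup>2 - trace A * k + 1 = 0"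
proof -
  obtain a b c d where A: "A = mat2 a b c d" by (rule mat2_cases)
  obtain x y where v: "v = vec2 x y" by (rule vec2_cases)
  have e: "a * x + b * y = k * x" "c * x + d * y = k * y" "a * d - b * c = 1"
    using assms by (simp_all add: A v)
  have "(k\<^sup>2 - (a + d) * k + 1) * x = (k - d) * (k * x - (a * x + b * y)) + b * (k * y - (c * x + d * y)) + (1 - (a * d - b * c)) * x"
    by (simp add: algebra_simps power2_eq_square)
  moreover have "(k\<^sup>2 - (a + d) * k + 1) * y = (k - a) * (k * y - (c * x + d * y)) + c * (k * x - (a * x + b * y)) + (1 - (a * d - b * c)) * y"
    by (simp add: algebra_simps power2_eq_square)
  ultimately have "(k\<^sup>2 - (a + d) * k + 1) * x = 0" "(k\<^sup>2 - (a + d) * k + 1) * y = 0"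
    by (simp_all add: e)
  then show ?thesis using assms(2) by (auto simp: A v vec2_zero)
qed

lemma uminus_vmult: "(- A) *v v = - (A *v v)" for A :: "'a::field ^ 2 ^ 2"
proof -
  have "- vec2 x y = vec2 (- x) (- y)" for x y :: 'a by (simp add: vec_eq_iff forall_2)
  then show ?thesis by (cases A rule: mat2_cases, cases v rule: vec2_cases) simp
qed

lemma anticommuting_no_common_fixed_point:
  fixes M N :: "'a::field ^ 2 ^ 2"
  assumes "M ** N = - (N ** M)" "(1::'a) \<noteq> -1" "P \<in> points" "act M P = P" "act N P = P"
  shows False
proof -
  obtain v where v: "v \<noteq> 0" "P = line v" using assms(3) by (auto simp: points_def)
  obtain k where k: "k \<noteq> 0" "M *v v = k *s v" using eigenvector_of_fixed_point v assms(4) by metis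
  obtain l where l: "l \<noteq> 0" "N *v v = l *s v" using eigenvector_of_fixed_point v assms(5) by metis
  have "(M ** N) *v v = (k * l) *s v" "(N ** M) *v v = (k * l) *s v"
    using k l by (simp_all add: matrix_vector_mul_assoc[symmetric] vector_scalar_commute mult.commute)
  then have "(k * l) *s v = - ((k * l) *s v)" using assms(1) by (metis uminus_vmult)
  then have "(k * l) *s v + (k * l) *s v = 0" by (metis add.right_inverse)
  then have "((1 - -1) * (k * l)) *s v = 0" by (cases v rule: vec2_cases) (simp add: vec2_zero vec_eq_iff forall_2 algebra_simps)
  then show False using v(1) k(1) l(1) assms(2) by (cases v rule: vec2_cases) (auto simp: vec2_zero)
qed

text \<open>The eigenvalues at the common fixed point are square roots of \<open>-1\<close>, so their product is \<open>1\<close> or \<open>-1\<close>.\<close>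

lemma traceless_common_fixed_point:
  fixes M N :: "'a::field ^ 2 ^ 2"
  assumes "det M = 1" "det N = 1" "trace M = 0" "trace N = 0" "P \<in> points" "act M P = P" "act N P = P"
  shows "(trace (M ** N))\<^sup>2 = 4"
proof -
  obtain v where v: "v \<noteq> 0" "P = line v" using assms(5) by (auto simp: points_def)
  obtain k where k: "k \<noteq> 0" "M *v v = k *s v" using eigenvector_of_fixed_point v assms(6) by metis
  obtain l where l: "l \<noteq> 0" "N *v v = l *s v" using eigenvector_of_fixed_point v assms(7) by metis
  have "k\<^sup>2 = -1" "l\<^sup>2 = -1"
    using eigenvalue_equation[OF assms(1) v(1) k(2)] eigenvalue_equation[OF assms(2) v(1) l(2)] assms(3,4)
    by (simp_all add: eq_neg_iff_add_eq_0)
  then have kl: "(k * l)\<^sup>2 = 1" by (simp add: power_mult_distrib)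
  have "(M ** N) *v v = (k * l) *s v"
    using k l by (simp add: matrix_vector_mul_assoc[symmetric] vector_scalar_commute mult.commute)
  then have "(k * l)\<^sup>2 - trace (M ** N) * (k * l) + 1 = 0"
    using eigenvalue_equation[of "M ** N" v "k * l"] assms(1,2) v(1) by (simp add: det_mul)
  then have "trace (M ** N) * (k * l) = 2" using kl by simp
  then have "(trace (M ** N))\<^sup>2 * (k * l)\<^sup>2 = 2\<^sup>2" by (metis power_mult_distrib)
  then show ?thesis using kl by simp
qed

context finite_SL2_subgroup
begin

lemma orbit_of_size_two:
  assumes "card (orb P) = 2"
  obtains P' where "P' \<noteq> P"
    "\<And>A. A \<in> G \<Longrightarrow> (act A P = P \<and> act A P' = P') \<or> (act A P = P' \<and> act A P' = P)"
proof -
  obtain S T where ST: "orb P = {S, T}" "S \<noteq> T" using assms by (auto simp: card_2_iff)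
  then obtain P' where P': "orb P = {P, P'}" "P' \<noteq> P" using self_in_orb[of P] by (metis doubleton_eq_iff insertE singletonD)
  have "(act A P = P \<and> act A P' = P') \<or> (act A P = P' \<and> act A P' = P)" if A: "A \<in> G" for A
  proof -
    have "act A P \<in> orb P" using A by (auto simp: orb_def)
    moreover have "act A P' \<in> orb P'" using A by (auto simp: orb_def)
    then have "act A P' \<in> orb P" using orb_eq[of P' P] P'(1) by simp
    moreover have "act A P \<noteq> act A P'" using act_adj_cancel(1)[OF det[OF A]] P'(2) by metis
    ultimately show ?thesis using P' by auto
  qed
  with P'(2) that show ?thesis by blast
qed

lemma orbit_of_size_one: "card (orb P) = 1 \<Longrightarrow> A \<in> G \<Longrightarrow> act A P = P"
proof -
  assume "card (orb P) = 1" "A \<in> G"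
  then obtain S where "orb P = {S}" "act A P \<in> orb P" by (auto simp: card_1_singleton_iff orb_def)
  then show ?thesis using self_in_orb[of P] by simp
qed

text \<open>Two of the involutions \<open>I\<close>, \<open>J\<close>, \<open>I ** J\<close> never have a common fixed point. So if two points form an orbit, then exactly
one of the three, \<open>M\<close>, fixes both points. If \<open>R\<close> fixes them as well, then \<open>M ** R\<close> has the trace \<open>2\<close> or \<open>-2\<close>; if it swaps
them, then so does \<open>M ** R\<close>, which has the trace \<open>0\<close>.\<close>

lemma no_small_orbit_quaternion:
  assumes "(1::'a) \<noteq> -1" "I \<in> G" "J \<in> G" "R \<in> G" "I ** J = - (J ** I)"
    "trace I = 0" "trace J = 0" "trace (I ** J) = 0" "trace R = 0"
    and nz: "\<And>M. M \<in> {I, J, I ** J} \<Longrightarrow> trace (M ** R) \<noteq> 0 \<and> (trace (M ** R))\<^sup>2 \<noteq> 4"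
    and P: "P \<in> points"
  shows "card (orb P) \<noteq> 1" "card (orb P) \<noteq> 2"
proof -
  note anti = anticommuting_no_common_fixed_point[OF assms(5,1) P]
  show "card (orb P) \<noteq> 1" using anti orbit_of_size_one assms(2,3) by blast
  show "card (orb P) \<noteq> 2"
  proof
    assume "card (orb P) = 2"
    then obtain P' where P': "P' \<noteq> P"
      and sw: "\<And>A. A \<in> G \<Longrightarrow> (act A P = P \<and> act A P' = P') \<or> (act A P = P' \<and> act A P' = P)"
      using orbit_of_size_two by blast
    have "\<exists>M \<in> {I, J, I ** J}. act M P = P" using sw[OF assms(2)] sw[OF assms(3)] by (auto simp: act_mult)
    then obtain M where M: "M \<in> {I, J, I ** J}" "act M P = P" by blast
    have MG: "M \<in> G" "trace M = 0" using M assms by auto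
    have MP': "act M P' = P'" using sw[OF MG(1)] M(2) P' by auto
    show False
    proof (cases "act R P = P")
      case True
      have "(trace (M ** R))\<^sup>2 = 4"
        by (rule traceless_common_fixed_point[OF _ _ MG(2) assms(9) P M(2) True]) (use MG(1) assms(4) in auto)
      then show False using nz[OF M(1)] by blast
    next
      case False
      then have R: "act R P = P'" "act R P' = P" using sw[OF assms(4)] by auto
      have "trace (M ** R) = 0"
        by (rule trace_zero_of_swap[OF _ P]) (use MG assms(4) R M(2) MP' P' in \<open>auto simp: act_mult\<close>)
      then show False using nz[OF M(1)] by blast
    qed
  qed
qed

text \<open>Nontrivial translations fix infinity only. They cannot all three swap the same two points, as one is the product of
the other two.\<close>

lemma no_small_orbit_char_two:
  assumes "mat2 1 a 0 1 \<in> G" "mat2 1 b 0 1 \<in> G" "mat2 0 1 1 0 \<in> G" "a \<noteq> 0" "b \<noteq> 0" "a + b \<noteq> 0"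
    and P: "P \<in> points"
  shows "card (orb P) \<noteq> 1" "card (orb P) \<noteq> 2"
proof -
  have fx: "Q = line (vec2 1 0)" if "Q \<in> points" "act (mat2 1 c 0 1) Q = Q" "c \<noteq> 0" for Q and c :: 'a
    using that fixed_points_triangular(2)[of 1 c] by (auto simp: fixed_points_def)
  show "card (orb P) \<noteq> 1"
  proof
    assume "card (orb P) = 1"
    then have *: "act A P = P" if "A \<in> G" for A using orbit_of_size_one that by blast
    then have "P = line (vec2 1 0)" using fx[OF P] assms(1,4) by blast
    then have "line (vec2 0 1) = line (vec2 1 (0::'a))" using *[OF assms(3)] by simp
    then show False by (simp add: line_eq_iff vec2_zero)
  qed
  show "card (orb P) \<noteq> 2"
  proof
    assume "card (orb P) = 2"
    then obtain P' where P': "P' \<noteq> P"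
      and sw: "\<And>A. A \<in> G \<Longrightarrow> (act A P = P \<and> act A P' = P') \<or> (act A P = P' \<and> act A P' = P)"
      using orbit_of_size_two by blast
    have pt: "P' \<in> points"
    proof -
      have "\<not> act (mat2 1 a 0 1) P = P \<or> \<not> act (mat2 1 b 0 1) P = P \<or> P = line (vec2 1 0)" using fx[OF P] assms by blast
      moreover have "act (mat2 0 1 1 0) (line (vec2 1 0)) \<noteq> line (vec2 1 (0::'a))" by (simp add: line_eq_iff vec2_zero)
      ultimately obtain A where "A \<in> G" "act A P \<noteq> P" using assms(1-3) by metis
      then show ?thesis using sw[of A] act_points[OF det P] by metis
    qed
    have nf: "act (mat2 1 c 0 1) P = P' \<and> act (mat2 1 c 0 1) P' = P" if "mat2 1 c 0 1 \<in> G" "c \<noteq> 0" for c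
      using sw[OF that(1)] fx[OF P _ that(2)] fx[OF pt _ that(2)] P' by metis
    have "mat2 1 a 0 1 ** mat2 1 b 0 1 = mat2 1 (a + b) 0 (1::'a)" by (simp add: add.commute)
    then have "mat2 1 (a + b) 0 1 \<in> G" "act (mat2 1 (a + b) 0 1) P = P"
      using nf[OF assms(1,4)] nf[OF assms(2,5)] assms(1,2) mult by (metis, metis act_mult)
    then show False using nf[of "a + b"] assms(6) P' by simp
  qed
qed

end

section \<open>Subgroups over a finite field\<close>

definition to_ac_mat :: "'a::field ^ 2 ^ 2 \<Rightarrow> 'a alg_closure ^ 2 ^ 2" where
  "to_ac_mat A = mat2 (to_ac (A $ 1 $ 1)) (to_ac (A $ 1 $ 2)) (to_ac (A $ 2 $ 1)) (to_ac (A $ 2 $ 2))"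

lemma to_ac_mat_mat2 [simp]: "to_ac_mat (mat2 a b c d) = mat2 (to_ac a) (to_ac b) (to_ac c) (to_ac d)"
  by (simp add: to_ac_mat_def)

lemma to_ac_mat_mult: "to_ac_mat (A ** B) = to_ac_mat A ** to_ac_mat B"
  by (cases A rule: mat2_cases, cases B rule: mat2_cases) simp

lemma to_ac_mat_one: "to_ac_mat (mat 1) = mat 1" by (simp add: mat2_one)
lemma to_ac_mat_uminus: "to_ac_mat (- A) = - to_ac_mat A" by (cases A rule: mat2_cases) simp
lemma to_ac_mat_adj: "to_ac_mat (adj A) = adj (to_ac_mat A)" by (cases A rule: mat2_cases) simp
lemma to_ac_mat_det: "det (to_ac_mat A) = to_ac (det A)" by (cases A rule: mat2_cases) simp
lemma to_ac_mat_trace: "trace (to_ac_mat A) = to_ac (trace A)" by (cases A rule: mat2_cases) simp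

lemma inj_to_ac_mat: "inj to_ac_mat"
proof (rule injI)
  fix A B :: "'a ^ 2 ^ 2" assume "to_ac_mat A = to_ac_mat B"
  then show "A = B" by (cases A rule: mat2_cases, cases B rule: mat2_cases) simp
qed

text \<open>The first column is not zero, and it determines one of the entries of the second column from the other one.\<close>

lemma card_SL2_le:
  assumes "finite (UNIV :: 'a::field set)"
  shows "card {A :: 'a ^ 2 ^ 2. det A = 1} \<le> CARD('a) * (CARD('a)\<^sup>2 - 1)"
proof -
  let ?f = "\<lambda>A :: 'a ^ 2 ^ 2. ((A $ 1 $ 1, A $ 2 $ 1), if A $ 1 $ 1 = 0 then A $ 2 $ 2 else A $ 1 $ 2)"
  have "inj_on ?f {A. det A = 1}"
  proof (rule inj_onI)
    fix A B :: "'a ^ 2 ^ 2" assume AB: "A \<in> {A. det A = 1}" "B \<in> {A. det A = 1}" "?f A = ?f B"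
    obtain a b c d where A: "A = mat2 a b c d" by (rule mat2_cases)
    obtain a' b' c' d' where B: "B = mat2 a' b' c' d'" by (rule mat2_cases)
    have e: "a' = a" "c' = c" and f: "(if a = 0 then d else b) = (if a = 0 then d' else b')"
      using AB(3) by (auto simp: A B)
    have d: "a * d - b * c = 1" "a * d' - b' * c = 1" using AB(1,2) by (simp_all add: A B e)
    show "A = B"
    proof (cases "a = 0")
      case True
      then have "c \<noteq> 0" using d by auto
      have "- (b * c) = - (b' * c)" using d True by simp
      then have "b * c = b' * c" by (simp only: neg_equal_iff_equal)
      then show ?thesis using \<open>c \<noteq> 0\<close> f True by (simp add: A B e)
    next
      case False
      then have "b = b'" using f by simp
      then have "a * d = a * d'" using d by (simp add: algebra_simps)
      then show ?thesis using \<open>b = b'\<close> False by (simp add: A B e)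
    qed
  qed
  moreover have "?f ` {A. det A = 1} \<subseteq> (UNIV \<times> UNIV - {(0, 0)}) \<times> UNIV"
    by (auto simp: det_2)
  moreover have fin: "finite ((UNIV \<times> UNIV - {(0 :: 'a, 0 :: 'a)}) \<times> (UNIV :: 'a set))"
    using assms by (intro finite_cartesian_product finite_Diff) (simp_all add: finite_prod)
  ultimately have "card {A :: 'a ^ 2 ^ 2. det A = 1} \<le> card ((UNIV \<times> UNIV - {(0 :: 'a, 0 :: 'a)}) \<times> (UNIV :: 'a set))"
    by (rule card_inj_on_le)
  also have "\<dots> = (CARD('a)\<^sup>2 - 1) * CARD('a)"
    using assms by (simp add: card_cartesian_product card_Diff_singleton power2_eq_square finite_cartesian_product)
  finally show ?thesis by (simp add: mult.commute)
qed

locale SL2_subgroup =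
  fixes H :: "('a::field ^ 2 ^ 2) set"
  assumes finite_field: "finite (UNIV :: 'a set)"
    and det: "A \<in> H \<Longrightarrow> det A = 1"
    and one: "mat 1 \<in> H"
    and mult: "A \<in> H \<Longrightarrow> B \<in> H \<Longrightarrow> A ** B \<in> H"
    and adj: "A \<in> H \<Longrightarrow> adj A \<in> H"
    and uminus: "A \<in> H \<Longrightarrow> - A \<in> H"
begin

lemma finite_matrices: "finite (S :: ('a ^ 2 ^ 2) set)"
proof -
  have "finite (UNIV :: ('a \<times> 'a \<times> 'a \<times> 'a) set)" using finite_field by (simp add: finite_prod)
  moreover have "(UNIV :: ('a ^ 2 ^ 2) set) \<subseteq> (\<lambda>(a, b, c, d). mat2 a b c d) ` UNIV"
    by (metis (no_types, lifting) case_prod_conv mat2_eta rangeI subsetI)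
  ultimately show ?thesis by (metis finite_imageI finite_subset subset_UNIV)
qed

sublocale closure: finite_SL2_subgroup "to_ac_mat ` H"
proof
  show "finite (to_ac_mat ` H)" using finite_matrices by simp
  show "mat 1 \<in> to_ac_mat ` H" using one to_ac_mat_one by (metis image_eqI)
  fix A assume "A \<in> to_ac_mat ` H"
  then obtain A' where A: "A' \<in> H" "A = to_ac_mat A'" by blast
  show "det A = 1" using A det by (simp add: to_ac_mat_det)
  show "adj A \<in> to_ac_mat ` H" "- A \<in> to_ac_mat ` H" using A adj uminus by (auto simp flip: to_ac_mat_adj to_ac_mat_uminus)
  fix B assume "B \<in> to_ac_mat ` H"
  then show "A ** B \<in> to_ac_mat ` H" using A mult by (auto simp flip: to_ac_mat_mult)
qed

text \<open>By the assumption on the trace, the field of \<open>trace_in_small_field\<close> has at least as many elements as the base field,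
and then \<open>H\<close> has at least as many elements as \<open>SL\<^sub>2\<close>.\<close>

theorem eq_SL2:
  assumes p: "p = CHAR('a)" "prime p"
    and no_fix: "\<And>P. P \<in> points \<Longrightarrow> card (closure.orb P) \<noteq> 1"
    and no_pair: "\<And>P. P \<in> points \<Longrightarrow> card (closure.orb P) \<noteq> 2"
    and two: "p = 2 \<Longrightarrow> \<exists>P \<in> points. card (closure.pars P) \<ge> 2"
    and A: "A \<in> H"
    and deg: "\<And>m. m \<ge> 1 \<Longrightarrow> ((trace A)\<^sup>2 - 2) ^ (p ^ m) = (trace A)\<^sup>2 - 2 \<Longrightarrow> m \<ge> 3 \<and> p ^ m \<ge> CARD('a)"
  shows "H = {A. det A = 1}"
proof -
  have p': "p = CHAR('a alg_closure)" using p by simp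
  have "to_ac_mat A \<in> to_ac_mat ` H" using A by blast
  from closure.trace_in_small_field[OF p' p(2) no_fix no_pair two this]
  obtain m where m: "m \<ge> 1" "((trace (to_ac_mat A))\<^sup>2 - 2) ^ (p ^ m) = (trace (to_ac_mat A))\<^sup>2 - 2"
    "m \<le> 2 \<or> card (to_ac_mat ` H) \<ge> p ^ m * (p ^ (2 * m) - 1)" by blast
  have "to_ac (((trace A)\<^sup>2 - 2) ^ (p ^ m)) = to_ac ((trace A)\<^sup>2 - 2)"
    using m(2) by (simp add: to_ac_mat_trace)
  then have "((trace A)\<^sup>2 - 2) ^ (p ^ m) = (trace A)\<^sup>2 - 2" by (simp only: to_ac_eq_iff)
  with deg[OF m(1)] have mm: "m \<ge> 3" "p ^ m \<ge> CARD('a)" by blast+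
  have "CARD('a) * (CARD('a)\<^sup>2 - 1) \<le> p ^ m * ((p ^ m)\<^sup>2 - 1)"
    using mm(2) by (intro mult_mono diff_le_mono power_mono) auto
  also have "\<dots> \<le> card (to_ac_mat ` H)" using m(3) mm(1) by (simp add: power_mult[symmetric] mult.commute)
  also have "\<dots> = card H" by (rule card_image[OF inj_on_subset[OF inj_to_ac_mat subset_UNIV]])
  finally have "card {A :: 'a ^ 2 ^ 2. det A = 1} \<le> card H" using card_SL2_le[OF finite_field] by simp
  then show ?thesis using det finite_matrices by (intro card_seteq) auto
qed

end

section \<open>Automorphisms change traces by field automorphisms\<close>

definition mpow :: "'a::semiring_1 ^ 2 ^ 2 \<Rightarrow> nat \<Rightarrow> 'a ^ 2 ^ 2" where
  "mpow A n = ((**) A ^^ n) (mat 1)"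

lemma mpow_simps [simp]: "mpow A 0 = mat 1" "mpow A (Suc n) = A ** mpow A n"
  by (simp_all add: mpow_def)

abbreviation upper :: "'a::{zero,one} \<Rightarrow> 'a ^ 2 ^ 2" where "upper x \<equiv> mat2 1 x 0 1"
abbreviation lower :: "'a::{zero,one} \<Rightarrow> 'a ^ 2 ^ 2" where "lower x \<equiv> mat2 1 0 x 1"

lemma mpow_upper: "mpow (upper x) n = upper (of_nat n * x)" "mpow (lower x) n = lower (of_nat n * x)"
  by (induction n) (simp_all add: mat2_one algebra_simps)

text \<open>A matrix with a nonzero entry \<open>c\<close> in the lower left corner is a product \<open>upper x ** lower c ** upper y\<close>.\<close>

lemma SL2_generated [consumes 1, case_names upper lower mult]:
  fixes A :: "'a::field ^ 2 ^ 2"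
  assumes "det A = 1" and u: "\<And>x. Q (upper x)" and l: "\<And>x. Q (lower x)"
    and m: "\<And>A B. Q A \<Longrightarrow> Q B \<Longrightarrow> Q (A ** B)"
  shows "Q A"
proof -
  have nz: "Q B" if B: "det B = 1" "B $ 2 $ 1 \<noteq> 0" for B :: "'a ^ 2 ^ 2"
  proof -
    obtain a b c d where E: "B = mat2 a b c d" by (rule mat2_cases)
    with B have *: "a * d - b * c = 1" "c \<noteq> 0" by auto
    then have "b = (a * d - 1) / c" by (simp add: field_simps)
    moreover have "a * ((d - 1) / c) + (a - 1) / c = (a * d - 1) / c" using *(2) by (simp add: field_simps)
    ultimately have "B = upper ((a - 1) / c) ** lower c ** upper ((d - 1) / c)"
      using *(2) by (simp add: E)
    then show ?thesis using m u l by metis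
  qed
  show ?thesis
  proof (cases "A $ 2 $ 1 = 0")
    case True
    then obtain k b where A: "k \<noteq> 0" "A = mat2 k b 0 (1 / k)" using triangular_cases assms(1) by metis
    have "Q (lower 1 ** A)" by (rule nz) (use A in \<open>simp_all add: distrib_left mult.commute\<close>)
    moreover have "A = lower (-1) ** (lower 1 ** A)" using A by simp
    ultimately show ?thesis using m l by metis
  next
    case False
    then show ?thesis using nz assms(1) by blast
  qed
qed

text \<open>An automorphism of the projective group, seen as a relation between matrices that is a function up to sign. The relation
spares the choice of representatives, and replacing the automorphism by its composition with a conjugation becomes a
substitution.\<close>

locale SL2_correspondence =
  fixes R :: "'a::field ^ 2 ^ 2 \<Rightarrow> 'a ^ 2 ^ 2 \<Rightarrow> bool"
  assumes finite_field: "finite (UNIV :: 'a set)"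
    and det: "R A B \<Longrightarrow> det A = 1 \<and> det B = 1"
    and total: "det A = 1 \<Longrightarrow> \<exists>B. R A B"
    and mult: "R A B \<Longrightarrow> R A' B' \<Longrightarrow> R (A ** A') (B ** B')"
    and unique: "R A B \<Longrightarrow> R A B' \<longleftrightarrow> B' = B \<or> B' = - B"
    and inj: "R A B \<Longrightarrow> R A' B \<Longrightarrow> A' = A \<or> A' = - A"
begin

lemma conj: "det S = 1 \<Longrightarrow> SL2_correspondence (\<lambda>A B. R A (S ** B ** adj S))"
proof
  assume S: "det S = 1"
  have aa: "adj (adj S) = S" by (cases S rule: mat2_cases) simp
  have un: "B = adj S ** (S ** B ** adj S) ** S" for B
    using S by (simp add: matrix_mul_assoc[symmetric] adj_cancel adj_mult)
  fix A B A' B'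
  show "det A = 1 \<and> det B = 1" if "R A (S ** B ** adj S)"
    using det[OF that] S by (simp add: det_mul)
  show "\<exists>B. R A (S ** B ** adj S)" if dA: "det A = 1"
  proof -
    obtain B where "R A B" using total[OF dA] by blast
    moreover have "B = S ** (adj S ** B ** S) ** adj S"
      using S by (simp add: matrix_mul_assoc[symmetric] adj_cancel adj_mult)
    ultimately show ?thesis by metis
  qed
  show "R (A ** A') (S ** (B ** B') ** adj S)" if "R A (S ** B ** adj S)" "R A' (S ** B' ** adj S)"
  proof -
    have "(S ** B ** adj S) ** (S ** B' ** adj S) = S ** (B ** B') ** adj S"
      using S by (simp add: matrix_mul_assoc[symmetric] adj_cancel)
    then show ?thesis using mult[OF that] by simp
  qed
  show "R A (S ** B' ** adj S) = (B' = B \<or> B' = - B)" if "R A (S ** B ** adj S)"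
  proof -
    have "S ** (- B) ** adj S = - (S ** B ** adj S)"
      by (cases S rule: mat2_cases, cases B rule: mat2_cases) (simp add: algebra_simps)
    then show ?thesis using unique[OF that] un by metis
  qed
  show "A' = A \<or> A' = - A" if "R A (S ** B ** adj S)" "R A' (S ** B ** adj S)"
    using inj[OF that] .
qed (rule finite_field)

lemma one: "R (mat 1) (mat 1)"
proof -
  obtain B where B: "R (mat 1) B" using total[of "mat 1"] by auto
  have "B ** B = B \<or> B ** B = - B" using mult[OF B B] unique[OF B] by simp
  then have "adj B ** (B ** B) = adj B ** B \<or> adj B ** (B ** B) = adj B ** - B" by metis
  moreover have "adj B ** - B = - (adj B ** B)"
    by (cases B rule: mat2_cases) simp
  ultimately have "B = mat 1 \<or> B = - mat 1" using det[OF B] by (simp add: adj_cancel adj_mult)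
  then show ?thesis using unique[OF B, of "mat 1"] by auto
qed

lemma mpow: "R A B \<Longrightarrow> R (mpow A n) (mpow B n)"
  by (induction n) (simp_all add: one mult)

text \<open>Elements of order \<open>p\<close> correspond to elements of order \<open>p\<close>. The eigenvalues \<open>k\<close> of such a matrix satisfy
\<open>(k - l) ^ p = k ^ p - l ^ p = 0\<close> for \<open>l = 1\<close> or \<open>l = -1\<close>, so they are rational and equal.\<close>

lemma fixed_point_of_image:
  assumes "mpow A CHAR('a) = mat 1" "R A B"
  obtains P l where "P \<in> fixed_points B" "(trace B)\<^sup>2 = 4"
proof -
  have p: "prime CHAR('a)" using finite_field by (simp add: prime_CHAR_semidom finite_imp_CHAR_pos)
  have "R (mat 1) (mpow B CHAR('a))" using mpow[OF assms(2), of "CHAR('a)"] assms(1) by simp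
  then have B: "mpow B CHAR('a) = mat 1 \<or> mpow B CHAR('a) = - mat 1" using unique[OF one] by blast
  have dB: "det B = 1" using det assms(2) by blast
  have dC: "det (to_ac_mat B) = 1" using dB by (simp add: to_ac_mat_det)
  obtain Q where "Q \<in> fixed_points (to_ac_mat B)" using fixed_point_exists[OF dC] by blast
  then have "Q \<in> points" "act (to_ac_mat B) Q = Q" by (simp_all add: fixed_points_def)
  moreover from this obtain v where "v \<noteq> 0" "Q = line v" by (auto simp: points_def)
  ultimately have v: "v \<noteq> 0" "act (to_ac_mat B) (line v) = line v" by simp_all
  obtain k where k: "k \<noteq> 0" "to_ac_mat B *v v = k *s v" using eigenvector_of_fixed_point v by metis
  have pow: "to_ac_mat (mpow B n) *v v = k ^ n *s v" for n
    by (induction n) (simp_all add: to_ac_mat_one to_ac_mat_mult k matrix_vector_mul_assoc[symmetric] vector_scalar_commute mult.commute)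
  have cancel: "a = b" if "a *s v = b *s v" for a b
    using that v(1) by (cases v rule: vec2_cases) (auto simp: vec2_zero)
  obtain l :: 'a where l: "l = 1 \<or> l = -1" "k ^ CHAR('a) = to_ac l"
  proof -
    from B show ?thesis
    proof
      assume "mpow B CHAR('a) = mat 1"
      then have "k ^ CHAR('a) *s v = 1 *s v" using pow[of "CHAR('a)"] by (simp add: to_ac_mat_one)
      then show ?thesis using that[of 1] cancel by auto
    next
      assume "mpow B CHAR('a) = - mat 1"
      then have "k ^ CHAR('a) *s v = - v" using pow[of "CHAR('a)"] by (simp add: to_ac_mat_one to_ac_mat_uminus uminus_vmult)
      also have "\<dots> = (-1) *s v" by (simp add: vec_eq_iff)
      finally show ?thesis using that[of "-1"] cancel by auto
    qed
  qed
  have p': "CHAR('a) = CHAR('a alg_closure)" by simp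
  have "l ^ CHAR('a) = l" using l(1) frob_minus[OF refl p, of 1 1] by auto
  then have "(k - to_ac l) ^ (CHAR('a) ^ 1) = 0"
    unfolding frob_diff[OF p' p] using l(2) by (simp flip: to_ac_power)
  then have "k = to_ac l" by simp
  then have "to_ac (l\<^sup>2 - trace B * l + 1) = 0" using eigenvalue_equation[OF dC v(1) k(2)] by (simp add: to_ac_mat_trace)
  then have "l\<^sup>2 - trace B * l + 1 = 0" using to_ac_eq_0_iff by blast
  then have eq: "1 - trace B * l + l\<^sup>2 = 0" by (simp add: algebra_simps)
  have "l\<^sup>2 = 1" using l(1) by auto
  with eq have "trace B * l = 2" by (simp add: algebra_simps)
  then have "(trace B)\<^sup>2 * l\<^sup>2 = 2\<^sup>2" by (metis power_mult_distrib)
  then have "(trace B)\<^sup>2 = 4" using \<open>l\<^sup>2 = 1\<close> by simp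
  moreover obtain P where "P \<in> fixed_points B" using eigenvalue_imp_fixed_point[OF dB eq] by blast
  ultimately show ?thesis using that by blast
qed

lemma neg_cases: "x = - x \<Longrightarrow> x = 0 \<or> (1::'a) = -1" for x :: 'a
proof -
  assume "x = - x"
  then have "(1 - -1) * x = 0" by (simp add: algebra_simps)
  then have "x = 0 \<or> (1::'a) - -1 = 0" using mult_eq_0_iff by blast
  then show ?thesis by (metis right_minus_eq)
qed

text \<open>The centralizer of a nontrivial translation, modulo signs, consists of translations.\<close>

lemma upper_commuting:
  fixes a b c d y :: 'a
  assumes "y \<noteq> 0" "a * d - b * c = 1"
    and "mat2 a b c d ** upper y = upper y ** mat2 a b c d \<or> mat2 a b c d ** upper y = - (upper y ** mat2 a b c d)"
  shows "mat2 a b c d = upper (a * b) \<or> mat2 a b c d = - upper (a * b)"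
proof -
  have "c = 0 \<and> a = d"
    using assms(3)
  proof
    assume "mat2 a b c d ** upper y = upper y ** mat2 a b c d"
    then have "y * c = 0" "a * y + b = b + y * d" by auto
    then show ?thesis using assms(1) by (simp add: mult.commute)
  next
    assume *: "mat2 a b c d ** upper y = - (upper y ** mat2 a b c d)"
    then have e: "a = - (a + y * c)" "a * y + b = - (b + y * d)" "c = - c" by auto
    show ?thesis
    proof (cases "(1::'a) = -1")
      case True
      then have m: "- x = x" for x :: 'a by (metis mult_1 mult_minus_left)
      from e(1,2) have "a = a + y * c" "a * y + b = b + y * d" by (simp_all only: m)
      then show ?thesis using assms(1) by (simp add: mult.commute)
    next
      case False
      then have "c = 0" using neg_cases[OF e(3)] by simp
      then have "a = 0" using e(1) neg_cases[of a] False by simp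
      then show ?thesis using \<open>c = 0\<close> assms(2) by simp
    qed
  qed
  moreover from this have "a * a = 1" using assms(2) by simp
  then have "a = 1 \<or> a = -1" by (metis power2_eq_1_iff power2_eq_square)
  ultimately show ?thesis by auto
qed

lemma lower_commuting:
  fixes a b c d y :: 'a
  assumes "y \<noteq> 0" "a * d - b * c = 1"
    and "mat2 a b c d ** lower y = lower y ** mat2 a b c d \<or> mat2 a b c d ** lower y = - (lower y ** mat2 a b c d)"
  shows "mat2 a b c d = lower (a * c) \<or> mat2 a b c d = - lower (a * c)"
proof -
  have "mat2 a c b d ** upper y = upper y ** mat2 a c b d \<or> mat2 a c b d ** upper y = - (upper y ** mat2 a c b d)"
    using assms(3) by (auto simp: algebra_simps)
  then have "mat2 a c b d = upper (a * c) \<or> mat2 a c b d = - upper (a * c)"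
    using upper_commuting[of y a d c b] assms(1,2) by (simp add: mult.commute)
  then show ?thesis by auto
qed

lemma sign_eq: "- upper x = upper y \<Longrightarrow> x = (y::'a)" "- lower x = lower y \<Longrightarrow> x = (y::'a)"
proof -
  have neg: "- z = z" if "(-1::'a) = 1" for z :: 'a using that by (metis mult_1 mult_minus_left)
  show "x = y" if "- upper x = upper y" using that neg[of x] by simp
  show "x = y" if "- lower x = lower y" using that neg[of x] by simp
qed

text \<open>The image of one translation is parabolic, so a conjugation turns it into a translation. The images of the other
translations commute with it modulo signs and are translations as well.\<close>

lemma normalize_upper:
  obtains S where "det S = 1" "\<And>x. \<exists>y. R (upper x) (S ** upper y ** adj S)"
proof -
  have pw: "mpow (upper 1) CHAR('a) = (mat 1 :: 'a ^ 2 ^ 2)" by (simp add: mpow_upper mat2_one)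
  obtain B where B: "R (upper 1) B" using total[of "upper 1"] by auto
  obtain P where P: "P \<in> fixed_points B" "(trace B)\<^sup>2 = 4" using fixed_point_of_image[OF pw B] by metis
  have dB: "det B = 1" using det B by blast
  obtain S l b where S: "det S = 1" "l \<noteq> 0" "B = S ** mat2 l b 0 (1 / l) ** adj S"
    using triangularize[OF dB P(1)] by metis
  have l1: "l = 1 \<or> l = -1" using P(2) S trace_triangular[OF S(2)] by (simp add: trace_conj power2_eq_1_iff)
  interpret C: SL2_correspondence "\<lambda>A B. R A (S ** B ** adj S)" by (rule conj[OF S(1)])
  have R1: "R (upper 1) (S ** upper (l * b) ** adj S)"
  proof -
    have "mat2 l b 0 (1 / l) = upper (l * b) \<or> mat2 l b 0 (1 / l) = - upper (l * b)" using l1 by auto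
    then show ?thesis using B S(3) C.unique[of "upper 1" "mat2 l b 0 (1 / l)"] by auto
  qed
  have b: "l * b \<noteq> 0"
  proof
    assume "l * b = 0"
    then have "upper (l * b) = mat 1" by (simp only: mat2_one)
    then have "R (upper 1) (S ** mat 1 ** adj S)" using R1 by metis
    then have "upper 1 = (mat 1 :: 'a ^ 2 ^ 2) \<or> upper 1 = - (mat 1 :: 'a ^ 2 ^ 2)" by (rule C.inj[OF C.one])
    then show False by (simp add: mat2_one)
  qed
  have "\<exists>y. R (upper x) (S ** upper y ** adj S)" for x
  proof -
    obtain D where D: "R (upper x) (S ** D ** adj S)" using C.total[of "upper x"] by auto
    obtain a' b' c' d' where D': "D = mat2 a' b' c' d'" by (rule mat2_cases)
    have "R (upper x ** upper 1) (S ** (D ** upper (l * b)) ** adj S)"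
      "R (upper 1 ** upper x) (S ** (upper (l * b) ** D) ** adj S)"
      using C.mult[OF D R1] C.mult[OF R1 D] .
    moreover have "upper x ** upper 1 = upper 1 ** upper x" by (simp add: add.commute)
    ultimately have "D ** upper (l * b) = upper (l * b) ** D \<or> D ** upper (l * b) = - (upper (l * b) ** D)"
      using C.unique by metis
    moreover have "a' * d' - b' * c' = 1" using C.det[OF D] by (simp add: D')
    ultimately have "D = upper (a' * b') \<or> D = - upper (a' * b')"
      using upper_commuting[OF b] unfolding D' by blast
    then have "R (upper x) (S ** upper (a' * b') ** adj S)" using D C.unique[OF D, of "upper (a' * b')"] by auto
    then show ?thesis by blast
  qed
  with S(1) show ?thesis by (rule that)
qed

lemma upper_function:
  assumes "\<And>x. \<exists>y. R (upper x) (upper y)"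
  obtains f where "\<And>x. R (upper x) (upper (f x))" "\<And>x y. f (x + y) = f x + f y" "bij f"
proof -
  define f where "f x = (SOME y. R (upper x) (upper y))" for x
  have f: "R (upper x) (upper (f x))" for x unfolding f_def by (rule someI_ex[OF assms])
  have un: "y = y'" if "R (upper x) (upper y)" "R (upper x) (upper y')" for x y y'
    using unique[OF that(1), of "upper y'"] that(2) sign_eq(1)[of y y'] by (metis mat2_eq_iff)
  have "R (upper (x + y)) (upper (f x + f y))" for x y
    using mult[OF f[of x] f[of y]] by (simp add: add.commute)
  then have add: "f (x + y) = f x + f y" for x y using un f by metis
  have "inj f"
  proof (rule injI)
    fix x y assume "f x = f y"
    then have "upper x = upper y \<or> upper x = - upper y" using inj f by metis
    then show "x = y" using sign_eq(1)[of y x] by (metis mat2_eq_iff)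
  qed
  then have "bij f" using finite_field by (simp add: bij_def finite_UNIV_inj_surj)
  with f add show ?thesis by (rule that)
qed

text \<open>The image of a lower triangular translation has its fixed point away from infinity, since all upper triangular
translations are images of such. Conjugation by an upper triangular translation moves this fixed point to zero.\<close>

lemma normalize_lower:
  assumes up: "\<And>x. \<exists>y. R (upper x) (upper y)"
  obtains S where "det S = 1" "\<And>x. \<exists>y. R (upper x) (S ** upper y ** adj S)"
    "\<And>x. \<exists>y. R (lower x) (S ** lower y ** adj S)"
proof -
  obtain f where f: "\<And>x. R (upper x) (upper (f x))" "bij f" using upper_function[OF up] by metis
  have pw: "mpow (lower 1) CHAR('a) = (mat 1 :: 'a ^ 2 ^ 2)" by (simp add: mpow_upper mat2_one)
  obtain B where B: "R (lower 1) B" using total[of "lower 1"] by auto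
  obtain P where P: "P \<in> fixed_points B" "(trace B)\<^sup>2 = 4" using fixed_point_of_image[OF pw B] by metis
  have dB: "det B = 1" using det B by blast
  have nu: "B \<noteq> upper y \<and> B \<noteq> - upper y" for y
  proof -
    obtain x where x: "f x = y" using f(2) by (metis bij_pointE)
    have "B = upper y \<or> B = - upper y \<Longrightarrow> R (upper x) B" using unique[OF f(1)[of x], of B] x by blast
    moreover have "\<not> R (upper x) B" using inj[OF B, of "upper x"] by auto
    ultimately show ?thesis by blast
  qed
  have "P \<noteq> line (vec2 1 0)"
  proof
    assume "P = line (vec2 1 0)"
    then have "B $ 2 $ 1 = 0" using P(1) fixes_infinity_iff[OF dB] by (simp add: fixed_points_def del: act_line)
    then obtain l b where l: "l \<noteq> 0" "B = mat2 l b 0 (1 / l)" using triangular_cases[OF dB] by metis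
    then have "l = 1 \<or> l = -1" using P(2) trace_triangular[OF l(1)] by (simp add: power2_eq_1_iff)
    then show False using nu[of "l * b"] l by auto
  qed
  moreover have "P \<in> points" using P(1) by (simp add: fixed_points_def)
  ultimately obtain s where s: "P = line (vec2 s 1)" using points_cases by metis
  define S where "S = upper s"
  have dS: "det S = 1" by (simp add: S_def)
  interpret C: SL2_correspondence "\<lambda>A B. R A (S ** B ** adj S)" by (rule conj[OF dS])
  have upS: "R (upper x) (S ** upper (f x) ** adj S)" for x using f(1)[of x] by (simp add: S_def)
  define B' where "B' = adj S ** B ** S"
  have BB': "B = S ** B' ** adj S" using dS by (simp add: B'_def matrix_mul_assoc[symmetric] adj_cancel adj_mult)
  have RB': "R (lower 1) (S ** B' ** adj S)" using B BB' by simp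
  have "act B' (line (vec2 0 1)) = line (vec2 0 1)"
  proof -
    have "act S (line (vec2 0 1)) = P" by (simp add: S_def s)
    then show ?thesis using P(1) dS unfolding B'_def act_mult fixed_points_def by (metis (mono_tags, lifting) act_adj_cancel(1) mem_Collect_eq)
  qed
  obtain a b c d where E: "B' = mat2 a b c d" by (rule mat2_cases)
  have dB': "a * d - b * c = 1" using C.det[OF RB'] by (simp add: E)
  have b0: "b = 0"
    using \<open>act B' (line (vec2 0 1)) = line (vec2 0 1)\<close> line_eq_iff[of "vec2 b d" "vec2 0 1"] dB'
    by (auto simp: E vec2_zero)
  have "trace B = trace B'" using trace_conj[OF dS] by (simp add: BB')
  then have tr: "(a + d)\<^sup>2 = 4" using P(2) by (simp add: E)
  have "a \<noteq> 0" using dB' b0 by auto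
  then have a0: "a \<noteq> 0" "d = 1 / a" using dB' b0 by (simp_all add: field_simps)
  then have a1: "a = 1 \<or> a = -1" using tr trace_triangular[of a] by (simp add: power2_eq_1_iff)
  have R1: "R (lower 1) (S ** lower (a * c) ** adj S)"
  proof -
    have "B' = lower (a * c) \<or> B' = - lower (a * c)" using a1 a0 by (auto simp: E b0)
    then show ?thesis using RB' C.unique[OF RB', of "lower (a * c)"] by auto
  qed
  have c: "a * c \<noteq> 0"
  proof
    assume "a * c = 0"
    then have "lower (a * c) = mat 1" by (simp only: mat2_one)
    then have "R (lower 1) (S ** mat 1 ** adj S)" using R1 by metis
    then have "lower 1 = (mat 1 :: 'a ^ 2 ^ 2) \<or> lower 1 = - (mat 1 :: 'a ^ 2 ^ 2)" by (rule C.inj[OF C.one])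
    then show False by (simp add: mat2_one)
  qed
  have "\<exists>y. R (lower x) (S ** lower y ** adj S)" for x
  proof -
    obtain D where D: "R (lower x) (S ** D ** adj S)" using C.total[of "lower x"] by auto
    obtain a' b' c' d' where D': "D = mat2 a' b' c' d'" by (rule mat2_cases)
    have "R (lower x ** lower 1) (S ** (D ** lower (a * c)) ** adj S)"
      "R (lower 1 ** lower x) (S ** (lower (a * c) ** D) ** adj S)"
      using C.mult[OF D R1] C.mult[OF R1 D] .
    moreover have "lower x ** lower 1 = lower 1 ** lower x" by (simp add: add.commute)
    ultimately have "D ** lower (a * c) = lower (a * c) ** D \<or> D ** lower (a * c) = - (lower (a * c) ** D)"
      using C.unique by metis
    moreover have "a' * d' - b' * c' = 1" using C.det[OF D] by (simp add: D')
    ultimately have "D = lower (a' * c') \<or> D = - lower (a' * c')"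
      using lower_commuting[OF c] unfolding D' by blast
    then have "R (lower x) (S ** lower (a' * c') ** adj S)" using D C.unique[OF D, of "lower (a' * c')"] by auto
    then show ?thesis by blast
  qed
  with dS upS show ?thesis using that by blast
qed

text \<open>The product \<open>upper x ** lower y ** upper x\<close> exchanges zero and infinity exactly for \<open>y = - 1 / x\<close>. This property can be
expressed by the translations that it conjugates into each other, and is therefore preserved.\<close>

lemma weyl_correspondence:
  assumes f: "\<And>x. R (upper x) (upper (f x))" and g: "\<And>x. R (lower x) (lower (g x))"
    and "f 1 \<noteq> 0" and x: "x \<noteq> 0"
  shows "f x * g (- 1 / x) = - 1" "R (mat2 0 x (- 1 / x) 0) (mat2 0 (f x) (- 1 / f x) 0)"
proof -
  define F where "F = f x"
  define H where "H = g (- 1 / x)"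
  define w where "w = mat2 0 x (- 1 / x) 0"
  (* the product of the images of the factors of \<open>w\<close> *)
  define W where "W = mat2 (1 + F * H) (F * (2 + F * H)) H (1 + F * H)"
  have "w = upper x ** lower (- 1 / x) ** upper x" using x by (simp add: w_def)
  moreover have "W = upper F ** lower H ** upper F" by (simp add: W_def algebra_simps)
  ultimately have wW: "R w W" using mult[OF mult[OF f[of x] g[of "- 1 / x"]] f[of x]] by (simp only: F_def H_def)
  (* this relation between \<open>w\<close> and the translations forces its image \<open>W\<close> to exchange zero and infinity *)
  have "w ** upper 1 = lower (- 1 / x\<^sup>2) ** w" using x by (simp add: w_def power2_eq_square)
  moreover have "R (w ** upper 1) (W ** upper (f 1))" "R (lower (- 1 / x\<^sup>2) ** w) (lower (g (- 1 / x\<^sup>2)) ** W)"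
    using mult[OF wW f] mult[OF g wW] .
  ultimately have "W ** upper (f 1) = lower (g (- 1 / x\<^sup>2)) ** W \<or> W ** upper (f 1) = - (lower (g (- 1 / x\<^sup>2)) ** W)"
    using unique[of "lower (- 1 / x\<^sup>2) ** w" "lower (g (- 1 / x\<^sup>2)) ** W" "W ** upper (f 1)"] by simp
  then have "1 + F * H = 0"
  proof
    assume "W ** upper (f 1) = lower (g (- 1 / x\<^sup>2)) ** W"
    then have "(1 + F * H) * f 1 + F * (2 + F * H) = F * (2 + F * H)" by (simp add: W_def)
    then have "(1 + F * H) * f 1 = 0" by (metis add_cancel_left_left)
    then show ?thesis using assms(3) by simp
  next
    assume "W ** upper (f 1) = - (lower (g (- 1 / x\<^sup>2)) ** W)"
    then have e: "1 + F * H = - (1 + F * H)" "(1 + F * H) * f 1 + F * (2 + F * H) = - (F * (2 + F * H))"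
      by (simp_all add: W_def)
    show ?thesis
    proof (cases "(1::'a) = -1")
      case True
      then have "- y = y" for y :: 'a by (metis mult_1 mult_minus_left)
      with e(2) have "(1 + F * H) * f 1 + F * (2 + F * H) = F * (2 + F * H)" by simp
      then have "(1 + F * H) * f 1 = 0" by (metis add_cancel_left_left)
      then show ?thesis using assms(3) by simp
    next
      case False
      then show ?thesis using neg_cases[OF e(1)] by blast
    qed
  qed
  then have FH: "F * H = - 1" by (metis add.commute eq_neg_iff_add_eq_0)
  then show "f x * g (- 1 / x) = - 1" by (simp add: F_def H_def)
  have "F \<noteq> 0" using FH by auto
  then have "H = - 1 / F" using FH by (simp add: field_simps)
  then have "W = mat2 0 F (- 1 / F) 0" unfolding W_def FH using \<open>F \<noteq> 0\<close> by simp
  then show "R (mat2 0 x (- 1 / x) 0) (mat2 0 (f x) (- 1 / f x) 0)" using wW by (simp add: w_def F_def)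
qed

text \<open>Products of two exchanging elements are the diagonal matrices with entries \<open>x\<close> and \<open>1 / x\<close>; these multiply translations
by \<open>x\<^sup>2\<close>. This gives \<open>\<phi> (x\<^sup>2 * y) = (\<phi> x)\<^sup>2 * \<phi> y\<close> for the normalized action \<open>\<phi>\<close> on translations. The step to all
products uses polarization, or the surjectivity of squaring in characteristic two.\<close>

lemma field_hom_of_normalized:
  assumes up: "\<And>x. \<exists>y. R (upper x) (upper y)" and low: "\<And>x. \<exists>y. R (lower x) (lower y)"
  obtains \<phi> where "\<And>x y. \<phi> (x + y) = \<phi> x + \<phi> y" "\<And>x y. \<phi> (x * y) = \<phi> x * \<phi> y" "\<phi> 1 = 1"
    "\<And>A B. R A B \<Longrightarrow> (trace B)\<^sup>2 = \<phi> ((trace A)\<^sup>2)"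
proof -
  obtain f where f: "\<And>x. R (upper x) (upper (f x))" "\<And>x y. f (x + y) = f x + f y" "bij f"
    using upper_function[OF up] by metis
  obtain g where g: "\<And>x. R (lower x) (lower (g x))" using low by metis
  have "f 0 + f 0 = f 0 + 0" using f(2)[of 0 0] by (simp only: add_0_right)
  then have f0: "f 0 = 0" by (rule add_left_imp_eq)
  have fneg: "f (- x) = - f x" for x using f(2)[of x "- x"] f0 by (simp add: eq_neg_iff_add_eq_0 add.commute)
  have fnz: "f x \<noteq> 0" if "x \<noteq> 0" for x using that f(3) f0 by (metis bij_pointE)
  define c where "c = f 1"
  have c: "c \<noteq> 0" using fnz[of 1] by (simp add: c_def)
  define \<phi> where "\<phi> x = f x / c" for x
  have f_phi: "f x = c * \<phi> x" for x using c by (simp add: \<phi>_def)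
  have add: "\<phi> (x + y) = \<phi> x + \<phi> y" for x y by (simp add: \<phi>_def f(2) add_divide_distrib)
  have one: "\<phi> 1 = 1" using c by (simp add: \<phi>_def c_def)
  have zero: "\<phi> 0 = 0" by (simp add: \<phi>_def f0)
  have nz: "\<phi> x \<noteq> 0" if "x \<noteq> 0" for x using fnz[OF that] c by (simp add: \<phi>_def)
  note weyl = weyl_correspondence[OF f(1) g fnz[OF one_neq_zero]]
  have sq: "\<phi> (x\<^sup>2 * y) = (\<phi> x)\<^sup>2 * \<phi> y" for x y
  proof (cases "x = 0")
    case True
    then show ?thesis by (simp add: zero)
  next
    case False
    define k where "k = \<phi> x"
    have k: "k \<noteq> 0" "f x = c * k" using nz[OF False] by (simp_all add: k_def f_phi)
    have "mat2 0 x (- 1 / x) 0 ** mat2 0 (-1) (- 1 / -1) 0 = mat2 x 0 0 (1 / x)" using False by simp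
    moreover have "mat2 0 (f x) (- 1 / f x) 0 ** mat2 0 (f (-1)) (- 1 / f (-1)) 0 = mat2 k 0 0 (1 / k)"
      using c k by (simp add: fneg flip: c_def)
    ultimately have d: "R (mat2 x 0 0 (1 / x)) (mat2 k 0 0 (1 / k))"
      using mult[OF weyl(2)[OF False] weyl(2)[of "-1"]] by simp
    have "mat2 x 0 0 (1 / x) ** upper y = upper (x\<^sup>2 * y) ** mat2 x 0 0 (1 / x)"
      using False by (simp add: power2_eq_square)
    moreover have "R (mat2 x 0 0 (1 / x) ** upper y) (mat2 k 0 0 (1 / k) ** upper (f y))"
      "R (upper (x\<^sup>2 * y) ** mat2 x 0 0 (1 / x)) (upper (f (x\<^sup>2 * y)) ** mat2 k 0 0 (1 / k))"
      using mult[OF d f(1)] mult[OF f(1) d] .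
    ultimately have "mat2 k 0 0 (1 / k) ** upper (f y) = upper (f (x\<^sup>2 * y)) ** mat2 k 0 0 (1 / k) \<or>
        mat2 k 0 0 (1 / k) ** upper (f y) = - (upper (f (x\<^sup>2 * y)) ** mat2 k 0 0 (1 / k))"
      using unique[of "upper (x\<^sup>2 * y) ** mat2 x 0 0 (1 / x)" "upper (f (x\<^sup>2 * y)) ** mat2 k 0 0 (1 / k)"
          "mat2 k 0 0 (1 / k) ** upper (f y)"] by metis
    then have "k * f y = f (x\<^sup>2 * y) / k"
    proof
      assume "mat2 k 0 0 (1 / k) ** upper (f y) = - (upper (f (x\<^sup>2 * y)) ** mat2 k 0 0 (1 / k))"
      then have "k = - k" "k * f y = - (f (x\<^sup>2 * y) / k)" by simp_all
      moreover from this have "(1::'a) = -1" using neg_cases k by blast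
      then have "- z = z" for z :: 'a by (metis mult_1 mult_minus_left)
      ultimately show ?thesis by simp
    qed simp
    then have "f (x\<^sup>2 * y) = k\<^sup>2 * f y" using k by (simp add: field_simps power2_eq_square)
    then show ?thesis using c by (simp add: \<phi>_def k_def)
  qed
  have sq1: "\<phi> (x\<^sup>2) = (\<phi> x)\<^sup>2" for x using sq[of x 1] by (simp add: one)
  have mul: "\<phi> (x * y) = \<phi> x * \<phi> y" for x y
  proof (cases "(1::'a) = -1")
    case True
    have "inj (\<lambda>x::'a. x\<^sup>2)"
    proof (rule injI)
      fix u v :: 'a assume "u\<^sup>2 = v\<^sup>2"
      then have "u = v \<or> u = - v" by (simp add: power2_eq_iff)
      then show "u = v" using True by (metis mult_1 mult_minus_left)
    qed
    then have "surj (\<lambda>x::'a. x\<^sup>2)" using finite_field by (simp add: finite_UNIV_inj_surj)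
    then obtain u where "x = u\<^sup>2" by (metis surjD)
    then show ?thesis by (simp add: sq sq1)
  next
    case False
    then have two: "(2::'a) \<noteq> 0" by (metis add_eq_0_iff one_add_one)
    have "(x + y)\<^sup>2 = x\<^sup>2 + (x * y + x * y) + y\<^sup>2" by (simp add: power2_eq_square algebra_simps)
    then have "\<phi> ((x + y)\<^sup>2) = \<phi> (x\<^sup>2 + (x * y + x * y) + y\<^sup>2)" by (rule arg_cong)
    then have "(\<phi> x + \<phi> y)\<^sup>2 = (\<phi> x)\<^sup>2 + (\<phi> (x * y) + \<phi> (x * y)) + (\<phi> y)\<^sup>2"
      unfolding add sq1 .
    then have "2 * (\<phi> x * \<phi> y) = 2 * \<phi> (x * y)" by (simp add: power2_eq_square algebra_simps)
    then show ?thesis using two by simp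
  qed
  have neg: "\<phi> (- x) = - \<phi> x" for x by (simp add: \<phi>_def fneg)
  have inv: "\<phi> (1 / x) = 1 / \<phi> x" if "x \<noteq> 0" for x
    using mul[of x "1 / x"] that nz[OF that] by (simp add: one field_simps)
  have gy: "g y = \<phi> y / c" for y
  proof (cases "y = 0")
    case True
    have "R (mat 1) (lower (g 0))" using g[of 0] by (simp add: mat2_one)
    then have "lower (g 0) = mat 1 \<or> lower (g 0) = - mat 1" using unique[OF SL2_correspondence.one[OF SL2_correspondence_axioms]] by blast
    then show ?thesis using True zero by (auto simp: mat2_one)
  next
    case False
    have "f (- 1 / y) * g (- 1 / (- 1 / y)) = - 1" using weyl(1)[of "- 1 / y"] False by simp
    then have "f (- 1 / y) * g y = - 1" using False by simp
    moreover have "f (- 1 / y) = - (c / \<phi> y)" using inv[OF False] neg[of "1 / y"] by (simp add: f_phi)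
    ultimately have "(c / \<phi> y) * g y = 1" by simp
    then show ?thesis using c nz[OF False] by (simp add: field_simps)
  qed
  (* \<open>\<phi>\<close> in all entries, followed by conjugation with the diagonal matrix of \<open>c\<close> and \<open>1\<close> *)
  define \<Phi> where "\<Phi> A = mat2 (\<phi> (A $ 1 $ 1)) (c * \<phi> (A $ 1 $ 2)) (\<phi> (A $ 2 $ 1) / c) (\<phi> (A $ 2 $ 2))" for A :: "'a ^ 2 ^ 2"
  have Phi: "R A (\<Phi> A)" if "det A = 1" for A
    using that
  proof (induction A rule: SL2_generated)
    case (upper x)
    then show ?case using f(1)[of x] by (simp add: \<Phi>_def one zero f_phi)
  next
    case (lower x)
    then show ?case using g[of x] by (simp add: \<Phi>_def one zero gy)
  next
    case (mult A B)
    have "\<Phi> (A ** B) = \<Phi> A ** \<Phi> B"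
      using c by (cases A rule: mat2_cases, cases B rule: mat2_cases) (simp add: \<Phi>_def add mul algebra_simps add_divide_distrib)
    then show ?case using SL2_correspondence.mult[OF SL2_correspondence_axioms mult] by simp
  qed
  have "(trace B)\<^sup>2 = \<phi> ((trace A)\<^sup>2)" if "R A B" for A B
  proof -
    have "det A = 1" using det[OF that] by blast
    then have "B = \<Phi> A \<or> B = - \<Phi> A" using unique[OF Phi] that by blast
    then have "(trace B)\<^sup>2 = (trace (\<Phi> A))\<^sup>2" by auto
    also have "trace (\<Phi> A) = \<phi> (trace A)" by (cases A rule: mat2_cases) (simp add: \<Phi>_def add)
    finally show ?thesis by (simp add: sq1)
  qed
  with add mul one that show ?thesis by blast
qed

text \<open>After two conjugations, which do not change traces, the correspondence preserves both groups of translations and is then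
given by a field automorphism up to a diagonal matrix.\<close>

theorem trace_field_hom:
  obtains \<phi> where "\<And>x y. \<phi> (x + y) = \<phi> x + \<phi> y" "\<And>x y. \<phi> (x * y) = \<phi> x * \<phi> y" "\<phi> 1 = 1"
    "\<And>A B. R A B \<Longrightarrow> (trace B)\<^sup>2 = \<phi> ((trace A)\<^sup>2)"
proof -
  obtain S where S: "det S = 1" "\<And>x. \<exists>y. R (upper x) (S ** upper y ** adj S)" using normalize_upper by metis
  interpret C: SL2_correspondence "\<lambda>A B. R A (S ** B ** adj S)" by (rule conj[OF S(1)])
  obtain T where T: "det T = 1" "\<And>x. \<exists>y. R (upper x) (S ** (T ** upper y ** adj T) ** adj S)"
    "\<And>x. \<exists>y. R (lower x) (S ** (T ** lower y ** adj T) ** adj S)" using C.normalize_lower[OF S(2)] by metis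
  interpret D: SL2_correspondence "\<lambda>A B. R A (S ** (T ** B ** adj T) ** adj S)" by (rule C.conj[OF T(1)])
  obtain \<phi> where phi: "\<And>x y. \<phi> (x + y) = \<phi> x + \<phi> y" "\<And>x y. \<phi> (x * y) = \<phi> x * \<phi> y" "\<phi> 1 = 1"
    "\<And>A B. R A (S ** (T ** B ** adj T) ** adj S) \<Longrightarrow> (trace B)\<^sup>2 = \<phi> ((trace A)\<^sup>2)"
    using D.field_hom_of_normalized[OF T(2,3)] by blast
  have "(trace B)\<^sup>2 = \<phi> ((trace A)\<^sup>2)" if R: "R A B" for A B
  proof -
    define E where "E = adj T ** (adj S ** B ** S) ** T"
    have "B = S ** (T ** E ** adj T) ** adj S"
      using S(1) T(1) by (simp add: E_def matrix_mul_assoc[symmetric] adj_cancel adj_mult)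
    moreover from this have "trace B = trace E" using S(1) T(1) by (metis trace_conj)
    ultimately show ?thesis using phi(4)[of A E] R by simp
  qed
  with phi(1-3) that show ?thesis by blast
qed

end

section \<open>Elements that generate a cubic extension\<close>

lemma card_roots_le:
  fixes h :: "'a::field poly"
  assumes "Polynomial.degree h < n"
  shows "finite {x. x ^ n + poly h x = 0}" "card {x. x ^ n + poly h x = 0} \<le> n"
proof -
  define f where "f = Polynomial.monom 1 n + h"
  have d: "Polynomial.degree f = n" unfolding f_def using assms
    by (subst degree_add_eq_left) (simp_all add: Polynomial.degree_monom_eq)
  have eq: "{x. x ^ n + poly h x = 0} = {x. poly f x = 0}" by (simp add: f_def poly_monom)
  have "f \<noteq> 0" using d assms by auto
  then show "finite {x. x ^ n + poly h x = 0}" "card {x. x ^ n + poly h x = 0} \<le> n"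
    unfolding eq using poly_roots_finite[of f] card_poly_roots_bound[of f] d by simp_all
qed

lemma power_card_field:
  fixes x :: "'a::field"
  assumes "finite (UNIV :: 'a set)"
  shows "x ^ CARD('a) = x"
proof (cases "x = 0")
  case True
  then show ?thesis using assms by (simp add: card_gt_0_iff power_0_left)
next
  case False
  let ?S = "UNIV - {0 :: 'a}"
  have bij: "bij_betw (\<lambda>y. x * y) ?S ?S"
    by (rule bij_betw_byWitness[where f' = "\<lambda>y. inverse x * y"]) (use False in auto)
  have "(\<Prod>y\<in>?S. y) = (\<Prod>y\<in>?S. x * y)"
    using prod.reindex_bij_betw[OF bij, of "\<lambda>y. y"] by simp
  also have "\<dots> = x ^ card ?S * (\<Prod>y\<in>?S. y)" by (simp add: prod.distrib)
  finally have "x ^ card ?S = 1" using assms by simp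
  moreover have "CARD('a) = Suc (card ?S)" by (rule card.remove[OF assms]) simp
  ultimately show ?thesis by (simp only: power_Suc mult_1_right)
qed

locale cubic_field =
  fixes p e :: nat and K :: "'a::field itself"
  assumes p: "prime p" and e: "e \<ge> 1" and card_field: "CARD('a) = p ^ (3 * e)"
begin

definition q :: nat where "q = p ^ e"

lemma finite_field: "finite (UNIV :: 'a set)"
  using card_field p by (metis card.infinite power_not_zero not_prime_0)

lemma char: "CHAR('a) = p"
proof -
  have "prime CHAR('a)" using finite_field by (simp add: prime_CHAR_semidom finite_imp_CHAR_pos)
  moreover have "CHAR('a) dvd p ^ (3 * e)" using CHAR_dvd_CARD[where ?'a = 'a] card_field by simp
  ultimately show ?thesis using p by (metis prime_dvd_power primes_dvd_imp_eq)
qed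

lemma p2: "p \<ge> 2" using p by (rule prime_ge_2_nat)
lemma q2: "q \<ge> 2" unfolding q_def using p2 e self_le_power[of p e] by linarith

lemma frobenius_period: "x ^ (p ^ (3 * e)) = (x :: 'a)"
  using power_card_field[OF finite_field, of x] by (simp add: card_field)

lemma power_q: "(x + y :: 'a) ^ q = x ^ q + y ^ q" "(- x :: 'a) ^ q = - (x ^ q)" "(x - y :: 'a) ^ q = x ^ q - y ^ q"
  unfolding q_def using frob_add frob_minus frob_diff char p by metis+

lemma power_q3: "((x ^ q) ^ q) ^ q = (x :: 'a)"
proof -
  have "q * q * q = p ^ (e + e + e)" by (simp add: q_def power_add)
  also have "e + e + e = 3 * e" by simp
  finally have "((x ^ q) ^ q) ^ q = x ^ (p ^ (3 * e))" by (simp only: power_mult[symmetric])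
  then show ?thesis by (simp add: frobenius_period)
qed

text \<open>These are the elements that generate the field over its prime field.\<close>

definition full_degree :: "'a \<Rightarrow> bool" where
  "full_degree x \<longleftrightarrow> (\<forall>m\<ge>1. x ^ (p ^ m) = x \<longrightarrow> 3 * e \<le> m)"

lemma power_multiple: "x ^ (p ^ d) = x \<Longrightarrow> x ^ (p ^ (d * k)) = (x :: 'a)"
  by (induction k) (simp_all add: power_add power_mult)

lemma period_dvd:
  assumes "x ^ (p ^ d) = (x :: 'a)" "\<And>m. m \<ge> 1 \<Longrightarrow> x ^ (p ^ m) = x \<Longrightarrow> d \<le> m" "d \<ge> 1" "x ^ (p ^ m) = x"
  shows "d dvd m"
proof (rule ccontr)
  assume "\<not> d dvd m"
  then have "m mod d \<ge> 1" by (simp add: dvd_eq_mod_eq_0 Suc_le_eq)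
  moreover have "x ^ (p ^ (m mod d)) = x"
  proof -
    have "x = x ^ (p ^ (d * (m div d) + m mod d))" using assms(4) by simp
    also have "\<dots> = (x ^ (p ^ (d * (m div d)))) ^ (p ^ (m mod d))" by (simp only: power_add power_mult)
    also have "\<dots> = x ^ (p ^ (m mod d))" by (simp add: power_multiple[OF assms(1)])
    finally show ?thesis by simp
  qed
  ultimately have "d \<le> m mod d" by (rule assms(2))
  then show False using assms(3) by (metis mod_less_divisor not_le less_le_trans zero_less_one)
qed

text \<open>The degree \<open>d\<close> of \<open>x\<close> is a proper divisor of \<open>3 e\<close>. It is a multiple of three unless \<open>x\<close> lies in the field with \<open>q\<close>
elements. On the field with \<open>r\<^sup>3\<close> elements, \<open>r = p ^ j\<close>, the map \<open>x \<mapsto> x ^ q\<close> is then \<open>x \<mapsto> x ^ r\<close> or its inverse.\<close>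

lemma not_full_degree:
  assumes "\<not> full_degree x" "x ^ q \<noteq> x"
  obtains j where "1 \<le> j" "j \<le> e div 2" "x ^ (p ^ (3 * j)) = x"
    "((e div j) mod 3 = 1 \<and> x ^ q = x ^ (p ^ j)) \<or> ((e div j) mod 3 = 2 \<and> x ^ q = x ^ (p ^ (2 * j)))"
proof -
  define d where "d = (LEAST m. m \<ge> 1 \<and> x ^ (p ^ m) = x)"
  have ex: "\<exists>m. m \<ge> 1 \<and> x ^ (p ^ m) = x" using frobenius_period e by (intro exI[of _ "3 * e"]) auto
  have d: "d \<ge> 1" "x ^ (p ^ d) = x" using LeastI_ex[OF ex] by (simp_all add: d_def)
  have dmin: "d \<le> m" if "m \<ge> 1" "x ^ (p ^ m) = x" for m unfolding d_def using that by (intro Least_le) simp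
  have "d dvd 3 * e" by (rule period_dvd[OF d(2) dmin d(1) frobenius_period])
  then obtain k where k: "3 * e = d * k" by (rule dvdE)
  have "d \<noteq> 3 * e" using assms(1) dmin by (auto simp: full_degree_def)
  then have k2: "k \<ge> 2" using k e by (cases "k = 0 \<or> k = 1") auto
  have n3: "\<not> 3 dvd k"
  proof
    assume "3 dvd k"
    then obtain l where "k = 3 * l" by (rule dvdE)
    then have "e = d * l" using k by simp
    moreover have "x ^ q = x ^ (p ^ e)" by (simp add: q_def)
    ultimately have "x ^ q = x ^ (p ^ (d * l))" by metis
    then show False using assms(2) power_multiple[OF d(2), of l] by simp
  qed
  have "prime (3::nat)" by simp
  moreover have "3 dvd d * k" using k by (metis dvd_triv_left)
  ultimately have "3 dvd d" using n3 by (metis prime_dvd_mult_iff)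
  then obtain j where j: "d = 3 * j" by (rule dvdE)
  have ejk: "e = j * k" using k j by simp
  have j1: "j \<ge> 1" using d(1) j by simp
  have "2 * j \<le> e" unfolding ejk using k2 by (simp add: mult.commute)
  then have je: "j \<le> e div 2" by simp
  have ek: "e div j = k" using ejk j1 by simp
  have "k mod 3 \<noteq> 0" using n3 by (simp add: dvd_eq_mod_eq_0)
  then have m3: "k mod 3 = 1 \<or> k mod 3 = 2" by linarith
  have "x ^ q = x ^ (p ^ (d * (k div 3) + j * (k mod 3)))"
  proof -
    have "d * (k div 3) + j * (k mod 3) = j * (3 * (k div 3) + k mod 3)" by (simp only: j distrib_left mult_ac)
    then have "e = d * (k div 3) + j * (k mod 3)" by (simp add: ejk)
    moreover have "x ^ q = x ^ (p ^ e)" by (simp add: q_def)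
    ultimately show ?thesis by metis
  qed
  also have "\<dots> = (x ^ (p ^ (d * (k div 3)))) ^ (p ^ (j * (k mod 3)))" by (simp only: power_add power_mult)
  also have "\<dots> = x ^ (p ^ (j * (k mod 3)))" by (simp add: power_multiple[OF d(2)])
  finally show ?thesis using m3 that[OF j1 je] d(2) j ek by (auto simp: mult.commute)
qed

definition trace_kernel :: "'a set" where "trace_kernel = {x. x + x ^ q + (x ^ q) ^ q = 0}"

text \<open>The trace takes values in the field with \<open>q\<close> elements, and its fibres are the cosets of the kernel.\<close>

lemma card_trace_kernel: "card trace_kernel \<ge> q\<^sup>2"
proof -
  let ?T = "\<lambda>x :: 'a. x + x ^ q + (x ^ q) ^ q"
  let ?F = "{x :: 'a. x ^ q + poly (- Polynomial.monom 1 1) x = 0}"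
  have "Polynomial.degree (- Polynomial.monom 1 1 :: 'a poly) < q" using q2 by (simp add: Polynomial.degree_monom_eq)
  note F = card_roots_le[OF this]
  have im: "range ?T \<subseteq> ?F" by (auto simp: poly_monom power_q power_q3 algebra_simps)
  have fib: "card {x. ?T x = y} = card trace_kernel" if "y \<in> range ?T" for y
  proof -
    from that obtain x where x: "y = ?T x" by blast
    have "bij_betw (\<lambda>w. x + w) trace_kernel {x. ?T x = y}"
      by (rule bij_betw_byWitness[where f' = "\<lambda>w. w - x"])
        (auto simp: trace_kernel_def x power_q algebra_simps)
    from bij_betw_same_card[OF this] show ?thesis by simp
  qed
  have "CARD('a) = (\<Sum>y\<in>range ?T. card {x. ?T x = y})"
    using sum.image_gen[OF finite_field, of "\<lambda>_. 1 :: nat" ?T] by simp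
  also have "\<dots> = card (range ?T) * card trace_kernel" using fib by simp
  also have "\<dots> \<le> q * card trace_kernel"
    using card_mono[OF F(1) im] F(2) by (intro mult_right_mono) auto
  finally have "q * q\<^sup>2 \<le> q * card trace_kernel"
    by (simp add: card_field q_def power2_eq_square power_add[symmetric] numeral_3_eq_3 add.assoc)
  then show ?thesis using q2 by simp
qed

text \<open>An element of the kernel that lies in the field with \<open>q\<close> elements has the trace \<open>3 x = x\<close> and vanishes. One that lies in the
field with \<open>r\<^sup>3\<close> elements has trace zero over the field with \<open>r\<close> elements, which leaves at most \<open>r\<^sup>2\<close> possibilities.
Summation over the \<open>r\<close> with \<open>r\<^sup>2 \<le> q\<close> yields less than \<open>q\<^sup>2\<close>.\<close>

lemma exists_full_degree_char_two:
  assumes "p = 2" shows "\<exists>x \<in> trace_kernel. full_degree x"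
proof (rule ccontr)
  assume "\<not> ?thesis"
  then have bad: "\<not> full_degree x" if "x \<in> trace_kernel" for x using that by blast
  define m where "m = e div 2"
  let ?B = "\<lambda>j. {x :: 'a. x ^ (p ^ (2 * j)) + poly (Polynomial.monom 1 (p ^ j) + Polynomial.monom 1 1) x = 0}"
  have B: "finite (?B j) \<and> card (?B j) \<le> p ^ (2 * j)" if "j \<ge> 1" for j
  proof -
    have "p ^ j < p ^ (2 * j)" using p2 that by (intro power_strict_increasing) auto
    moreover from this have "1 < p ^ (2 * j)" using p2 by (meson le_less_trans one_le_power one_le_numeral order_trans)
    ultimately have "Polynomial.degree (Polynomial.monom 1 (p ^ j) + Polynomial.monom 1 1 :: 'a poly) < p ^ (2 * j)"
      by (intro degree_add_less) (simp_all add: Polynomial.degree_monom_eq)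
    then show ?thesis using card_roots_le by blast
  qed
  have sub: "trace_kernel \<subseteq> {0} \<union> (\<Union>j\<in>{1..m}. ?B j)"
  proof
    fix x assume x: "x \<in> trace_kernel"
    show "x \<in> {0} \<union> (\<Union>j\<in>{1..m}. ?B j)"
    proof (cases "x ^ q = x")
      case True
      then have "3 * x = 0" using x by (simp add: trace_kernel_def)
      moreover have "(of_nat 3 :: 'a) \<noteq> 0"
        using assms char by (subst of_nat_eq_0_iff_char_dvd) simp
      ultimately show ?thesis by simp
    next
      case False
      from not_full_degree[OF bad[OF x] False] obtain j where j: "1 \<le> j" "j \<le> e div 2" "x ^ (p ^ (3 * j)) = x"
        "x ^ q = x ^ (p ^ j) \<or> x ^ q = x ^ (p ^ (2 * j))" by metis
      have pp: "(x ^ (p ^ a)) ^ (p ^ b) = x ^ (p ^ (a + b))" for a b by (simp add: power_add power_mult)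
      have "x + x ^ (p ^ j) + x ^ (p ^ (2 * j)) = 0"
        using j(4)
      proof
        assume a: "x ^ q = x ^ (p ^ j)"
        have "(x ^ q) ^ q = (x ^ q) ^ (p ^ j)" unfolding a by (metis a power_commutes power_mult mult.commute)
        also have "\<dots> = x ^ (p ^ (2 * j))" by (simp add: a pp mult_2)
        finally show ?thesis using x a by (simp add: trace_kernel_def)
      next
        assume a: "x ^ q = x ^ (p ^ (2 * j))"
        have "(x ^ q) ^ q = (x ^ q) ^ (p ^ (2 * j))" unfolding a by (metis a power_mult mult.commute)
        also have "\<dots> = (x ^ (p ^ (3 * j))) ^ (p ^ j)" by (simp add: a pp)
        also have "\<dots> = x ^ (p ^ j)" by (simp add: j(3))
        finally show ?thesis using x a by (simp add: trace_kernel_def algebra_simps)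
      qed
      then have "x \<in> ?B j" by (simp add: poly_monom algebra_simps)
      then show ?thesis using j(1,2) by (auto simp: m_def)
    qed
  qed
  have fin: "finite ({0} \<union> (\<Union>j\<in>{1..m}. ?B j))" using B by auto
  have "q\<^sup>2 \<le> card ({0} \<union> (\<Union>j\<in>{1..m}. ?B j))" using card_trace_kernel card_mono[OF fin sub] by linarith
  also have "\<dots> \<le> 1 + card (\<Union>j\<in>{1..m}. ?B j)" using card_Un_le[of "{0}"] by simp
  also have "card (\<Union>j\<in>{1..m}. ?B j) \<le> (\<Sum>j=1..m. card (?B j))" by (rule card_UN_le) simp
  also have "\<dots> \<le> (\<Sum>j=1..m. p ^ (2 * j))" using B by (intro sum_mono) auto
  also have "(\<Sum>j=1..m. p ^ (2 * j)) \<le> (4 * 4 ^ m - 4) div 3"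
  proof -
    have "3 * (\<Sum>j=1..n. p ^ (2 * j)) + 4 = 4 * 4 ^ n" for n :: nat
      by (induction n) (simp_all add: assms power_mult)
    then show ?thesis by (metis add_diff_cancel_right' nonzero_mult_div_cancel_left order_refl zero_neq_numeral)
  qed
  also have "4 ^ m \<le> q"
  proof -
    have "4 ^ m = p ^ (2 * m)" by (simp add: assms power_mult)
    also have "\<dots> \<le> p ^ e" using p2 by (intro power_increasing) (auto simp: m_def)
    finally show ?thesis by (simp add: q_def)
  qed
  finally have "q\<^sup>2 \<le> 1 + (4 * q - 4) div 3" by (simp add: div_le_mono)
  then have "3 * q\<^sup>2 \<le> 4 * q" using q2 by linarith
  moreover have "q\<^sup>2 \<ge> 2 * q" using q2 by (simp add: power2_eq_square)
  ultimately show False using q2 by linarith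
qed

text \<open>On these elements \<open>x \<mapsto> x ^ q\<close> is the Moebius map \<open>x \<mapsto> - (1 + x) / x\<close> of order three. They arise as quotients
\<open>v ^ q / v\<close> from the elements \<open>v\<close> of trace zero.\<close>

definition moebius_roots :: "'a set" where "moebius_roots = {x. x ^ q * x + x + 1 = 0}"

lemma card_moebius_roots: "card moebius_roots \<ge> q + 1"
proof -
  let ?K = "trace_kernel - {0}"
  let ?f = "\<lambda>v :: 'a. v ^ (q - 1)"
  have fK: "finite ?K" using finite_field by (meson finite_subset subset_UNIV)
  have im: "?f ` ?K \<subseteq> moebius_roots"
  proof
    fix x assume "x \<in> ?f ` ?K"
    then obtain v where v: "v \<noteq> 0" "v + v ^ q + (v ^ q) ^ q = 0" "x = v ^ (q - 1)" by (auto simp: trace_kernel_def)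
    have xv: "v ^ q = x * v" using v(3) q2 by (metis power_minus_mult zero_less_numeral less_le_trans)
    have "v * (1 + x + x ^ q * x) = v + v ^ q + (v ^ q) ^ q"
      by (simp add: xv power_mult_distrib algebra_simps)
    then have "1 + x + x ^ q * x = 0" using v by simp
    then show "x \<in> moebius_roots" by (simp add: moebius_roots_def algebra_simps)
  qed
  have fib: "card {v \<in> ?K. ?f v = c} \<le> q - 1" for c
  proof -
    have "Polynomial.degree [:- c:] < q - 1" using q2 by simp
    note r = card_roots_le[OF this]
    have "{v \<in> ?K. ?f v = c} \<subseteq> {x. x ^ (q - 1) + poly [:- c:] x = 0}" by auto
    then show ?thesis using r card_mono le_trans by blast
  qed
  have "card ?K = (\<Sum>c\<in>?f ` ?K. card {v \<in> ?K. ?f v = c})"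
    using sum.image_gen[OF fK, of "\<lambda>_. 1 :: nat" ?f] by simp
  also have "\<dots> \<le> (\<Sum>c\<in>?f ` ?K. q - 1)" by (intro sum_mono fib)
  also have "\<dots> = card (?f ` ?K) * (q - 1)" by simp
  also have "\<dots> \<le> card moebius_roots * (q - 1)"
    using im finite_field by (intro mult_right_mono card_mono) (auto intro: finite_subset)
  finally have "card ?K \<le> card moebius_roots * (q - 1)" .
  moreover have "card ?K \<ge> q\<^sup>2 - 1"
  proof -
    have "0 \<in> trace_kernel" using q2 by (simp add: trace_kernel_def power_0_left)
    then have "card ?K = card trace_kernel - 1" by simp
    then show ?thesis using card_trace_kernel by linarith
  qed
  moreover have "q\<^sup>2 - 1 = (q + 1) * (q - 1)" by (simp add: power2_eq_square algebra_simps diff_mult_distrib2)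
  ultimately have "(q + 1) * (q - 1) \<le> card moebius_roots * (q - 1)" by linarith
  moreover have "0 < q - 1" using q2 by simp
  ultimately show ?thesis by (metis mult_le_cancel2)
qed

text \<open>A root in the field with \<open>q\<close> elements is a root of \<open>x\<^sup>2 + x + 1\<close>; one in the field with \<open>r\<^sup>3\<close> elements is a root of
\<open>x ^ (r + 1) + x + 1\<close> or \<open>x ^ (r + 1) + x ^ r + 1\<close>, depending on \<open>r\<close>. Summation over the \<open>r\<close> with \<open>r\<^sup>2 \<le> q\<close> yields less
than \<open>q + 1\<close>.\<close>

lemma exists_full_degree_odd:
  assumes "p \<noteq> 2" shows "\<exists>x \<in> moebius_roots. full_degree x"
proof (rule ccontr)
  assume "\<not> ?thesis"
  then have bad: "\<not> full_degree x" if "x \<in> moebius_roots" for x using that by blast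
  have p3: "p \<ge> 3" using assms p2 by linarith
  define m where "m = e div 2"
  define h :: "nat \<Rightarrow> 'a poly" where "h j = Polynomial.monom 1 (if (e div j) mod 3 = 1 then 1 else p ^ j) + 1" for j
  let ?B = "\<lambda>j. {x :: 'a. x ^ (p ^ j + 1) + poly (h j) x = 0}"
  let ?C = "{x :: 'a. x ^ 2 + poly (Polynomial.monom 1 1 + 1) x = 0}"
  have B: "finite (?B j) \<and> card (?B j) \<le> p ^ j + 1" if "j \<ge> 1" for j
  proof -
    have "p ^ j \<ge> 1" using p2 by simp
    then have "Polynomial.degree (h j) < p ^ j + 1"
      unfolding h_def using p2 by (intro degree_add_less) (simp_all add: Polynomial.degree_monom_eq)
    then show ?thesis using card_roots_le by blast
  qed
  have "Polynomial.degree (Polynomial.monom 1 1 + 1 :: 'a poly) < 2"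
    by (intro degree_add_less) (simp_all add: Polynomial.degree_monom_eq)
  note C = card_roots_le[OF this]
  have sub: "moebius_roots \<subseteq> ?C \<union> (\<Union>j\<in>{1..m}. ?B j)"
  proof
    fix x assume x: "x \<in> moebius_roots"
    then have eq: "x ^ q * x + x + 1 = 0" by (simp add: moebius_roots_def)
    show "x \<in> ?C \<union> (\<Union>j\<in>{1..m}. ?B j)"
    proof (cases "x ^ q = x")
      case True
      then show ?thesis using eq by (simp add: poly_monom power2_eq_square algebra_simps)
    next
      case False
      from not_full_degree[OF bad[OF x] False] obtain j where j: "1 \<le> j" "j \<le> e div 2" "x ^ (p ^ (3 * j)) = x"
        "((e div j) mod 3 = 1 \<and> x ^ q = x ^ (p ^ j)) \<or> ((e div j) mod 3 = 2 \<and> x ^ q = x ^ (p ^ (2 * j)))" .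
      from j(4) have "x \<in> ?B j"
      proof
        assume "(e div j) mod 3 = 1 \<and> x ^ q = x ^ (p ^ j)"
        then show ?thesis using eq by (simp add: h_def poly_monom algebra_simps)
      next
        assume a: "(e div j) mod 3 = 2 \<and> x ^ q = x ^ (p ^ (2 * j))"
        then have "(x ^ (p ^ (2 * j)) * x + x + 1) ^ (p ^ j) = 0" using eq p2 by (simp add: zero_power)
        moreover have "(x ^ (p ^ (2 * j)) * x + x + 1) ^ (p ^ j) = (x ^ (p ^ (2 * j))) ^ (p ^ j) * x ^ (p ^ j) + x ^ (p ^ j) + 1"
          by (simp add: frob_add[OF char[symmetric] p] power_mult_distrib)
        moreover have "(x ^ (p ^ (2 * j))) ^ (p ^ j) = x"
          using j(3) by (simp add: power_mult[symmetric] power_add[symmetric])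
        ultimately have "x * x ^ (p ^ j) + x ^ (p ^ j) + 1 = 0" by simp
        then show ?thesis using a by (simp add: h_def poly_monom algebra_simps)
      qed
      then show ?thesis using j(1,2) by (auto simp: m_def)
    qed
  qed
  have fin: "finite (?C \<union> (\<Union>j\<in>{1..m}. ?B j))" using B C by auto
  have "q + 1 \<le> card (?C \<union> (\<Union>j\<in>{1..m}. ?B j))" using card_moebius_roots card_mono[OF fin sub] by linarith
  also have "\<dots> \<le> card ?C + card (\<Union>j\<in>{1..m}. ?B j)" by (rule card_Un_le)
  also have "\<dots> \<le> 2 + (\<Sum>j=1..m. card (?B j))" by (intro add_mono C(2) card_UN_le) simp
  also have "\<dots> \<le> 2 + (\<Sum>j=1..m. p ^ j + 1)" using B by (intro add_left_mono sum_mono) auto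
  finally have 1: "q + 1 \<le> 2 + (\<Sum>j=1..m. p ^ j + 1)" .
  have "(\<Sum>j=1..n. p ^ j + 1) + 2 \<le> 2 * p ^ n" for n :: nat
  proof (induction n)
    case (Suc n)
    have "3 * p ^ n \<le> p * p ^ n" using p3 by (intro mult_right_mono) auto
    moreover have "p ^ n \<ge> 1" using p2 by simp
    moreover have "(\<Sum>j=1..Suc n. p ^ j + 1) = (\<Sum>j=1..n. p ^ j + 1) + (p * p ^ n + 1)" by simp
    ultimately show ?case using Suc unfolding power_Suc by linarith
  qed simp
  from this[of m] 1 have le: "q + 1 \<le> 2 * p ^ m" by linarith
  show False
  proof (cases "m = 0")
    case True
    then show ?thesis using le q2 by simp
  next
    case False
    have "p ^ m * p ^ m \<le> q" unfolding q_def power_add[symmetric] using p2 by (intro power_increasing) (auto simp: m_def)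
    moreover have "3 * p ^ m \<le> p ^ m * p ^ m" using p3 False self_le_power[of p m] by (intro mult_right_mono) auto
    ultimately show ?thesis using le by linarith
  qed
qed

end

section \<open>The projective group and Wilson's operations\<close>

definition proj :: "'a::field ^ 2 ^ 2 \<Rightarrow> ('a ^ 2 ^ 2) set" where "proj A = {A, - A}"

lemma proj_eq_iff: "proj A = proj B \<longleftrightarrow> B = A \<or> B = - A"
  unfolding proj_def by (auto simp: doubleton_eq_iff)

lemma centre_SL: "group_centre (SL :: ('a::field ^ 2 ^ 2) monoid) = {mat 1, - mat 1}"
proof (intro equalityI subsetI)
  fix Z :: "'a ^ 2 ^ 2" assume Z: "Z \<in> group_centre SL"
  obtain a b c d where E: "Z = mat2 a b c d" by (rule mat2_cases)
  have cm: "Z ** A = A ** Z" if "det A = 1" for A using Z that by (simp add: group_centre_def SL_def)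
  have "det Z = 1" using Z by (simp add: group_centre_def SL_def)
  moreover have "c = 0" "a = d" using cm[of "mat2 1 1 0 1"] by (auto simp: E)
  moreover have "b = 0" using cm[of "mat2 1 0 1 1"] by (simp add: E)
  ultimately have "a\<^sup>2 = 1" "Z = mat2 a 0 0 a" by (simp_all add: E power2_eq_square)
  then show "Z \<in> {mat 1, - mat 1}" by (auto simp: power2_eq_1_iff mat2_one)
next
  fix Z :: "'a ^ 2 ^ 2" assume "Z \<in> {mat 1, - mat 1}"
  then show "Z \<in> group_centre SL" by (auto simp: group_centre_def SL_def minus_one_mult)
qed

lemma r_coset_SL: "group_centre SL #>\<^bsub>SL\<^esub> A = proj (A :: 'a::field ^ 2 ^ 2)"
  unfolding r_coset_def centre_SL by (auto simp: proj_def SL_def minus_one_mult)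

lemma carrier_L2: "carrier (L2 :: ('a::field ^ 2 ^ 2) set monoid) = proj ` {A. det A = 1}"
  by (auto simp: L2_def FactGroup_def RCOSETS_def r_coset_SL) (auto simp: SL_def)

lemma proj_in_L2 [simp]: "det A = 1 \<Longrightarrow> proj A \<in> carrier L2"
  by (auto simp: carrier_L2)

lemma mult_L2: "proj A \<otimes>\<^bsub>L2\<^esub> proj B = proj (A ** B :: 'a::field ^ 2 ^ 2)"
proof -
  have "A ** - B = - (A ** B)" by (cases A rule: mat2_cases, cases B rule: mat2_cases) simp
  then show ?thesis by (auto simp: L2_def FactGroup_def set_mult_def proj_def SL_def minus_mult)
qed

lemma one_L2: "\<one>\<^bsub>L2\<^esub> = proj (mat 1 :: 'a::field ^ 2 ^ 2)"
  by (simp add: L2_def FactGroup_def centre_SL proj_def)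

lemma inv_L2: "det A = 1 \<Longrightarrow> inv\<^bsub>L2\<^esub> (proj A) = proj (adj A)" for A :: "'a::field ^ 2 ^ 2"
proof -
  assume A: "det A = 1"
  interpret L: group "L2 :: ('a ^ 2 ^ 2) set monoid" by (rule group_L2)
  show ?thesis by (rule L.inv_equality) (use A in \<open>simp_all add: mult_L2 one_L2 adj_mult\<close>)
qed

lemma involution_L2:
  fixes A :: "'a::field ^ 2 ^ 2"
  assumes "det A = 1" "\<not> central A" "A ** A = mat 1 \<or> A ** A = - mat 1"
  shows "is_involution L2 (proj A)"
  using assms by (auto simp: is_involution_def mult_L2 one_L2 proj_eq_iff central_def)

lemma preimage_generate:
  fixes S :: "('a::field ^ 2 ^ 2) set set"
  assumes "finite (UNIV :: 'a set)" "S \<subseteq> carrier L2"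
  shows "SL2_subgroup {A. det A = 1 \<and> proj A \<in> generate L2 S}"
proof -
  interpret L: group "L2 :: ('a ^ 2 ^ 2) set monoid" by (rule group_L2)
  have sg: "subgroup (generate L2 S) L2" by (rule L.generate_is_subgroup[OF assms(2)])
  show ?thesis
  proof
    fix A B assume A: "A \<in> {A. det A = 1 \<and> proj A \<in> generate L2 S}"
    show "det A = 1" using A by simp
    have "proj (- A) = proj A" by (simp add: proj_eq_iff)
    then show "- A \<in> {A. det A = 1 \<and> proj A \<in> generate L2 S}" using A by simp
    show "adj A \<in> {A. det A = 1 \<and> proj A \<in> generate L2 S}"
      using A subgroup.m_inv_closed[OF sg, of "proj A"] by (simp add: inv_L2)
    assume B: "B \<in> {A. det A = 1 \<and> proj A \<in> generate L2 S}"
    show "A ** B \<in> {A. det A = 1 \<and> proj A \<in> generate L2 S}"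
      using A B subgroup.m_closed[OF sg, of "proj A" "proj B"] by (simp add: mult_L2 det_mul)
  next
    show "mat 1 \<in> {A. det A = 1 \<and> proj A \<in> generate L2 S}"
      using subgroup.one_closed[OF sg] by (simp add: one_L2)
  qed (rule assms(1))
qed

lemma iso_of_matrix_map:
  fixes T :: "'a::field ^ 2 ^ 2 \<Rightarrow> 'a ^ 2 ^ 2"
  assumes fin: "finite (UNIV :: 'a set)"
    and T: "\<And>A B. T (A ** B) = T A ** T B" "\<And>A. T (- A) = - T A" "\<And>A. det A = 1 \<Longrightarrow> det (T A) = 1"
    and inj: "inj T"
  shows "(\<lambda>U. T ` U) \<in> iso L2 L2" "T ` proj A = proj (T A)"
proof -
  show tp: "T ` proj A = proj (T A)" for A by (simp add: proj_def T(2))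
  have finL: "finite (carrier (L2 :: ('a ^ 2 ^ 2) set monoid))"
  proof -
    interpret SL2_subgroup "{A :: 'a ^ 2 ^ 2. det A = 1}"
      by unfold_locales (use fin in \<open>auto simp: det_mul\<close>)
    show ?thesis by (simp add: carrier_L2 finite_matrices)
  qed
  have cl: "T ` U \<in> carrier L2" if "U \<in> carrier L2" for U
    using that T(3) by (auto simp: carrier_L2 tp)
  have "inj_on ((`) T) (carrier L2)" using inj by (simp add: inj_on_def inj_image_eq_iff)
  moreover from this have "(`) T ` carrier L2 = carrier L2"
    using cl by (intro endo_inj_surj[OF finL]) auto
  ultimately have "bij_betw ((`) T) (carrier L2) (carrier L2)" by (simp add: bij_betw_def)
  moreover have "T ` (U \<otimes>\<^bsub>L2\<^esub> V) = T ` U \<otimes>\<^bsub>L2\<^esub> T ` V" if UV: "U \<in> carrier L2" "V \<in> carrier L2" for U V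
  proof -
    obtain A B where "U = proj A" "V = proj B" using UV by (auto simp: carrier_L2)
    then show ?thesis by (simp only: mult_L2 tp T(1))
  qed
  ultimately show "(\<lambda>U. T ` U) \<in> iso L2 L2" using cl by (auto simp: iso_def hom_def)
qed

text \<open>Flips may differ outside the set of flags, as they do for Wilson's operations on generated maps.\<close>

lemma map_isomorphic_cong:
  assumes "flags M = flags M'" "flags N = flags N'"
    and "\<And>x. x \<in> flags M \<Longrightarrow> flip0 M x = flip0 M' x \<and> flip1 M x = flip1 M' x \<and> flip2 M x = flip2 M' x"
    and "\<And>x. x \<in> flags N \<Longrightarrow> flip0 N x = flip0 N' x \<and> flip1 N x = flip1 N' x \<and> flip2 N x = flip2 N' x"
  shows "map_isomorphic M N \<longleftrightarrow> map_isomorphic M' N'"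
proof -
  have "\<phi> \<in> map_isos M N \<longleftrightarrow> \<phi> \<in> map_isos M' N'" for \<phi>
  proof (cases "bij_betw \<phi> (flags M) (flags N)")
    case True
    then have "\<phi> x \<in> flags N" if "x \<in> flags M" for x using that by (auto simp: bij_betw_def)
    then show ?thesis using assms True by (simp add: map_isos_def)
  next
    case False
    then show ?thesis using assms by (simp add: map_isos_def)
  qed
  then have "map_isos M N = map_isos M' N'" by blast
  then show ?thesis by (simp add: map_isomorphic_def)
qed

context map_triple
begin

definition third where "third = \<rho>\<^sub>0 \<otimes> \<rho>\<^sub>2"

lemma third_closed [simp]: "third \<in> carrier G" by (simp add: third_def)

lemma third_products:
  "\<rho>\<^sub>0 \<otimes> \<rho>\<^sub>2 = third" "\<rho>\<^sub>2 \<otimes> \<rho>\<^sub>0 = third" "\<rho>\<^sub>0 \<otimes> third = \<rho>\<^sub>2" "third \<otimes> \<rho>\<^sub>0 = \<rho>\<^sub>2"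
  "\<rho>\<^sub>2 \<otimes> third = \<rho>\<^sub>0" "third \<otimes> \<rho>\<^sub>2 = \<rho>\<^sub>0" "third \<otimes> third = \<one>"
proof -
  show a: "\<rho>\<^sub>0 \<otimes> \<rho>\<^sub>2 = third" "\<rho>\<^sub>2 \<otimes> \<rho>\<^sub>0 = third" by (simp_all add: third_def commute)
  show "third \<otimes> \<rho>\<^sub>2 = \<rho>\<^sub>0" by (simp add: third_def m_assoc square)
  show "third \<otimes> \<rho>\<^sub>0 = \<rho>\<^sub>2" by (simp add: third_def commute m_assoc square)
  show "\<rho>\<^sub>0 \<otimes> third = \<rho>\<^sub>2" by (simp add: third_def m_assoc[symmetric] square)
  show b: "\<rho>\<^sub>2 \<otimes> third = \<rho>\<^sub>0" by (simp add: third_def commute m_assoc[symmetric] square)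
  show "third \<otimes> third = \<one>"
  proof -
    have "third \<otimes> third = \<rho>\<^sub>0 \<otimes> (\<rho>\<^sub>2 \<otimes> third)" by (subst third_def) (simp add: m_assoc)
    then show ?thesis by (simp only: b square)
  qed
qed

text \<open>The outer generators of the six images, in the order of \<open>wilson_images\<close>.\<close>

definition wilson_left :: "nat \<Rightarrow> 'a" where
  "wilson_left i = [\<rho>\<^sub>0, \<rho>\<^sub>2, third, third, \<rho>\<^sub>2, \<rho>\<^sub>0] ! i"
definition wilson_right :: "nat \<Rightarrow> 'a" where
  "wilson_right i = [\<rho>\<^sub>2, \<rho>\<^sub>0, \<rho>\<^sub>2, \<rho>\<^sub>0, third, third] ! i"

lemma less_6_cases: "i < (6::nat) \<longleftrightarrow> i = 0 \<or> i = 1 \<or> i = 2 \<or> i = 3 \<or> i = 4 \<or> i = 5" by auto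

lemma wilson_image:
  assumes "i < 6"
  defines "M \<equiv> wilson_images (generated_map G \<rho>\<^sub>0 \<rho>\<^sub>1 \<rho>\<^sub>2) ! i"
    and "N \<equiv> generated_map G (wilson_left i) \<rho>\<^sub>1 (wilson_right i)"
  shows "flags M = flags N"
    "x \<in> flags M \<Longrightarrow> flip0 M x = flip0 N x \<and> flip1 M x = flip1 N x \<and> flip2 M x = flip2 N x"
proof -
  show f: "flags M = flags N"
    using assms(1) unfolding less_6_cases M_def N_def
    by (auto simp: wilson_images_def dual_def petrie_def generated_map_def nth_Cons')
  show "flip0 M x = flip0 N x \<and> flip1 M x = flip1 N x \<and> flip2 M x = flip2 N x" if "x \<in> flags M"
  proof -
    have "x \<in> carrier G" using that f by (simp add: N_def generated_map_def)
    then show ?thesis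
      using assms(1) unfolding less_6_cases M_def N_def wilson_left_def wilson_right_def
      by (auto simp: wilson_images_def dual_def petrie_def generated_map_def nth_Cons' m_assoc third_products)
  qed
qed

lemma wilson_triple:
  assumes "i < 6" "\<rho>\<^sub>0 \<noteq> \<rho>\<^sub>2"
  shows "map_triple G (wilson_left i) \<rho>\<^sub>1 (wilson_right i)"
proof -
  have ne: "third \<noteq> \<one>"
  proof
    assume "third = \<one>"
    then have "third \<otimes> \<rho>\<^sub>2 = \<rho>\<^sub>2" by simp
    then show False using assms(2) third_products(6) by simp
  qed
  have inv: "is_involution G third" using ne by (simp add: is_involution_def third_products)
  have gen: "generate G {x, \<rho>\<^sub>1, y} = carrier G"
    if c: "x \<in> carrier G" "y \<in> carrier G" and "{\<rho>\<^sub>0, \<rho>\<^sub>2} \<subseteq> {x, y, x \<otimes> y}" for x y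
  proof -
    have sg: "subgroup (generate G {x, \<rho>\<^sub>1, y}) G" using c by (intro generate_is_subgroup) auto
    have "{x, \<rho>\<^sub>1, y} \<subseteq> generate G {x, \<rho>\<^sub>1, y}" by (auto intro: generate.incl)
    moreover from this have "x \<otimes> y \<in> generate G {x, \<rho>\<^sub>1, y}" using subgroup.m_closed[OF sg] by blast
    ultimately have "{\<rho>\<^sub>0, \<rho>\<^sub>1, \<rho>\<^sub>2} \<subseteq> generate G {x, \<rho>\<^sub>1, y}" using that(3) by blast
    then have "carrier G \<subseteq> generate G {x, \<rho>\<^sub>1, y}"
      using generate_subgroup_incl[OF _ sg] generating by blast
    then show ?thesis using generate_incl[of "{x, \<rho>\<^sub>1, y}"] c by auto
  qed
  have lr: "is_involution G (wilson_left i)" "is_involution G (wilson_right i)"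
    "wilson_left i \<otimes> wilson_right i = wilson_right i \<otimes> wilson_left i"
    "{\<rho>\<^sub>0, \<rho>\<^sub>2} \<subseteq> {wilson_left i, wilson_right i, wilson_left i \<otimes> wilson_right i}"
    using assms(1) involutions inv unfolding less_6_cases wilson_left_def wilson_right_def
    by (auto simp: nth_Cons' third_products)
  have "generate G {wilson_left i, \<rho>\<^sub>1, wilson_right i} = carrier G"
    by (rule gen) (use lr in \<open>simp_all add: is_involution_def\<close>)
  then show ?thesis
    by unfold_locales (use lr involutions in simp_all)
qed

lemma wilson_iso_iff:
  assumes "\<rho>\<^sub>0 \<noteq> \<rho>\<^sub>2" "i < 6" "j < 6"
  shows "(i, j) \<in> wilson_iso (generated_map G \<rho>\<^sub>0 \<rho>\<^sub>1 \<rho>\<^sub>2) \<longleftrightarrow>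
    (\<exists>h \<in> iso G G. h (wilson_left i) = wilson_left j \<and> h \<rho>\<^sub>1 = \<rho>\<^sub>1 \<and> h (wilson_right i) = wilson_right j)"
proof -
  have "(i, j) \<in> wilson_iso (generated_map G \<rho>\<^sub>0 \<rho>\<^sub>1 \<rho>\<^sub>2) \<longleftrightarrow>
    map_isomorphic (generated_map G (wilson_left i) \<rho>\<^sub>1 (wilson_right i)) (generated_map G (wilson_left j) \<rho>\<^sub>1 (wilson_right j))"
    using assms(2,3) wilson_image[of i] wilson_image[of j]
    by (simp add: wilson_iso_def, intro map_isomorphic_cong) auto
  then show ?thesis
    using map_triple.isomorphic_generated_map_iff[OF wilson_triple[OF assms(2,1)] wilson_triple[OF assms(3,1)]] by simp
qed

text \<open>The triality joins the images with the positions 0, 4, 3 and those with the positions 1, 2, 5. An isomorphism between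
the two classes would make the map isomorphic to its dual.\<close>

theorem class_III_of_triality:
  assumes "finite (carrier G)" "\<rho>\<^sub>0 \<noteq> \<rho>\<^sub>2"
    and t: "t \<in> iso G G" "t \<rho>\<^sub>0 = \<rho>\<^sub>2" "t \<rho>\<^sub>2 = \<rho>\<^sub>0 \<otimes> \<rho>\<^sub>2" "t \<rho>\<^sub>1 = \<rho>\<^sub>1"
    and no_swap: "\<And>h. h \<in> iso G G \<Longrightarrow> h \<rho>\<^sub>0 = \<rho>\<^sub>2 \<Longrightarrow> h \<rho>\<^sub>2 = \<rho>\<^sub>0 \<Longrightarrow> h \<rho>\<^sub>1 = \<rho>\<^sub>1 \<Longrightarrow> False"
  shows "class_III (generated_map G \<rho>\<^sub>0 \<rho>\<^sub>1 \<rho>\<^sub>2)"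
proof -
  let ?M = "generated_map G \<rho>\<^sub>0 \<rho>\<^sub>1 \<rho>\<^sub>2"
  have t3: "t third = \<rho>\<^sub>0"
  proof -
    have "t third = t \<rho>\<^sub>0 \<otimes> t \<rho>\<^sub>2" using t(1) unfolding third_def by (auto simp: iso_def hom_def)
    then show ?thesis using t(2,3) by (simp add: third_products)
  qed
  have t': "t \<rho>\<^sub>2 = third" using t(3) by (simp add: third_def)
  define E where "E i j \<longleftrightarrow> (i, j) \<in> wilson_iso ?M" for i j
  have E: "E i j \<longleftrightarrow> (\<exists>h \<in> iso G G. h (wilson_left i) = wilson_left j \<and> h \<rho>\<^sub>1 = \<rho>\<^sub>1 \<and> h (wilson_right i) = wilson_right j)"
    if "i < 6" "j < 6" for i j unfolding E_def using wilson_iso_iff[OF assms(2) that] .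
  have wclosed: "wilson_left i \<in> carrier G" "wilson_right i \<in> carrier G" if "i < 6" for i
    using map_triple.closed[OF wilson_triple[OF that assms(2)]] by auto
  have refl: "E i i" if "i < 6" for i
    unfolding E[OF that that] by (rule bexI[of _ "\<lambda>x. x"]) (auto simp: iso_def hom_def bij_betw_def)
  have trans: "E i k" if ij: "E i j" and jk: "E j k" and lt: "i < 6" "j < 6" "k < 6" for i j k
  proof -
    obtain g h where "g \<in> iso G G" "h \<in> iso G G"
      "g (wilson_left i) = wilson_left j \<and> g \<rho>\<^sub>1 = \<rho>\<^sub>1 \<and> g (wilson_right i) = wilson_right j"
      "h (wilson_left j) = wilson_left k \<and> h \<rho>\<^sub>1 = \<rho>\<^sub>1 \<and> h (wilson_right j) = wilson_right k"
      using ij jk E lt by blast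
    then show ?thesis using iso_set_trans[of g G G h G] wclosed[OF lt(1)] unfolding E[OF lt(1,3)]
      by (intro bexI[of _ "h \<circ> g"]) auto
  qed
  have sym: "E j i" if ij: "E i j" and lt: "i < 6" "j < 6" for i j
  proof -
    obtain h where h: "h \<in> iso G G"
      "h (wilson_left i) = wilson_left j" "h \<rho>\<^sub>1 = \<rho>\<^sub>1" "h (wilson_right i) = wilson_right j"
      using ij E lt by blast
    have inj: "inj_on h (carrier G)" using h(1) by (simp add: iso_def bij_betw_def)
    have "inv_into (carrier G) h \<in> iso G G" by (rule iso_set_sym[OF h(1)])
    moreover have "inv_into (carrier G) h (wilson_left j) = wilson_left i"
      "inv_into (carrier G) h \<rho>\<^sub>1 = \<rho>\<^sub>1" "inv_into (carrier G) h (wilson_right j) = wilson_right i"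
      using inv_into_f_f[OF inj] h(2-) wclosed[OF lt(1)] by (metis, metis closed(2), metis)
    ultimately show ?thesis unfolding E[OF lt(2,1)] by blast
  qed
  note W = wilson_left_def wilson_right_def
  have e: "E 0 4" "E 4 3" "E 1 2" "E 2 5"
    using t t' t3 by (auto simp: E W nth_Cons' intro!: bexI[of _ t])
  have ne: "\<not> E 0 1" using no_swap by (auto simp: E W)
  have A: "E i j" if "i \<in> {0, 3, 4}" "j \<in> {0, 3, 4}" for i j
  proof -
    have "E 0 k \<and> k < 6" if "k \<in> {0, 3, 4}" for k using that e(1,2) refl[of 0] trans[of 0 4 3] by auto
    then have "E 0 i" "E 0 j" "i < 6" "j < 6" using that by blast+
    then show ?thesis using sym[of 0 i] trans[of i 0 j] by simp
  qed
  have B: "E i j" if "i \<in> {1, 2, 5}" "j \<in> {1, 2, 5}" for i j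
  proof -
    have "E 1 k \<and> k < 6" if "k \<in> {1, 2, 5}" for k using that e(3,4) refl[of 1] trans[of 1 2 5] by auto
    then have "E 1 i" "E 1 j" "i < 6" "j < 6" using that by blast+
    then show ?thesis using sym[of 1 i] trans[of i 1 j] by simp
  qed
  have C: "\<not> E i j" if ij: "i \<in> {0, 3, 4}" "j \<in> {1, 2, 5}" for i j
  proof
    assume "E i j"
    moreover have "i < 6" "j < 6" using ij by auto
    moreover have "E 0 i" "E j 1" using A[of 0 i] B[of j 1] ij by auto
    ultimately show False using ne trans[of 0 i j] trans[of 0 j 1] by simp
  qed
  have split: "k < 6 \<longleftrightarrow> k \<in> {0, 3, 4} \<or> k \<in> {1, 2, 5}" for k :: nat by auto
  have im: "wilson_iso ?M `` {i} = (if i \<in> {0, 3, 4} then {0, 3, 4} else {1, 2, 5})" if "i < 6" for i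
  proof -
    have "j \<in> wilson_iso ?M `` {i} \<longleftrightarrow> j < 6 \<and> E i j" for j by (auto simp: E_def wilson_iso_def)
    moreover have "j < 6 \<and> E i j \<longleftrightarrow> j \<in> (if i \<in> {0, 3, 4} then {0, 3, 4} else {1, 2, 5})" for j
    proof (cases "i \<in> {0, 3, 4}")
      case True
      then show ?thesis using A[OF True, of j] C[OF True, of j] split[of j] by auto
    next
      case False
      then have i: "i \<in> {1, 2, 5}" using that split by blast
      then have "\<not> E i j" if "j \<in> {0, 3, 4}" using C[OF that i] sym[of i j] split[of i] split[of j] that i by blast
      then show ?thesis using B[OF i, of j] False split[of j] by auto
    qed
    ultimately show ?thesis by blast
  qed
  have quot: "{..<6} // wilson_iso ?M = {{0, 3, 4}, {1, 2, 5}}"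
  proof -
    have "{..<6} // wilson_iso ?M = (\<lambda>i. wilson_iso ?M `` {i}) ` {..<6}" by (auto simp: quotient_def)
    also have "\<dots> = (\<lambda>i. if i \<in> {0, 3, 4} then {0, 3, 4} else {1, 2, 5}) ` {..<6::nat}"
      by (intro image_cong) (auto simp: im)
    also have "(\<lambda>i. if i \<in> {0, 3, 4} then a else b) ` {..<6 :: nat} = {a, b}" for a b :: "nat set"
    proof -
      have six: "{..<6 :: nat} = {0, 1, 2, 3, 4, 5}" by auto
      show ?thesis unfolding six by auto
    qed
    finally show ?thesis .
  qed
  have "{0, 3, 4} \<noteq> {1, 2, 5 :: nat}" by auto
  then have "card ({..<6} // wilson_iso ?M) = 2" unfolding quot by simp
  moreover have "\<forall>C \<in> {..<6} // wilson_iso ?M. card C = 3" unfolding quot by simp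
  ultimately show ?thesis using reflexible_generated_map[OF assms(1,2)] by (simp add: class_III_def)
qed

end

section \<open>Semilinear trialities\<close>

definition generates_class_III :: "('a, 'b) monoid_scheme \<Rightarrow> 'a \<Rightarrow> 'a \<Rightarrow> 'a \<Rightarrow> bool" where
  "generates_class_III G \<rho>\<^sub>0 \<rho>\<^sub>1 \<rho>\<^sub>2 \<longleftrightarrow>
    is_involution G \<rho>\<^sub>0 \<and> is_involution G \<rho>\<^sub>1 \<and> is_involution G \<rho>\<^sub>2 \<and>
    \<rho>\<^sub>0 \<otimes>\<^bsub>G\<^esub> \<rho>\<^sub>2 = \<rho>\<^sub>2 \<otimes>\<^bsub>G\<^esub> \<rho>\<^sub>0 \<and>
    generate G {\<rho>\<^sub>0, \<rho>\<^sub>1, \<rho>\<^sub>2} = carrier G \<and>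
    class_III (generated_map G \<rho>\<^sub>0 \<rho>\<^sub>1 \<rho>\<^sub>2)"

lemma correspondence_of_iso:
  fixes h :: "('a::field ^ 2 ^ 2) set \<Rightarrow> ('a ^ 2 ^ 2) set"
  assumes "finite (UNIV :: 'a set)" "h \<in> iso L2 L2"
  shows "SL2_correspondence (\<lambda>A B. det A = 1 \<and> det B = 1 \<and> h (proj A) = proj B)"
proof
  have hom: "h (proj A \<otimes>\<^bsub>L2\<^esub> proj B) = h (proj A) \<otimes>\<^bsub>L2\<^esub> h (proj B)" if "det A = 1" "det B = 1" for A B
    using assms(2) that by (auto simp: iso_def hom_def)
  have cl: "h (proj A) \<in> carrier L2" if "det A = 1" for A
    using assms(2) that by (auto simp: iso_def hom_def)
  have inj: "inj_on h (carrier L2)" using assms(2) by (simp add: iso_def bij_betw_def)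
  fix A B A' B' :: "'a ^ 2 ^ 2"
  show "det A = 1 \<and> det B = 1" if "det A = 1 \<and> det B = 1 \<and> h (proj A) = proj B" using that by blast
  show "\<exists>B. det A = 1 \<and> det B = 1 \<and> h (proj A) = proj B" if "det A = 1"
    using cl[OF that] that by (auto simp: carrier_L2)
  show "det (A ** A') = 1 \<and> det (B ** B') = 1 \<and> h (proj (A ** A')) = proj (B ** B')"
    if "det A = 1 \<and> det B = 1 \<and> h (proj A) = proj B" "det A' = 1 \<and> det B' = 1 \<and> h (proj A') = proj B'"
    using that hom[of A A'] by (simp add: mult_L2 det_mul)
  show "(det A = 1 \<and> det B' = 1 \<and> h (proj A) = proj B') = (B' = B \<or> B' = - B)"
    if "det A = 1 \<and> det B = 1 \<and> h (proj A) = proj B"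
    using that by (auto simp: proj_eq_iff)
  show "A' = A \<or> A' = - A"
    if "det A = 1 \<and> det B = 1 \<and> h (proj A) = proj B" "det A' = 1 \<and> det B = 1 \<and> h (proj A') = proj B"
  proof -
    have "h (proj A) = h (proj A')" using that by simp
    then have "proj A = proj A'" using inj that by (metis inj_onD proj_in_L2)
    then show ?thesis by (simp add: proj_eq_iff)
  qed
qed (rule assms(1))

context cubic_field
begin

lemma full_degree_power_q: "full_degree x \<Longrightarrow> full_degree (x ^ q)"
  unfolding full_degree_def
proof (intro allI impI)
  fix m assume x: "\<forall>m\<ge>1. x ^ (p ^ m) = x \<longrightarrow> 3 * e \<le> m" and m: "1 \<le> m" "(x ^ q) ^ (p ^ m) = x ^ q"
  have "(x ^ (p ^ m)) ^ q = (x ^ q) ^ (p ^ m)" by (simp add: power_mult[symmetric] mult.commute)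
  then have "(((x ^ (p ^ m)) ^ q) ^ q) ^ q = ((x ^ q) ^ q) ^ q" using m(2) by simp
  then have "x ^ (p ^ m) = x" by (simp only: power_q3)
  then show "3 * e \<le> m" using x m(1) by blast
qed

lemma full_degree_diff_2: "full_degree x \<Longrightarrow> full_degree (x - 2)"
proof -
  have two: "(2 :: 'a) ^ (p ^ m) = 2" for m
  proof -
    have "(1 + 1 :: 'a) ^ (p ^ m) = 1 + 1" by (simp only: frob_add[OF char[symmetric] p] power_one)
    then show ?thesis by simp
  qed
  show "full_degree x \<Longrightarrow> full_degree (x - 2)"
    unfolding full_degree_def frob_diff[OF char[symmetric] p] two by simp
qed

lemma full_degree_neq: "full_degree x \<Longrightarrow> x \<noteq> 0 \<and> x \<noteq> 4 \<and> x ^ q \<noteq> x"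
proof -
  assume x: "full_degree x"
  have pp: "p > 0" using p2 by simp
  have "3 * e \<le> m \<or> x ^ (p ^ m) \<noteq> x" if "m \<ge> 1" for m using x that by (auto simp: full_degree_def)
  from this[of 1] this[of e] have 1: "x ^ p \<noteq> x" "x ^ q \<noteq> x" using e by (auto simp: q_def)
  have "(2 + 2 :: 'a) ^ (p ^ 1) = 2 + 2"
  proof -
    have "((1 + 1) + (1 + 1) :: 'a) ^ (p ^ 1) = (1 + 1) + (1 + 1)" by (simp only: frob_add[OF char[symmetric] p] power_one)
    then show ?thesis by simp
  qed
  then have "(4 :: 'a) ^ p = 4" by simp
  then have "x \<noteq> 4" using 1(1) by blast
  moreover have "x \<noteq> 0" using 1(1) zero_power[OF pp] by metis
  ultimately show ?thesis using 1(2) by blast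
qed

definition frobenius :: "'a ^ 2 ^ 2 \<Rightarrow> 'a ^ 2 ^ 2" where
  "frobenius A = mat2 ((A $ 1 $ 1) ^ q) ((A $ 1 $ 2) ^ q) ((A $ 2 $ 1) ^ q) ((A $ 2 $ 2) ^ q)"

lemma frobenius_mat2 [simp]: "frobenius (mat2 a b c d) = mat2 (a ^ q) (b ^ q) (c ^ q) (d ^ q)"
  by (simp add: frobenius_def)

lemma frobenius_mult: "frobenius (A ** B) = frobenius A ** frobenius B"
  by (cases A rule: mat2_cases, cases B rule: mat2_cases) (simp add: power_q power_mult_distrib)

lemma frobenius_uminus: "frobenius (- A) = - frobenius A"
  by (cases A rule: mat2_cases) (simp add: power_q)

lemma frobenius_det: "det (frobenius A) = (det A) ^ q"
  by (cases A rule: mat2_cases) (simp add: power_q power_mult_distrib)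

lemma inj_frobenius: "inj frobenius"
proof (rule injI)
  have *: "x = y" if "x ^ q = y ^ q" for x y :: 'a using that by (metis power_q3)
  fix A B assume "frobenius A = frobenius B"
  then show "A = B" by (cases A rule: mat2_cases, cases B rule: mat2_cases) (auto dest: *)
qed

text \<open>An automorphism that swaps the outer involutions yields a field automorphism \<open>\<phi>\<close> with \<open>\<phi> a = a ^ q\<close> and
\<open>\<phi> (a ^ q) = a\<close> for the squared trace \<open>a\<close> of \<open>A ** R\<close>. Then \<open>a = \<phi> a ^ q = (a ^ q) ^ q\<close>, which is impossible for an element
of full degree.\<close>

theorem class_III_of_semilinear_triality:
  fixes A B R S :: "'a ^ 2 ^ 2"
  assumes det: "det A = 1" "det B = 1" "det R = 1" "det S = 1"
    and inv: "\<not> central A" "\<not> central B" "\<not> central R"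
      "A ** A = mat 1 \<or> A ** A = - mat 1" "B ** B = mat 1 \<or> B ** B = - mat 1" "R ** R = mat 1 \<or> R ** R = - mat 1"
    and comm: "A ** B = B ** A \<or> A ** B = - (B ** A)"
    and tri: "S ** frobenius A ** adj S = B" "S ** frobenius B ** adj S = A ** B" "S ** frobenius R ** adj S = R"
    and tr: "full_degree ((trace (A ** R))\<^sup>2)" "(trace (B ** R))\<^sup>2 = ((trace (A ** R))\<^sup>2) ^ q"
    and gen: "\<And>H. SL2_subgroup H \<Longrightarrow> A \<in> H \<Longrightarrow> B \<in> H \<Longrightarrow> R \<in> H \<Longrightarrow> H = {A. det A = 1}"
  shows "\<exists>\<rho>\<^sub>0 \<rho>\<^sub>1 \<rho>\<^sub>2. generates_class_III (L2 :: ('a ^ 2 ^ 2) set monoid) \<rho>\<^sub>0 \<rho>\<^sub>1 \<rho>\<^sub>2"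
proof -
  let ?L = "L2 :: ('a ^ 2 ^ 2) set monoid"
  have i: "is_involution ?L (proj A)" "is_involution ?L (proj R)" "is_involution ?L (proj B)"
    using det inv by (simp_all add: involution_L2)
  have c: "proj A \<otimes>\<^bsub>?L\<^esub> proj B = proj B \<otimes>\<^bsub>?L\<^esub> proj A"
    using comm by (auto simp: mult_L2 proj_eq_iff)
  interpret L: group ?L by (rule group_L2)
  have g: "generate ?L {proj A, proj R, proj B} = carrier ?L"
  proof
    have sub: "{proj A, proj R, proj B} \<subseteq> carrier ?L" using det by simp
    then show "generate ?L {proj A, proj R, proj B} \<subseteq> carrier ?L" by (rule L.generate_incl)
    have "{C. det C = 1 \<and> proj C \<in> generate ?L {proj A, proj R, proj B}} = {C. det C = 1}"
      by (rule gen[OF preimage_generate[OF finite_field sub]]) (use det in \<open>auto intro: generate.incl\<close>)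
    then show "carrier ?L \<subseteq> generate ?L {proj A, proj R, proj B}" by (auto simp: carrier_L2)
  qed
  interpret M: map_triple ?L "proj A" "proj R" "proj B"
    by unfold_locales (use i c g in simp_all)
  interpret U: SL2_subgroup "{A :: 'a ^ 2 ^ 2. det A = 1}"
    by unfold_locales (use finite_field in \<open>auto simp: det_mul\<close>)
  have finL: "finite (carrier ?L)" by (simp add: carrier_L2 U.finite_matrices)
  have AB: "proj A \<noteq> proj B"
  proof
    assume "proj A = proj B"
    then have "B = A \<or> B = - A" by (simp add: proj_eq_iff)
    then have "(trace (B ** R))\<^sup>2 = (trace (A ** R))\<^sup>2" by (auto simp: minus_mult)
    then show False using tr full_degree_neq by metis
  qed
  let ?T = "\<lambda>C. S ** frobenius C ** adj S"
  have T: "?T (C ** D) = ?T C ** ?T D" "?T (- C) = - ?T C" "det C = 1 \<Longrightarrow> det (?T C) = 1" for C D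
  proof -
    show "?T (C ** D) = ?T C ** ?T D"
      using det(4) by (simp add: frobenius_mult matrix_mul_assoc[symmetric] adj_cancel)
    have "S ** - E ** adj S = - (S ** E ** adj S)" for E
      by (cases S rule: mat2_cases, cases E rule: mat2_cases) (simp add: algebra_simps)
    then show "?T (- C) = - ?T C" by (simp add: frobenius_uminus)
    show "det C = 1 \<Longrightarrow> det (?T C) = 1" using det(4) by (simp add: det_mul frobenius_det)
  qed
  have injT: "inj ?T"
  proof (rule injI)
    fix C D assume "?T C = ?T D"
    then have "adj S ** ?T C ** S = adj S ** ?T D ** S" by simp
    then have "frobenius C = frobenius D" using det(4) by (simp add: matrix_mul_assoc[symmetric] adj_cancel adj_mult)
    then show "C = D" using inj_frobenius by (simp add: inj_def)
  qed
  note iT = iso_of_matrix_map[OF finite_field T injT]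
  have "class_III (generated_map ?L (proj A) (proj R) (proj B))"
  proof (rule M.class_III_of_triality[OF finL AB iT(1)])
    show "?T ` proj A = proj B" "?T ` proj R = proj R" "?T ` proj B = proj A \<otimes>\<^bsub>?L\<^esub> proj B"
      by (simp_all add: iT(2) tri mult_L2)
  next
    fix h assume h: "h \<in> iso ?L ?L" "h (proj A) = proj B" "h (proj B) = proj A" "h (proj R) = proj R"
    interpret C: SL2_correspondence "\<lambda>A B. det A = 1 \<and> det B = 1 \<and> h (proj A) = proj B"
      by (rule correspondence_of_iso[OF finite_field h(1)])
    obtain \<phi> where phi: "\<And>x y. \<phi> (x * y) = \<phi> x * \<phi> y" "\<phi> 1 = 1"
      "\<And>C D. det C = 1 \<and> det D = 1 \<and> h (proj C) = proj D \<Longrightarrow> (trace D)\<^sup>2 = \<phi> ((trace C)\<^sup>2)"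
      using C.trace_field_hom by metis
    define a where "a = (trace (A ** R))\<^sup>2"
    have pow: "\<phi> (x ^ n) = \<phi> x ^ n" for x n by (induction n) (simp_all add: phi)
    have "det (A ** R) = 1 \<and> det (B ** R) = 1 \<and> h (proj (A ** R)) = proj (B ** R)"
      using C.mult[of A B R R] det h by simp
    then have 1: "a ^ q = \<phi> a" using phi(3) tr(2) by (metis a_def)
    have "det (B ** R) = 1 \<and> det (A ** R) = 1 \<and> h (proj (B ** R)) = proj (A ** R)"
      using C.mult[of B A R R] det h by simp
    then have "a = \<phi> (a ^ q)" using phi(3) tr(2) by (metis a_def)
    then have "a = \<phi> a ^ q" by (simp only: pow)
    then have "a = (a ^ q) ^ q" by (simp only: 1)
    then have "a ^ q = a" by (metis power_q3)
    then show False using full_degree_neq tr(1) by (simp add: a_def)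
  qed
  with i c g show ?thesis unfolding generates_class_III_def by blast
qed

lemma SL2_of_full_degree:
  assumes H: "SL2_subgroup H"
    and no_fix: "\<And>P. P \<in> points \<Longrightarrow> card (finite_SL2_subgroup.orb (to_ac_mat ` H) P) \<noteq> 1"
    and no_pair: "\<And>P. P \<in> points \<Longrightarrow> card (finite_SL2_subgroup.orb (to_ac_mat ` H) P) \<noteq> 2"
    and two: "p = 2 \<Longrightarrow> \<exists>P \<in> points. card (finite_SL2_subgroup.pars (to_ac_mat ` H) P) \<ge> 2"
    and A: "A \<in> H" "full_degree ((trace A)\<^sup>2)"
  shows "H = {A. det A = 1}"
proof -
  interpret H: SL2_subgroup H by (rule H)
  show ?thesis
  proof (rule H.eq_SL2[OF char[symmetric] p no_fix no_pair two A(1)])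
    fix m assume m: "1 \<le> m" "((trace A)\<^sup>2 - 2) ^ (p ^ m) = (trace A)\<^sup>2 - 2"
    then have "3 * e \<le> m" using full_degree_diff_2[OF A(2)] by (auto simp: full_degree_def)
    then show "3 \<le> m \<and> CARD('a) \<le> p ^ m" using e p2 by (auto simp: card_field intro!: power_increasing)
  qed
qed

end

section \<open>The two kinds of characteristic\<close>

lemma traceless_square:
  fixes A :: "'a::field ^ 2 ^ 2"
  assumes "trace A = 0" "det A = 1" shows "A ** A = - mat 1"
proof (cases A rule: mat2_cases)
  fix a b c d assume A: "A = mat2 a b c d"
  then have d: "d = - a" using assms(1) by (simp add: eq_neg_iff_add_eq_0 add.commute)
  have "a * a + b * c = - (a * d - b * c)" by (simp add: d)
  also have "a * d - b * c = 1" using assms(2) unfolding A mat2_det .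
  finally have "a * a + b * c = -1" .
  then show ?thesis by (simp add: A d mat2_one algebra_simps)
qed

context cubic_field
begin

text \<open>The triality is the Frobenius map itself: it permutes the translations by the three conjugates of \<open>a\<close>, whose sum is zero, and
it fixes every matrix with entries 0 and 1.\<close>

theorem class_III_exists_char_two:
  assumes "p = 2"
  shows "\<exists>\<rho>\<^sub>0 \<rho>\<^sub>1 \<rho>\<^sub>2. generates_class_III (L2 :: ('a ^ 2 ^ 2) set monoid) \<rho>\<^sub>0 \<rho>\<^sub>1 \<rho>\<^sub>2"
proof -
  have two: "(2 :: 'a) = 0" using char assms by (metis of_nat_CHAR of_nat_numeral)
  then have neg: "- x = x" for x :: 'a by (metis add_eq_0_iff mult_2 mult_zero_left)
  obtain a where a: "a + a ^ q + (a ^ q) ^ q = 0" "full_degree a"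
    using exists_full_degree_char_two[OF assms] by (auto simp: trace_kernel_def)
  define b where "b = a ^ q"
  have aq: "a \<noteq> 0" "b \<noteq> a" using full_degree_neq[OF a(2)] by (simp_all add: b_def)
  have b0: "b \<noteq> 0" using full_degree_neq[OF full_degree_power_q[OF a(2)]] by (simp add: b_def)
  have ab: "a + b \<noteq> 0" using aq(2) neg[of a] by (metis eq_neg_iff_add_eq_0 add.commute)
  have bq: "b ^ q = a + b" using a(1) neg[of "a + b"] unfolding b_def by (metis eq_neg_iff_add_eq_0 add.commute)
  define W where "W = mat2 0 1 1 (0 :: 'a)"
  have qpos: "0 < q" using q2 by simp
  have fd: "full_degree (a\<^sup>2)" unfolding full_degree_def
  proof (intro allI impI)
    fix m assume m: "1 \<le> m" "(a\<^sup>2) ^ (p ^ m) = a\<^sup>2"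
    then have "(a ^ (p ^ m))\<^sup>2 = a\<^sup>2" by (simp add: power_mult[symmetric] mult.commute)
    then have "a ^ (p ^ m) = a" using neg by (auto simp: power2_eq_iff)
    then show "3 * e \<le> m" using a(2) m(1) by (simp add: full_degree_def)
  qed
  have gen: "H = {A. det A = 1}" if H: "SL2_subgroup H" "upper a \<in> H" "upper b \<in> H" "W \<in> H" for H
  proof -
    interpret H: SL2_subgroup H by (rule H(1))
    have m: "mat2 1 (to_ac a) 0 1 \<in> to_ac_mat ` H" "mat2 1 (to_ac b) 0 1 \<in> to_ac_mat ` H" "mat2 0 1 1 0 \<in> to_ac_mat ` H"
      using imageI[OF H(2), of to_ac_mat] imageI[OF H(3), of to_ac_mat] imageI[OF H(4), of to_ac_mat] by (simp_all add: W_def)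
    have nz: "to_ac a \<noteq> 0" "to_ac b \<noteq> 0" "to_ac a + to_ac b \<noteq> 0" "to_ac a \<noteq> to_ac b"
      using aq b0 ab by (simp_all flip: to_ac_add)
    note small = H.closure.no_small_orbit_char_two[OF m nz(1-3)]
    have "upper a ** W \<in> H" using H H.mult by blast
    moreover have "trace (upper a ** W) = a" by (simp add: W_def)
    moreover have "\<exists>P \<in> points. 2 \<le> card (H.closure.pars P)"
    proof (rule bexI)
      have "{upper (to_ac a), upper (to_ac b)} \<subseteq> H.closure.pars (line (vec2 1 0))"
        using m nz by (auto simp: H.closure.pars_def H.closure.stab_def parabolic_def central_def mat2_one)
      then have "card {upper (to_ac a), upper (to_ac b)} \<le> card (H.closure.pars (line (vec2 1 0)))"
        by (intro card_mono) auto
      then show "2 \<le> card (H.closure.pars (line (vec2 1 0)))" using nz(4) by simp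
    qed simp
    ultimately show ?thesis using SL2_of_full_degree[OF H(1) small, of "upper a ** W"] fd by simp
  qed
  show ?thesis
  proof (rule class_III_of_semilinear_triality[of "upper a" "upper b" W "mat 1", OF _ _ _ _ _ _ _ _ _ _ _ _ _ _ _ _ gen])
    show "det (upper a) = 1" "det (upper b) = 1" "det W = 1" "det (mat 1 :: 'a ^ 2 ^ 2) = 1"
      by (simp_all add: W_def neg)
    show "\<not> central (upper a)" "\<not> central (upper b)" "\<not> central W"
      using aq b0 by (simp_all add: central_def mat2_one W_def)
    show "upper a ** upper a = mat 1 \<or> upper a ** upper a = - mat 1"
      "upper b ** upper b = mat 1 \<or> upper b ** upper b = - mat 1"
      "W ** W = mat 1 \<or> W ** W = - mat 1"
      by (simp_all add: mat2_one W_def two)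
    show "upper a ** upper b = upper b ** upper a \<or> upper a ** upper b = - (upper b ** upper a)"
      by (simp add: add.commute)
    have one_adj: "adj (mat 1) = (mat 1 :: 'a ^ 2 ^ 2)" by (simp add: mat2_one)
    show "mat 1 ** frobenius (upper a) ** adj (mat 1) = upper b"
      "mat 1 ** frobenius (upper b) ** adj (mat 1) = upper a ** upper b"
      "mat 1 ** frobenius W ** adj (mat 1) = W"
      using qpos by (simp_all add: one_adj b_def[symmetric] bq W_def add.commute zero_power)
    show "full_degree ((trace (upper a ** W))\<^sup>2)" using fd by (simp add: W_def)
    show "(trace (upper b ** W))\<^sup>2 = ((trace (upper a ** W))\<^sup>2) ^ q"
      by (simp add: W_def b_def power_mult[symmetric] mult.commute)
  qed
qed

lemma two_neq_zero: "p \<noteq> 2 \<Longrightarrow> (2 :: 'a) \<noteq> 0"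
proof
  assume "p \<noteq> 2" "(2 :: 'a) = 0"
  then have "of_nat 2 = (0 :: 'a)" by simp
  then have "p dvd 2" using char by (simp only: of_nat_eq_0_iff_char_dvd)
  then show False using \<open>p \<noteq> 2\<close> p by (metis primes_dvd_imp_eq two_is_prime_nat)
qed

text \<open>More than half of the elements of the field with \<open>q\<close> elements are squares, so the squares meet the set of all \<open>-1 - y\<close>
for squares \<open>y\<close>.\<close>

lemma sum_of_squares_minus_one:
  assumes "p \<noteq> 2"
  obtains s t :: 'a where "s ^ q = s" "t ^ q = t" "s\<^sup>2 + t\<^sup>2 = -1"
proof -
  let ?F = "{x :: 'a. x ^ q = x}"
  have odd: "odd p" using assms p2 p by (simp add: prime_odd_nat)
  have fin: "finite S" for S :: "'a set" using finite_field by (rule finite_subset[OF subset_UNIV])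
  note two = two_neq_zero[OF assms]
  have cF: "card ?F \<ge> q"
  proof -
    let ?T = "\<lambda>x :: 'a. x + x ^ q + (x ^ q) ^ q"
    have im: "range ?T \<subseteq> ?F" by (auto simp: power_q power_q3 algebra_simps)
    let ?h = "Polynomial.monom 1 q + Polynomial.monom 1 1 :: 'a poly"
    have "q < q ^ 2" using q2 by (simp add: power2_eq_square)
    then have "Polynomial.degree ?h < q ^ 2" using q2 by (intro degree_add_less) (simp_all add: Polynomial.degree_monom_eq)
    note r = card_roots_le[OF this]
    have fib: "card {x. ?T x = y} \<le> q ^ 2" if "y \<in> range ?T" for y
    proof -
      from that obtain x where x: "y = ?T x" by blast
      have "bij_betw (\<lambda>w. w - x) {x. ?T x = y} {x. ?T x = 0}"
        by (rule bij_betw_byWitness[where f' = "\<lambda>w. x + w"]) (auto simp: x power_q algebra_simps)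
      then have "card {x. ?T x = y} = card {x. ?T x = 0}" by (rule bij_betw_same_card)
      also have "\<dots> \<le> card {x. x ^ (q ^ 2) + poly ?h x = 0}"
        by (intro card_mono r(1)) (auto simp: poly_monom power_mult[symmetric] power2_eq_square algebra_simps)
      finally show ?thesis using r(2) by linarith
    qed
    have "CARD('a) = (\<Sum>y\<in>range ?T. card {x. ?T x = y})"
      using sum.image_gen[OF finite_field, of "\<lambda>_. 1 :: nat" ?T] by simp
    also have "\<dots> \<le> (\<Sum>y\<in>range ?T. q ^ 2)" by (intro sum_mono fib)
    also have "\<dots> = card (range ?T) * q ^ 2" by simp
    also have "\<dots> \<le> card ?F * q ^ 2" using card_mono[OF fin im] by (intro mult_right_mono) auto
    finally have "q * q ^ 2 \<le> card ?F * q ^ 2"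
      by (simp add: card_field q_def power2_eq_square power_add[symmetric] numeral_3_eq_3 add.assoc)
    then show ?thesis using q2 by simp
  qed
  let ?S = "(\<lambda>x. x\<^sup>2) ` ?F"
  have fib: "card {x \<in> ?F. x\<^sup>2 = y} \<le> (if y = 0 then 1 else 2)" for y
  proof (cases "\<exists>x \<in> ?F. x\<^sup>2 = y")
    case True
    then obtain x where x: "x\<^sup>2 = y" by blast
    have "{x \<in> ?F. x\<^sup>2 = y} \<subseteq> {x, - x}" using x by (auto simp: power2_eq_iff)
    then have "card {x \<in> ?F. x\<^sup>2 = y} \<le> card {x, - x}" by (intro card_mono) auto
    also have "\<dots> \<le> (if y = 0 then 1 else 2)" using x by (auto simp: card_insert_if)
    finally show ?thesis .
  next
    case False
    then have none: "{x \<in> ?F. x\<^sup>2 = y} = {}" by blast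
    show ?thesis unfolding none by simp
  qed
  have "card ?F = (\<Sum>y\<in>?S. card {x \<in> ?F. x\<^sup>2 = y})"
    using sum.image_gen[OF fin, of "\<lambda>_. 1 :: nat" ?F "\<lambda>x. x\<^sup>2"] by simp
  also have "\<dots> \<le> (\<Sum>y\<in>?S. if y = 0 then 1 else 2)" by (intro sum_mono fib)
  also have "\<dots> = (\<Sum>y\<in>?S - {0}. 2) + 1"
  proof -
    have "0 \<in> ?S" using q2 by (intro image_eqI[of _ _ 0]) (auto simp: zero_power)
    then show ?thesis using sum.remove[OF fin, of 0 ?S "\<lambda>y. if y = 0 then 1 else 2 :: nat"] by simp
  qed
  also have "\<dots> = 2 * (card ?S - 1) + 1"
  proof -
    have "0 \<in> ?S" using q2 by (intro image_eqI[of _ _ 0]) (auto simp: zero_power)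
    then show ?thesis by simp
  qed
  finally have "card ?F \<le> 2 * (card ?S - 1) + 1" .
  moreover have "card ?S \<noteq> 0"
  proof -
    have "(0 :: 'a) \<in> ?F" using q2 by (simp add: zero_power)
    then have "?S \<noteq> {}" by blast
    then show ?thesis using fin by (simp only: card_eq_0_iff) simp
  qed
  ultimately have cS: "2 * card ?S \<ge> q + 1" using cF by linarith
  let ?N = "(\<lambda>y. -1 - y) ` ?S"
  have "card ?N = card ?S" by (intro card_image) (auto simp: inj_on_def)
  have F_sq: "x\<^sup>2 \<in> ?F" "-1 - x\<^sup>2 \<in> ?F" if "x \<in> ?F" for x
  proof -
    show "x\<^sup>2 \<in> ?F" using that by (simp add: power2_eq_square power_mult_distrib)
    then show "-1 - x\<^sup>2 \<in> ?F" by (simp add: power_q)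
  qed
  have "?S \<inter> ?N \<noteq> {}"
  proof
    assume "?S \<inter> ?N = {}"
    then have "card (?S \<union> ?N) = card ?S + card ?N" using fin by (intro card_Un_disjoint) auto
    moreover have "?S \<union> ?N \<subseteq> ?F" using F_sq by blast
    moreover have "card ?F \<le> q"
    proof -
      have "Polynomial.degree (- Polynomial.monom 1 1 :: 'a poly) < q" using q2 by (simp add: Polynomial.degree_monom_eq)
      note r = card_roots_le[OF this]
      have "?F \<subseteq> {x. x ^ q + poly (- Polynomial.monom 1 1) x = 0}" by (auto simp: poly_monom)
      then show ?thesis using card_mono[OF r(1)] r(2) by (meson le_trans)
    qed
    ultimately show False using cS \<open>card ?N = card ?S\<close> card_mono[OF fin, of "?S \<union> ?N" ?F] by linarith
  qed
  then obtain s t where st: "s \<in> ?F" "t \<in> ?F" "s\<^sup>2 = -1 - t\<^sup>2" by blast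
  then have "s\<^sup>2 + t\<^sup>2 = -1" by (simp add: algebra_simps)
  with st that show ?thesis by blast
qed

end

text \<open>If \<open>s\<^sup>2 + t\<^sup>2 = -1\<close>, then this is the quaternion \<open>x i + y j + w k\<close>, where \<open>i\<close>, \<open>j\<close>, \<open>k\<close> are the matrices with one
coordinate \<open>1\<close> and two coordinates \<open>0\<close>.\<close>

definition pure :: "'a::field \<Rightarrow> 'a \<Rightarrow> 'a \<Rightarrow> 'a \<Rightarrow> 'a \<Rightarrow> 'a ^ 2 ^ 2" where
  "pure s t x y w = mat2 (y * s + w * t) (x + y * t - w * s) (- x + y * t - w * s) (- (y * s + w * t))"

lemma pure_det: "s\<^sup>2 + t\<^sup>2 = -1 \<Longrightarrow> det (pure s t x y w) = x\<^sup>2 + y\<^sup>2 + w\<^sup>2"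
proof -
  assume st: "s\<^sup>2 + t\<^sup>2 = -1"
  have "det (pure s t x y w) = x\<^sup>2 - (y\<^sup>2 + w\<^sup>2) * (s\<^sup>2 + t\<^sup>2)" by (simp add: pure_def algebra_simps power2_eq_square)
  then show ?thesis by (simp add: st)
qed

lemma pure_trace: "trace (pure s t x y w) = 0" by (simp add: pure_def)

lemma pure_product_trace:
  assumes st: "s\<^sup>2 + t\<^sup>2 = -1"
  shows "trace (pure s t a b c ** pure s t x y w) = - 2 * (a * x + b * y + c * w)"
proof -
  have "trace (pure s t a b c ** pure s t x y w) = 2 * (b * y + c * w) * (s\<^sup>2 + t\<^sup>2) - 2 * (a * x)"
    by (simp add: pure_def algebra_simps power2_eq_square)
  also have "\<dots> = - 2 * (a * x + b * y + c * w)" unfolding st by (simp add: algebra_simps)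
  finally show ?thesis .
qed

lemma pure_basis_product:
  assumes st: "s\<^sup>2 + t\<^sup>2 = -1"
  shows "pure s t 1 0 0 ** pure s t 0 1 0 = pure s t 0 0 1"
    "pure s t 0 1 0 ** pure s t 1 0 0 = - pure s t 0 0 (1 :: 'a::field)"
  by (simp_all add: pure_def)

text \<open>This is the quaternion \<open>(1 + i + j + k) / 2\<close>.\<close>

definition rotation :: "'a::field \<Rightarrow> 'a \<Rightarrow> 'a ^ 2 ^ 2" where
  "rotation s t = mat2 ((1 + s + t) / 2) ((1 + t - s) / 2) ((- 1 + t - s) / 2) ((1 - s - t) / 2)"

lemma rotation_det:
  assumes st: "s\<^sup>2 + t\<^sup>2 = -1" and two: "(2 :: 'a::field) \<noteq> 0"
  shows "det (rotation s t :: 'a ^ 2 ^ 2) = 1"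
proof -
  define h :: 'a where "h = inverse 2"
  have h: "2 * h = 1" using two by (simp add: h_def)
  have "det (rotation s t) = h * h * (2 - 2 * (s\<^sup>2 + t\<^sup>2))"
    unfolding rotation_def divide_inverse h_def[symmetric] by (simp add: algebra_simps power2_eq_square)
  also have "\<dots> = (2 * h) * (2 * h)" unfolding st by (simp add: algebra_simps)
  finally show ?thesis by (simp only: h mult_1)
qed

lemma rotation_pure:
  assumes st: "s\<^sup>2 + t\<^sup>2 = -1" and two: "(2 :: 'a::field) \<noteq> 0"
  shows "rotation s t ** pure s t a b c ** adj (rotation s t) = pure s t c a (b :: 'a)"
proof -
  have tt: "t * t = - 1 - s * s" using st by (simp add: power2_eq_square algebra_simps)
  have tt': "t * (t * z) = - z - s * (s * z)" for z using arg_cong[OF tt, of "\<lambda>u. u * z"] by (simp add: algebra_simps)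
  have "rotation s t ** pure s t a b c = pure s t c a b ** rotation s t"
    using two by (simp add: rotation_def pure_def field_simps tt tt')
  then show ?thesis using rotation_det[OF assms] by (simp add: adj_cancel)
qed

lemma central_trace: "central A \<Longrightarrow> trace A = 2 \<or> trace A = - 2" for A :: "'a::field ^ 2 ^ 2"
  by (auto simp: central_def mat2_one)

context cubic_field
begin

lemma frobenius_pure:
  assumes "s ^ q = s" "t ^ q = t"
  shows "frobenius (pure s t x y w) = pure s t (x ^ q) (y ^ q) (w ^ q)"
  by (simp add: pure_def power_q power_mult_distrib assms)

text \<open>The equation for \<open>x\<close> says that \<open>x i + y j + w k\<close>, with the conjugates \<open>y\<close> and \<open>w\<close> of \<open>x\<close>, has determinant 1. It is
solved by \<open>x = n (1 + n) / (1 + n + n\<^sup>2)\<close> for the elements \<open>n\<close> with \<open>n ^ q = - (1 + n) / n\<close>. The quotient of \<open>x\<close>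
and its conjugate \<open>y\<close> is \<open>n\<close>, so that \<open>x\<^sup>2\<close> has full degree if \<open>n\<^sup>2\<close> has; and \<open>n\<close> has norm 1, whereas \<open>- n\<close> has norm \<open>-1\<close>,
so that \<open>n\<^sup>2\<close> has full degree if \<open>n\<close> has.\<close>

theorem class_III_exists_odd:
  assumes p_odd: "p \<noteq> 2"
  shows "\<exists>\<rho>\<^sub>0 \<rho>\<^sub>1 \<rho>\<^sub>2. generates_class_III (L2 :: ('a ^ 2 ^ 2) set monoid) \<rho>\<^sub>0 \<rho>\<^sub>1 \<rho>\<^sub>2"
proof -
  obtain s t :: 'a where st: "s ^ q = s" "t ^ q = t" "s\<^sup>2 + t\<^sup>2 = -1" using sum_of_squares_minus_one[OF p_odd] .
  note two = two_neq_zero[OF p_odd]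
  have qpos: "0 < q" using q2 by simp
  have two_q: "(2 :: 'a) ^ q = 2"
  proof -
    have "(1 + 1 :: 'a) ^ q = 1 + 1" by (simp only: power_q power_one)
    then show ?thesis by simp
  qed
  obtain n where n: "n ^ q * n + n + 1 = 0" "full_degree n"
    using exists_full_degree_odd[OF p_odd] by (auto simp: moebius_roots_def)
  have n0: "n \<noteq> 0" "n ^ q \<noteq> n" using full_degree_neq[OF n(2)] by auto
  (* if \<open>D\<close> vanished, then \<open>n\<close> would lie in the field with \<open>q\<close> elements *)
  define D where "D = 1 + n + n\<^sup>2"
  have D0: "D \<noteq> 0"
  proof
    assume "D = 0"
    then have "n ^ q * n + n + 1 = 1 + n + n\<^sup>2" using n(1) by (simp add: D_def)
    then have "n ^ q * n = n * n" by (simp add: power2_eq_square algebra_simps)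
    then show False using n0 by simp
  qed
  have n1: "1 + n \<noteq> 0"
  proof
    assume "1 + n = 0"
    moreover have "n ^ q * n + (1 + n) = 0" using n(1) by (simp add: add_ac)
    ultimately have "n ^ q * n = 0" by (simp only: add_0_right)
    then show False using n0(1) by simp
  qed
  have nq: "n ^ q = - (1 + n) / n"
  proof -
    have "n ^ q * n + (1 + n) = 0" using n(1) by (simp add: add_ac)
    then have "n ^ q * n = - (1 + n)" by (simp only: eq_neg_iff_add_eq_0)
    then show ?thesis using n0(1) by (simp add: field_simps)
  qed
  have nq1: "1 + n ^ q = - 1 / n" using n0(1) by (simp add: nq field_simps)
  have Dq: "D ^ q = D / n\<^sup>2"
  proof -
    have "D ^ q = 1 + n ^ q + (n ^ q)\<^sup>2" by (simp add: D_def power_q power2_eq_square power_mult_distrib)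
    also have "\<dots> = D / n\<^sup>2" using n0(1) unfolding nq1 nq D_def by (simp add: field_simps power2_eq_square)
    finally show ?thesis .
  qed
  define x where "x = n * (1 + n) / D"
  define y where "y = (1 + n) / D"
  define w where "w = - n / D"
  have xq: "x ^ q = y"
  proof -
    have "x ^ q = n ^ q * (1 + n ^ q) / D ^ q" by (simp add: x_def power_divide power_mult_distrib power_q)
    also have "\<dots> = y" unfolding nq1 Dq nq y_def using n0(1) D0 by (simp add: field_simps power2_eq_square)
    finally show ?thesis .
  qed
  have yq: "y ^ q = w"
  proof -
    have "y ^ q = (1 + n ^ q) / D ^ q" by (simp add: y_def power_divide power_q)
    also have "\<dots> = w" unfolding nq1 Dq w_def using n0(1) D0 by (simp add: field_simps power2_eq_square)
    finally show ?thesis .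
  qed
  have wq: "w ^ q = x" using power_q3[of x] by (simp add: xq yq)
  have sq: "x\<^sup>2 + y\<^sup>2 + w\<^sup>2 = 1"
  proof -
    have "(n * (1 + n))\<^sup>2 + (1 + n)\<^sup>2 + n\<^sup>2 = D\<^sup>2" by (simp add: D_def power2_eq_square algebra_simps)
    then have "((n * (1 + n))\<^sup>2 + (1 + n)\<^sup>2 + n\<^sup>2) / D\<^sup>2 = 1" using D0 by simp
    moreover have "x\<^sup>2 = (n * (1 + n))\<^sup>2 / D\<^sup>2" "y\<^sup>2 = (1 + n)\<^sup>2 / D\<^sup>2" "w\<^sup>2 = n\<^sup>2 / D\<^sup>2"
      by (simp_all only: x_def y_def w_def power_divide power2_minus)
    ultimately show ?thesis by (simp only: add_divide_distrib)
  qed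
  have yx: "y * n = x" by (simp add: x_def y_def mult.commute)
  have norm: "n * n ^ q * (n ^ q) ^ q = 1"
  proof -
    have "n ^ q \<noteq> 0" using n0(1) by simp
    have "(n ^ q * n + n + 1) ^ q = 0" using n(1) qpos by (simp add: zero_power)
    then have "(n ^ q) ^ q * n ^ q + n ^ q + 1 = 0" by (simp add: power_q power_mult_distrib)
    then have "(n ^ q) ^ q * n ^ q + (1 + n ^ q) = 0" by (simp only: add_ac)
    then have "(n ^ q) ^ q * n ^ q = - (1 + n ^ q)" by (simp only: eq_neg_iff_add_eq_0)
    then have "(n ^ q) ^ q * n ^ q = 1 / n" by (simp add: nq1)
    moreover have "n * n ^ q * (n ^ q) ^ q = n * ((n ^ q) ^ q * n ^ q)" by (simp only: mult_ac)
    ultimately show ?thesis using n0(1) by simp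
  qed
  define a where "a = (- 2 * x)\<^sup>2"
  have scale: "((- 2 * v)\<^sup>2) ^ q = (- 2 * v ^ q)\<^sup>2" for v :: 'a
  proof -
    have "(- (2 * v)) ^ q = - (2 * v ^ q)" by (simp only: power_q(2) power_mult_distrib two_q)
    moreover have "((- (2 * v))\<^sup>2) ^ q = ((- (2 * v)) ^ q)\<^sup>2" by (simp only: power2_eq_square power_mult_distrib)
    ultimately show ?thesis by (simp only: mult_minus_left)
  qed
  have aq: "a ^ q = (- 2 * y)\<^sup>2" by (simp only: a_def scale xq)
  have x0: "x \<noteq> 0" "y \<noteq> 0" using n0(1) n1 D0 by (simp_all add: x_def y_def)
  have "(- 2 * y)\<^sup>2 * n\<^sup>2 = (- 2 * x)\<^sup>2" unfolding yx[symmetric] by (simp only: power_mult_distrib mult_ac)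
  then have an: "a ^ q * n\<^sup>2 = a" by (simp only: aq) (simp only: a_def)
  have fd: "full_degree a" unfolding full_degree_def
  proof (intro allI impI)
    fix m assume m: "1 \<le> m" "a ^ (p ^ m) = a"
    (* a field automorphism that fixes \<open>a\<close>; it is shown to fix \<open>n\<close> *)
    define f where "f z = z ^ (p ^ m)" for z :: 'a
    have f_mult: "f (u * v) = f u * f v" and f_q: "f (u ^ q) = f u ^ q" for u v
      by (simp_all add: f_def power_mult_distrib power_mult[symmetric] mult.commute)
    have fa: "f a = a" using m(2) by (simp add: f_def)
    have "f (a ^ q * n\<^sup>2) = a" by (simp only: an fa)
    then have "a ^ q * (f n)\<^sup>2 = a" by (simp add: f_mult f_q fa power2_eq_square)
    then have "a ^ q * (f n)\<^sup>2 = a ^ q * n\<^sup>2" by (simp only: an)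
    moreover have "- 2 * y \<noteq> 0" using x0 two by simp
    then have "a ^ q \<noteq> 0" unfolding aq power_eq_0_iff by blast
    ultimately have "(f n)\<^sup>2 = n\<^sup>2" by (metis mult_cancel_left)
    then have "f n = n \<or> f n = - n" by (simp add: power2_eq_iff)
    moreover have "f n \<noteq> - n"
    proof
      assume fn: "f n = - n"
      have "1 = f (n * n ^ q * (n ^ q) ^ q)" by (simp add: norm f_def)
      also have "\<dots> = - (n * n ^ q * (n ^ q) ^ q)" by (simp add: f_mult f_q fn power_q)
      finally have "1 = (- 1 :: 'a)" unfolding norm .
      then show False using two by (metis add_eq_0_iff one_add_one)
    qed
    ultimately have "n ^ (p ^ m) = n" by (simp add: f_def)
    then show "3 * e \<le> m" using n(2) m(1) by (simp add: full_degree_def)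
  qed
  have nz: "- 2 * v \<noteq> 0 \<and> (- 2 * v)\<^sup>2 \<noteq> 4" if "v \<in> {x, y, w}" for v
  proof -
    have fx: "full_degree ((- 2 * x)\<^sup>2)" using fd by (simp only: a_def)
    have fy: "full_degree ((- 2 * y)\<^sup>2)" using full_degree_power_q[OF fd] by (simp only: aq)
    have "full_degree ((- 2 * w)\<^sup>2)" using full_degree_power_q[OF fy] by (simp only: scale yq)
    with fx fy that have "full_degree ((- 2 * v)\<^sup>2)" by (metis insertE singletonD)
    then have "(- 2 * v)\<^sup>2 \<noteq> 0" "(- 2 * v)\<^sup>2 \<noteq> 4" using full_degree_neq by blast+
    then show ?thesis by (metis zero_power2)
  qed
  let ?I = "pure s t 1 0 0" and ?J = "pure s t 0 1 0" and ?K = "pure s t 0 0 1" and ?R = "pure s t x y w"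
  have IJ: "?I ** ?J = ?K" "?J ** ?I = - ?K" using pure_basis_product[OF st(3)] .
  have det: "det ?I = 1" "det ?J = 1" "det ?R = 1" by (simp_all only: pure_det[OF st(3)] sq) simp_all
  have tr: "trace (?I ** ?R) = - 2 * x" "trace (?J ** ?R) = - 2 * y" "trace (?K ** ?R) = - 2 * w"
    by (simp_all add: pure_product_trace[OF st(3)])
  have gen: "H = {A. det A = 1}" if H: "SL2_subgroup H" "?I \<in> H" "?J \<in> H" "?R \<in> H" for H
  proof -
    interpret H: SL2_subgroup H by (rule H(1))
    have neq: "(1 :: 'a alg_closure) \<noteq> -1"
    proof
      assume "(1 :: 'a alg_closure) = -1"
      then have "to_ac (1 :: 'a) = to_ac (-1)" by simp
      then have "(1 :: 'a) = -1" by (simp only: to_ac_eq_iff)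
      then show False using two by (metis add_eq_0_iff one_add_one)
    qed
    have anti: "to_ac_mat ?I ** to_ac_mat ?J = - (to_ac_mat ?J ** to_ac_mat ?I)"
      by (simp add: to_ac_mat_mult[symmetric] to_ac_mat_uminus[symmetric] IJ)
    have nzm: "trace (M ** to_ac_mat ?R) \<noteq> 0 \<and> (trace (M ** to_ac_mat ?R))\<^sup>2 \<noteq> 4"
      if MI: "M \<in> {to_ac_mat ?I, to_ac_mat ?J, to_ac_mat ?I ** to_ac_mat ?J}" for M
    proof -
      have t: "trace (to_ac_mat ?I ** to_ac_mat ?R) = to_ac (- 2 * x)" "trace (to_ac_mat ?J ** to_ac_mat ?R) = to_ac (- 2 * y)"
        "trace (to_ac_mat ?I ** to_ac_mat ?J ** to_ac_mat ?R) = to_ac (- 2 * w)"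
        by (simp_all only: to_ac_mat_mult[symmetric] to_ac_mat_trace IJ tr)
      from MI have "M = to_ac_mat ?I \<or> M = to_ac_mat ?J \<or> M = to_ac_mat ?I ** to_ac_mat ?J" by blast
      then obtain v where v: "v \<in> {x, y, w}" "trace (M ** to_ac_mat ?R) = to_ac (- 2 * v)"
        using t by blast
      have "to_ac (- 2 * v) \<noteq> to_ac 0" "to_ac ((- 2 * v)\<^sup>2) \<noteq> to_ac 4"
        unfolding to_ac_eq_iff using nz[OF v(1)] by blast+
      then show ?thesis unfolding v(2) to_ac_power to_ac_0 to_ac_numeral by blast
    qed
    note small = H.closure.no_small_orbit_quaternion[OF neq imageI[OF H(2)] imageI[OF H(3)] imageI[OF H(4)] anti _ _ _ _ nzm]
    have tz: "trace (to_ac_mat ?I) = 0" "trace (to_ac_mat ?J) = 0" "trace (to_ac_mat ?I ** to_ac_mat ?J) = 0" "trace (to_ac_mat ?R) = 0"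
      by (simp_all add: to_ac_mat_mult[symmetric] IJ to_ac_mat_trace pure_trace)
    have IR: "?I ** ?R \<in> H" using H H.mult by blast
    show ?thesis
    proof (rule SL2_of_full_degree[OF H(1) _ _ _ IR])
      show "card (H.closure.orb P) \<noteq> 1" "card (H.closure.orb P) \<noteq> 2" if "P \<in> points" for P
        using small(1)[OF tz _ that] small(2)[OF tz _ that] by blast+
      show "full_degree ((trace (?I ** ?R))\<^sup>2)" using fd by (simp only: tr a_def)
    qed (use p_odd in simp)
  qed
  note rot = rotation_pure[OF st(3) two]
  show ?thesis
  proof (rule class_III_of_semilinear_triality[of ?I ?J ?R "rotation s t", OF _ _ _ _ _ _ _ _ _ _ _ _ _ _ _ _ gen])
    show "det ?I = 1" "det ?J = 1" "det ?R = 1" "det (rotation s t) = 1" using det rotation_det[OF st(3) two] by blast+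
    show "\<not> central ?I" "\<not> central ?J" "\<not> central ?R"
      using central_trace two by (metis pure_trace neg_equal_0_iff_equal)+
    show "?I ** ?I = mat 1 \<or> ?I ** ?I = - mat 1" "?J ** ?J = mat 1 \<or> ?J ** ?J = - mat 1"
      "?R ** ?R = mat 1 \<or> ?R ** ?R = - mat 1"
      using traceless_square[OF pure_trace] det by blast+
    show "?I ** ?J = ?J ** ?I \<or> ?I ** ?J = - (?J ** ?I)" by (simp add: IJ)
    show "rotation s t ** frobenius ?I ** adj (rotation s t) = ?J"
      "rotation s t ** frobenius ?J ** adj (rotation s t) = ?I ** ?J"
      "rotation s t ** frobenius ?R ** adj (rotation s t) = ?R"
      using qpos by (simp_all only: frobenius_pure[OF st(1,2)] rot IJ xq yq wq) (simp_all add: zero_power)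
    show "full_degree ((trace (?I ** ?R))\<^sup>2)" using fd by (simp only: tr a_def)
    show "(trace (?J ** ?R))\<^sup>2 = ((trace (?I ** ?R))\<^sup>2) ^ q" using aq by (simp only: tr a_def)
  qed
qed

end

theorem theorem3:
  fixes q :: nat
  assumes "primepow q"
    and "CARD('a::field) = q ^ 3"
  shows "\<exists>\<rho>\<^sub>0 \<rho>\<^sub>1 \<rho>\<^sub>2.
    is_involution (L2 :: ('a ^ 2 ^ 2) set monoid) \<rho>\<^sub>0 \<and>
    is_involution (L2 :: ('a ^ 2 ^ 2) set monoid) \<rho>\<^sub>1 \<and>
    is_involution (L2 :: ('a ^ 2 ^ 2) set monoid) \<rho>\<^sub>2 \<and>
    \<rho>\<^sub>0 \<otimes>\<^bsub>L2\<^esub> \<rho>\<^sub>2 = \<rho>\<^sub>2 \<otimes>\<^bsub>L2\<^esub> \<rho>\<^sub>0 \<and>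
    generate L2 {\<rho>\<^sub>0, \<rho>\<^sub>1, \<rho>\<^sub>2} = carrier L2 \<and>
    class_III (generated_map L2 \<rho>\<^sub>0 \<rho>\<^sub>1 \<rho>\<^sub>2)"
proof -
  obtain p e where pe: "prime p" "e > 0" "q = p ^ e" using assms(1) by (auto simp: primepow_def)
  interpret cubic_field p e "TYPE('a)"
    by unfold_locales (use pe assms(2) in \<open>auto simp: power_mult[symmetric] mult.commute\<close>)
  show ?thesis using class_III_exists_char_two class_III_exists_odd
    unfolding generates_class_III_def by blast
qed

end
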